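(* Let $\ell\ge2$ and let $X$ be a closed hyperbolic $3$-manifold that fibers over the circle with fiber $\Sigma_\ell$. Write $G_\psi=\pi_1(X)=G_\ell\rtimes_\psi\mathbb{Z}$ with $\psi\in\mathrm{Aut}_+(G_\ell)$, and let $N_\psi$ be the kernel of the surjection $p_\psi\colon G_\psi\to\mathbb{Z}^{2\ell}\rtimes_{s_\ell(\psi)}\mathbb{Z}$ induced by the abelianization map $G_\ell\to\mathbb{Z}^{2\ell}$. Then $\mathrm{scl}_{G_\psi}$ and $\mathrm{scl}_{G_\psi,N_\psi}$ are not equivalent.
   Context: $\Sigma_\ell$ is a closed connected oriented surface of genus $\ell$ and $G_\ell=\pi_1(\Sigma_\ell)$. $\mathrm{Aut}_+(G_\ell)$ is the group of orientation-preserving automorphisms of $G_\ell$, and $s_\ell\colon\mathrm{Aut}_+(G_\ell)\to\mathrm{Sp}(2\ell,\mathbb{Z})$ is the symplectic representation, i.e. the induced action on the abelianization $\mathbb{Z}^{2\ell}$ of $G_\ell$. The manifold $X$ is the mapping torus of a pseudo-Anosov diffeomorphism $f_\psi$ of $\Sigma_\ell$ inducing $\psi$, and $\pi_1(X)$ has the presentation $\langle G_\ell,c\mid \psi(\gamma)c\gamma^{-1}c^{-1}\ (\gamma\in G_\ell)\rangle=G_\ell\rtimes_\psi\mathbb{Z}$. One has $N_\psi=\iota(G_\ell')$, where $\iota\colon G_\ell\to G_\psi$ is the natural inclusion and $G_\ell'$ is the commutator subgroup of $G_\ell$. Write $[g,h]=ghg^{-1}h^{-1}$. For a group $G$ and a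 normal subgroup $N$, $[G,N]$ is the subgroup generated by the mixed commutators $[g,w]$ with $g\in G$, $w\in N$. For $x\in[G,N]$, $\mathrm{cl}_{G,N}(x)$ is the least number of mixed commutators whose product is $x$, and $\mathrm{scl}_{G,N}(x)=\lim_{m\to\infty}\mathrm{cl}_{G,N}(x^m)/m$. For $N=G$ one writes $\mathrm{scl}_G=\mathrm{scl}_{G,G}$, the usual stable commutator length on $[G,G]$. $\mathrm{scl}_G$ and $\mathrm{scl}_{G,N}$ are called equivalent if there is a real constant $C>0$ such that $\mathrm{scl}_{G,N}(x)\le C\cdot\mathrm{scl}_G(x)$ for every $x\in[G,N]$. *)

theory Defs
  imports "HOL-Analysis.Analysis" "HOL-Algebra.Bij" "HOL-Algebra.Generated_Groups"
begin

section \<open>Fundamental groups\<close>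

text \<open>An element of the fundamental group of \<open>S\<close> at \<open>s\<close> is the set of all paths homotopic in
  \<open>S\<close> (relative to the endpoints) to some loop at \<open>s\<close>. As in the path library, a path is a
  function on all of the reals of which only the restriction to the unit interval matters.\<close>

definition path_class :: "'a::topological_space set \<Rightarrow> (real \<Rightarrow> 'a) \<Rightarrow> (real \<Rightarrow> 'a) set" where
  "path_class S p = {q. homotopic_paths S p q}"

definition fundamental_group ::
  "'a::topological_space set \<Rightarrow> 'a \<Rightarrow> (real \<Rightarrow> 'a) set monoid" where
  "fundamental_group S s =
     \<lparr>carrier = path_class S ` {p. path p \<and> path_image p \<subseteq> S \<and> pathstart p = s \<and> pathfinish p = s},
      mult = (\<lambda>A B. {r. \<exists>p\<in>A. \<exists>q\<in>B. homotopic_paths S (p +++ q) r}),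
      one = path_class S (\<lambda>_. s)\<rparr>"

definition fundamental_group_map ::
  "'b::topological_space set \<Rightarrow> ('a::topological_space \<Rightarrow> 'b) \<Rightarrow> (real \<Rightarrow> 'a) set \<Rightarrow> (real \<Rightarrow> 'b) set" where
  "fundamental_group_map X f A = {r. \<exists>p\<in>A. homotopic_paths X (f \<circ> p) r}"


section \<open>Closed oriented surfaces\<close>

text \<open>The boundary circle of the closed unit disc is divided into \<open>4 * l\<close> arcs, the \<open>k\<close>-th one
  being parametrised by \<open>t \<mapsto> cis (2 * pi * (k + t) / (4 * l))\<close>, and the arcs are glued in
  pairs according to the word \<open>a\<^sub>1 b\<^sub>1 a\<^sub>1\<inverse> b\<^sub>1\<inverse> \<dots> a\<^sub>l b\<^sub>l a\<^sub>l\<inverse> b\<^sub>l\<inverse>\<close>: arc \<open>4 * j\<close> with the reverse of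
  arc \<open>4 * j + 2\<close>, and arc \<open>4 * j + 1\<close> with the reverse of arc \<open>4 * j + 3\<close>. For \<open>l \<ge> 1\<close> the
  quotient is the closed connected oriented surface of genus \<open>l\<close>.\<close>

definition polygon_point :: "nat \<Rightarrow> real \<Rightarrow> complex" where
  "polygon_point l u = cis (2 * pi * u / (4 * real l))"

inductive side_pairing :: "nat \<Rightarrow> complex \<Rightarrow> complex \<Rightarrow> bool" for l :: nat where
  side_a: "j < l \<Longrightarrow> 0 \<le> t \<Longrightarrow> t \<le> 1 \<Longrightarrow>
     side_pairing l (polygon_point l (4 * real j + t)) (polygon_point l (4 * real j + 3 - t))"
| side_b: "j < l \<Longrightarrow> 0 \<le> t \<Longrightarrow> t \<le> 1 \<Longrightarrow>
     side_pairing l (polygon_point l (4 * real j + 1 + t)) (polygon_point l (4 * real j + 4 - t))"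

definition closed_surface_of_genus :: "nat \<Rightarrow> 'a::topological_space set \<Rightarrow> bool" where
  "closed_surface_of_genus l S \<longleftrightarrow>
     (\<exists>q. quotient_map (top_of_set (cball (0::complex) 1)) (top_of_set S) q \<and>
          (\<forall>z\<in>cball 0 1. \<forall>w\<in>cball 0 1. q z = q w \<longleftrightarrow> equivclp (side_pairing l) z w))"


section \<open>Closed hyperbolic 3-manifolds\<close>

text \<open>The upper half-space model, with \<open>cosh d(x, y) = 1 + |x - y|\<^sup>2 / (2 x\<^sub>3 y\<^sub>3)\<close>. The subspace
  topology of the half-space is the one induced by this metric.\<close>

definition hyp_space :: "(complex \<times> real) set" where
  "hyp_space = {x. 0 < snd x}"

definition hyp_dist :: "complex \<times> real \<Rightarrow> complex \<times> real \<Rightarrow> real" where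
  "hyp_dist x y = arcosh (1 + (dist x y)\<^sup>2 / (2 * snd x * snd y))"

definition hyp_isometries :: "(complex \<times> real \<Rightarrow> complex \<times> real) set" where
  "hyp_isometries =
     {f \<in> Bij hyp_space. \<forall>x\<in>hyp_space. \<forall>y\<in>hyp_space. hyp_dist (f x) (f y) = hyp_dist x y}"

definition closed_hyperbolic_3_manifold :: "'a::topological_space set \<Rightarrow> bool" where
  "closed_hyperbolic_3_manifold X \<longleftrightarrow> compact X \<and>
     (\<exists>\<Gamma> q. subgroup \<Gamma> (BijGroup hyp_space) \<and> \<Gamma> \<subseteq> hyp_isometries \<and>
        (\<forall>g\<in>\<Gamma>. \<forall>x\<in>hyp_space. g x = x \<longrightarrow> g = \<one>\<^bsub>BijGroup hyp_space\<^esub>) \<and>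
        (\<forall>K. compact K \<and> K \<subseteq> hyp_space \<longrightarrow> finite {g \<in> \<Gamma>. g ` K \<inter> K \<noteq> {}}) \<and>
        quotient_map (top_of_set hyp_space) (top_of_set X) q \<and>
        (\<forall>x\<in>hyp_space. \<forall>y\<in>hyp_space. q x = q y \<longleftrightarrow> (\<exists>g\<in>\<Gamma>. y = g x)))"


section \<open>Fibre bundles\<close>

definition fibre_bundle ::
  "'x::topological_space set \<Rightarrow> ('x \<Rightarrow> 'b::topological_space) \<Rightarrow> 'b set \<Rightarrow> 'f::topological_space set \<Rightarrow> bool" where
  "fibre_bundle X p B F \<longleftrightarrow> continuous_on X p \<and> p ` X = B \<and>
     (\<forall>b\<in>B. \<exists>U h k. b \<in> U \<and> openin (top_of_set B) U \<and>
        homeomorphism (U \<times> F) (X \<inter> p -` U) h k \<and> (\<forall>u\<in>U. \<forall>y\<in>F. p (h (u, y)) = u))"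


section \<open>Orientation-preserving automorphisms\<close>

text \<open>An orientation of a closed aspherical surface with fundamental group \<open>G\<close> is a generator of
  \<open>H\<^sup>2(G; \<int>) \<cong> \<int>\<close>, so an automorphism preserves the orientation iff it acts trivially on
  \<open>H\<^sup>2(G; \<int>)\<close>. The cohomology is that of the inhomogeneous cochain complex.\<close>

definition int_cocycle2 :: "('a, 'b) monoid_scheme \<Rightarrow> ('a \<Rightarrow> 'a \<Rightarrow> int) \<Rightarrow> bool" where
  "int_cocycle2 G c \<longleftrightarrow>
     (\<forall>f\<in>carrier G. \<forall>g\<in>carrier G. \<forall>h\<in>carrier G.
        c g h - c (f \<otimes>\<^bsub>G\<^esub> g) h + c f (g \<otimes>\<^bsub>G\<^esub> h) - c f g = 0)"

definition int_coboundary2 :: "('a, 'b) monoid_scheme \<Rightarrow> ('a \<Rightarrow> 'a \<Rightarrow> int) \<Rightarrow> bool" where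
  "int_coboundary2 G c \<longleftrightarrow>
     (\<exists>b. \<forall>g\<in>carrier G. \<forall>h\<in>carrier G. c g h = b h - b (g \<otimes>\<^bsub>G\<^esub> h) + b g)"

definition Aut_plus :: "('a, 'b) monoid_scheme \<Rightarrow> ('a \<Rightarrow> 'a) set" where
  "Aut_plus G = {\<psi> \<in> auto G. \<forall>c. int_cocycle2 G c \<longrightarrow>
     int_coboundary2 G (\<lambda>g h. c (\<psi> g) (\<psi> h) - c g h)}"


section \<open>Semidirect products with the integers\<close>

text \<open>In \<open>G \<rtimes>\<^sub>\<psi> \<int>\<close> the element \<open>c = (1, 1)\<close> satisfies \<open>c \<gamma> c\<inverse> = \<psi>(\<gamma>)\<close>.\<close>

definition semidirect_int :: "('a, 'b) monoid_scheme \<Rightarrow> ('a \<Rightarrow> 'a) \<Rightarrow> ('a \<times> int) monoid" where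
  "semidirect_int G \<psi> =
     \<lparr>carrier = carrier G \<times> UNIV,
      mult = (\<lambda>(g, m) (h, n). (g \<otimes>\<^bsub>G\<^esub> (\<psi> [^]\<^bsub>AutoGroup G\<^esub> m) h, m + n)),
      one = (\<one>\<^bsub>G\<^esub>, 0)\<rparr>"

abbreviation abelianization :: "('a, 'b) monoid_scheme \<Rightarrow> 'a set monoid" where
  "abelianization G \<equiv> G Mod (derived G (carrier G))"

text \<open>The action on the abelianization induced by an automorphism, which for a surface group is
  the symplectic representation. Elements of the abelianization are cosets.\<close>

definition induced_action :: "('a, 'b) monoid_scheme \<Rightarrow> ('a \<Rightarrow> 'a) \<Rightarrow> 'a set \<Rightarrow> 'a set" where
  "induced_action G \<psi> = (\<lambda>A\<in>carrier (abelianization G). \<psi> ` A)"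

definition abelianized_semidirect ::
  "('a, 'b) monoid_scheme \<Rightarrow> ('a \<Rightarrow> 'a) \<Rightarrow> ('a set \<times> int) monoid" where
  "abelianized_semidirect G \<psi> = semidirect_int (abelianization G) (induced_action G \<psi>)"

definition proj :: "('a, 'b) monoid_scheme \<Rightarrow> 'a \<times> int \<Rightarrow> 'a set \<times> int" where
  "proj G = (\<lambda>(g, m). (derived G (carrier G) #>\<^bsub>G\<^esub> g, m))"

definition N_sub :: "('a, 'b) monoid_scheme \<Rightarrow> ('a \<Rightarrow> 'a) \<Rightarrow> ('a \<times> int) set" where
  "N_sub G \<psi> = kernel (semidirect_int G \<psi>) (abelianized_semidirect G \<psi>) (proj G)"


section \<open>Mixed stable commutator length\<close>

definition mixed_commutators :: "('a, 'b) monoid_scheme \<Rightarrow> 'a set \<Rightarrow> 'a set" where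
  "mixed_commutators G N =
     {g \<otimes>\<^bsub>G\<^esub> w \<otimes>\<^bsub>G\<^esub> inv\<^bsub>G\<^esub> g \<otimes>\<^bsub>G\<^esub> inv\<^bsub>G\<^esub> w | g w. g \<in> carrier G \<and> w \<in> N}"

definition mixed_commutator_subgroup :: "('a, 'b) monoid_scheme \<Rightarrow> 'a set \<Rightarrow> 'a set" where
  "mixed_commutator_subgroup G N = generate G (mixed_commutators G N)"

text \<open>For normal \<open>N\<close> the inverse of a mixed commutator is again a mixed commutator, so every
  element of the mixed commutator subgroup is a product of mixed commutators.\<close>

definition mixed_cl :: "('a, 'b) monoid_scheme \<Rightarrow> 'a set \<Rightarrow> 'a \<Rightarrow> nat" where
  "mixed_cl G N x =
     (LEAST n. \<exists>cs. length cs = n \<and> set cs \<subseteq> mixed_commutators G N \<and>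
                    foldr (\<lambda>a b. a \<otimes>\<^bsub>G\<^esub> b) cs \<one>\<^bsub>G\<^esub> = x)"

definition mixed_scl :: "('a, 'b) monoid_scheme \<Rightarrow> 'a set \<Rightarrow> 'a \<Rightarrow> real" where
  "mixed_scl G N x = lim (\<lambda>m::nat. real (mixed_cl G N (x [^]\<^bsub>G\<^esub> m)) / real m)"

abbreviation scl :: "('a, 'b) monoid_scheme \<Rightarrow> 'a \<Rightarrow> real" where
  "scl G \<equiv> mixed_scl G (carrier G)"

definition scl_equivalent :: "('a, 'b) monoid_scheme \<Rightarrow> 'a set \<Rightarrow> bool" where
  "scl_equivalent G N \<longleftrightarrow>
     (\<exists>C>0. \<forall>x\<in>mixed_commutator_subgroup G N. mixed_scl G N x \<le> C * scl G x)"

end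

theory Submission
  imports Defs
begin

text \<open>
  Write \<open>[a\<^sub>1,b\<^sub>1] \<dots> [a\<^sub>l,b\<^sub>l] = 1\<close> for the relation of the surface group. The elements
  \<open>x\<^sub>n = [a\<^sub>1\<^sup>n,b\<^sub>1] \<dots> [a\<^sub>l\<^sup>n,b\<^sub>l]\<close> separate the two norms. Each is a product of \<open>l\<close> commutators, so its
  stable commutator length is at most \<open>l\<close>. Modulo the mixed commutator subgroup the kernel \<open>N\<close> becomes
  central, commutators become bilinear and \<open>x\<^sub>n\<close> becomes the \<open>n\<close>-th power of the relation, so \<open>x\<^sub>n\<close> does
  have a stable mixed commutator length (\<open>powered_relation\<close>). It remains to see that this length grows
  linearly with \<open>n\<close>.

  The lower bound comes from the Euler class. There is an integer-valued \<open>\<beta>\<close> on the surface group such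
  that \<open>\<beta> (g h) = \<beta> g + \<beta> h + E g h\<close> up to a bounded error, where \<open>E\<close> is the intersection form on the
  abelianization; in other words, the intersection form is a bounded class. Since \<open>E\<close> vanishes as
  soon as one argument is a product of commutators, \<open>\<beta>\<close> is a quasimorphism on the commutator subgroup
  and is invariant under conjugation up to a bounded error, but \<open>\<beta> [a\<^sup>n,b]\<close> is close to \<open>2 n E a b\<close>.
  To construct \<open>\<beta>\<close>, the surface group is mapped to a group of automorphisms of the universal cover
  of the projective line, multiplied by a Heisenberg group; the relation is sent to an element of
  the centre on which the displacement of a base point and the central coordinate of the
  Heisenberg group cancel (\<open>euler_data\<close>).

  The monodromy \<open>\<psi>\<close> does not preserve \<open>\<beta>\<close>, but it preserves \<open>E\<close>: an automorphism that acts trivially on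
  \<open>H\<^sup>2\<close> preserves the cup product on \<open>H\<^sup>1\<close>, and \<open>E\<close> is dual to it (\<open>intersection_invariant\<close>). Therefore the
  coboundary of \<open>\<beta> \<circ> \<psi>\<^sup>k - \<beta>\<close> is bounded independently of \<open>k\<close>, and \<open>\<beta>\<close> is bounded on the \<open>\<psi>\<close>-orbit of each
  element of the commutator subgroup (\<open>displacement_bounded\<close>). Let \<open>c\<close> be the stable letter. On the
  mixed commutator of \<open>g c\<^sup>m\<close> with \<open>w\<close>, moved by \<open>\<psi>\<^sup>k\<close>, the value of \<open>\<beta>\<close> is
  \<open>\<beta> (\<psi>\<^sup>k\<^sup>+\<^sup>m w) - \<beta> (\<psi>\<^sup>k w)\<close> up to a bounded error. Averaged over \<open>k\<close>, these differences telescope to zero,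
  so a product of \<open>r\<close> mixed commutators has average \<open>O(r)\<close>; the \<open>m\<close>-th power of \<open>x\<^sub>n\<close> has average about
  \<open>2 l n m\<close> (\<open>mixed_scl_lower_bound\<close>, \<open>not_scl_equivalent\<close>).

  The topology of the surface enters through \<open>surface_group_presentation\<close>: its fundamental group has
  generators with the relation above, and any solution of the relation in any group is the image
  of these generators under a homomorphism. Both halves rest on neighbourhoods in the polygon
  that contract compatibly with the gluings (\<open>star\<close>). Generators are the loops that cross one side
  of the polygon (\<open>crossings_generate\<close>), and homomorphisms are the holonomies of labellings of the
  sides (\<open>hom_of_labels\<close>).
\<close>

section \<open>Stable mixed commutator length\<close>

text \<open>Comparing \<open>f n\<close> with the values at the quotient and the remainder of \<open>n\<close> by a fixed \<open>k\<close> shows that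
  the infimum of \<open>f k / k\<close> is the limit.\<close>

lemma fekete_convergent:
  fixes f :: "nat \<Rightarrow> real"
  assumes sub: "\<And>m n. f (m + n) \<le> f m + f n" and nonneg: "\<And>n. 0 \<le> f n"
  shows "convergent (\<lambda>n. f n / real n)"
proof -
  define L where "L = (INF n\<in>{1..}. f n / real n)"
  have bdd: "bdd_below ((\<lambda>n. f n / real n) ` {1..})"
    by (rule bdd_belowI2[of _ 0]) (simp add: nonneg)
  have lower: "L \<le> f n / real n" if "n \<ge> 1" for n
    unfolding L_def by (rule cINF_lower[OF bdd]) (use that in auto)
  have mult: "f (q * k + r) \<le> real q * f k + f r" for q k r
  proof (induction q)
    case (Suc q)
    have "f (Suc q * k + r) = f (k + (q * k + r))" by (simp add: algebra_simps)
    also have "\<dots> \<le> f k + f (q * k + r)" by (rule sub)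
    also have "\<dots> \<le> f k + (real q * f k + f r)" using Suc by simp
    finally show ?case by (simp add: algebra_simps)
  qed simp
  have "(\<lambda>n. f n / real n) \<longlonglongrightarrow> L"
  proof (rule LIMSEQ_I)
    fix e :: real assume e: "0 < e"
    obtain k where k: "k \<ge> 1" "f k / real k < L + e / 2"
    proof -
      have "\<exists>x\<in>(\<lambda>n. f n / real n) ` {1..}. x < L + e / 2"
        unfolding L_def by (rule cInf_lessD) (use e in auto)
      then show thesis using that by auto
    qed
    define M where "M = (\<Sum>r<k. f r)"
    have M: "f r \<le> M" if "r < k" for r
      unfolding M_def by (rule member_le_sum) (use that nonneg in auto)
    have M0: "0 \<le> M" unfolding M_def by (rule sum_nonneg) (simp add: nonneg)
    obtain n0 :: nat where n0: "2 * M / e < real n0" using reals_Archimedean2 by blast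
    show "\<exists>no. \<forall>n\<ge>no. norm (f n / real n - L) < e"
    proof (intro exI allI impI)
      fix n assume n: "n \<ge> max 1 n0"
      have np: "0 < real n" using n by simp
      have "f n = f (n div k * k + n mod k)" by simp
      also have "\<dots> \<le> real (n div k) * f k + f (n mod k)" by (rule mult)
      also have "\<dots> \<le> real (n div k) * f k + M" using M[of "n mod k"] k by simp
      also have "real (n div k) * f k \<le> real n / real k * f k"
        by (rule mult_right_mono[OF _ nonneg]) (rule of_nat_div_le_of_nat)
      finally have "f n \<le> real n * (f k / real k) + M" by simp
      then have "f n / real n \<le> f k / real k + M / real n" using np by (simp add: field_simps)
      moreover have "M / real n < e / 2"
      proof -
        have "2 * M / e < real n" using n n0 by linarith
        then show ?thesis using e np by (simp add: field_simps)
      qed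
      ultimately have "f n / real n < L + e" using k by linarith
      then show "norm (f n / real n - L) < e" using lower[of n] n by simp
    qed
  qed
  then show ?thesis by (rule convergentI)
qed

definition comm :: "('a, 'b) monoid_scheme \<Rightarrow> 'a \<Rightarrow> 'a \<Rightarrow> 'a" where
  "comm G x y = x \<otimes>\<^bsub>G\<^esub> y \<otimes>\<^bsub>G\<^esub> inv\<^bsub>G\<^esub> x \<otimes>\<^bsub>G\<^esub> inv\<^bsub>G\<^esub> y"

primrec comm_prod :: "('a, 'b) monoid_scheme \<Rightarrow> (nat \<Rightarrow> 'a) \<Rightarrow> (nat \<Rightarrow> 'a) \<Rightarrow> nat \<Rightarrow> 'a" where
  "comm_prod G a b 0 = \<one>\<^bsub>G\<^esub>"
| "comm_prod G a b (Suc n) = comm_prod G a b n \<otimes>\<^bsub>G\<^esub> comm G (a n) (b n)"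

abbreviation list_prod :: "('a, 'b) monoid_scheme \<Rightarrow> 'a list \<Rightarrow> 'a" where
  "list_prod G cs \<equiv> foldr (\<lambda>a b. a \<otimes>\<^bsub>G\<^esub> b) cs \<one>\<^bsub>G\<^esub>"

context group
begin

lemma inv_cancel_left [simp]:
  "x \<in> carrier G \<Longrightarrow> y \<in> carrier G \<Longrightarrow> inv x \<otimes> (x \<otimes> y) = y"
  "x \<in> carrier G \<Longrightarrow> y \<in> carrier G \<Longrightarrow> x \<otimes> (inv x \<otimes> y) = y"
  by (simp_all flip: m_assoc)

lemma comm_closed [simp, intro]:
  "x \<in> carrier G \<Longrightarrow> y \<in> carrier G \<Longrightarrow> comm G x y \<in> carrier G"
  by (simp add: comm_def)

lemma comm_mult: "x \<in> carrier G \<Longrightarrow> y \<in> carrier G \<Longrightarrow> comm G x y \<otimes> (y \<otimes> x) = x \<otimes> y"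
  by (simp add: comm_def m_assoc)

lemma comm_prod_closed:
  "(\<And>i. i < n \<Longrightarrow> a i \<in> carrier G) \<Longrightarrow> (\<And>i. i < n \<Longrightarrow> b i \<in> carrier G) \<Longrightarrow> comm_prod G a b n \<in> carrier G"
  by (induction n) auto

lemma list_prod_closed [simp]: "set cs \<subseteq> carrier G \<Longrightarrow> list_prod G cs \<in> carrier G"
  by (induction cs) auto

lemma list_prod_append:
  "set cs \<subseteq> carrier G \<Longrightarrow> set ds \<subseteq> carrier G \<Longrightarrow>
     list_prod G (cs @ ds) = list_prod G cs \<otimes> list_prod G ds"
  by (induction cs) (auto simp: m_assoc)

lemma mixed_commutators_eq: "mixed_commutators G N = {comm G g w | g w. g \<in> carrier G \<and> w \<in> N}"
  by (simp add: mixed_commutators_def comm_def)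

lemma mixed_commutators_carrier: "N \<subseteq> carrier G \<Longrightarrow> mixed_commutators G N \<subseteq> carrier G"
  by (auto simp: mixed_commutators_eq)

lemma comm_prod_list:
  assumes "\<And>i. i < n \<Longrightarrow> a i \<in> carrier G" "\<And>i. i < n \<Longrightarrow> b i \<in> carrier G"
  shows "\<exists>cs. length cs = n \<and> set cs \<subseteq> mixed_commutators G (carrier G) \<and> list_prod G cs = comm_prod G a b n"
  using assms
proof (induction n)
  case (Suc n)
  then obtain cs where cs: "length cs = n" "set cs \<subseteq> mixed_commutators G (carrier G)"
    "list_prod G cs = comm_prod G a b n" by auto
  have "set cs \<subseteq> carrier G" using cs mixed_commutators_carrier by blast
  moreover have "comm G (a n) (b n) \<in> mixed_commutators G (carrier G)"
    using Suc.prems by (auto simp: mixed_commutators_eq)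
  ultimately show ?case using cs Suc.prems
    by (intro exI[of _ "cs @ [comm G (a n) (b n)]"]) (auto simp: list_prod_append simp del: foldr_append)
qed auto

text \<open>The inverse of \<open>[g,w]\<close> is \<open>[g\<inverse>, g w g\<inverse>]\<close>. Hence the products of mixed commutators already form
  the mixed commutator subgroup.\<close>

lemma mixed_commutator_inv:
  assumes N: "N \<lhd> G" and c: "c \<in> mixed_commutators G N"
  shows "inv c \<in> mixed_commutators G N"
proof -
  interpret N: normal N G by (rule N)
  obtain g w where gw: "g \<in> carrier G" "w \<in> N" "c = comm G g w"
    using c by (auto simp: mixed_commutators_eq)
  have w: "w \<in> carrier G" using gw N.subset by auto
  have "inv c = comm G (inv g) (g \<otimes> w \<otimes> inv g)"
    using gw w by (simp add: comm_def m_assoc inv_mult_group)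
  moreover have "g \<otimes> w \<otimes> inv g \<in> N" using gw N.inv_op_closed2 by auto
  ultimately show ?thesis using gw by (auto simp: mixed_commutators_eq)
qed

lemma mixed_commutator_subgroup_list:
  assumes N: "N \<lhd> G" and x: "x \<in> mixed_commutator_subgroup G N"
  shows "\<exists>cs. set cs \<subseteq> mixed_commutators G N \<and> list_prod G cs = x"
proof -
  have sub: "mixed_commutators G N \<subseteq> carrier G"
    using N by (intro mixed_commutators_carrier) (simp add: normal_imp_subgroup subgroup.subset)
  show ?thesis
    using x unfolding mixed_commutator_subgroup_def
  proof (induction rule: generate.induct)
    case one
    then show ?case by (intro exI[of _ "[]"]) simp
  next
    case (incl h)
    then show ?case using sub by (intro exI[of _ "[h]"]) auto
  next
    case (inv h)
    then show ?case using sub mixed_commutator_inv[OF N inv] by (intro exI[of _ "[inv h]"]) auto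
  next
    case (eng h1 h2)
    then obtain cs ds where "set cs \<subseteq> mixed_commutators G N" "list_prod G cs = h1"
      "set ds \<subseteq> mixed_commutators G N" "list_prod G ds = h2" by blast
    then show ?case using sub by (intro exI[of _ "cs @ ds"]) (auto simp: list_prod_append simp del: foldr_append)
  qed
qed

lemma mixed_cl_le:
  "set cs \<subseteq> mixed_commutators G N \<Longrightarrow> list_prod G cs = x \<Longrightarrow> mixed_cl G N x \<le> length cs"
  unfolding mixed_cl_def by (rule Least_le) auto

lemma mixed_cl_attained:
  assumes "N \<lhd> G" and "x \<in> mixed_commutator_subgroup G N"
  shows "\<exists>cs. length cs = mixed_cl G N x \<and> set cs \<subseteq> mixed_commutators G N \<and> list_prod G cs = x"
  unfolding mixed_cl_def
  by (rule LeastI_ex) (use mixed_commutator_subgroup_list[OF assms] in blast)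

lemma mixed_commutator_subgroup_subgroup:
  assumes "N \<lhd> G"
  shows "subgroup (mixed_commutator_subgroup G N) G"
  unfolding mixed_commutator_subgroup_def
  by (intro generate_is_subgroup mixed_commutators_carrier)
    (use assms in \<open>simp add: normal_imp_subgroup subgroup.subset\<close>)

text \<open>Factorizations of \<open>x\<^sup>m\<close> and \<open>x\<^sup>n\<close> can be concatenated, so the sequence is subadditive. Estimates of
  \<open>mixed_scl\<close> depend on this, because \<open>lim\<close> is unspecified for a divergent sequence.\<close>

lemma mixed_scl_convergent:
  assumes N: "N \<lhd> G" and x: "x \<in> mixed_commutator_subgroup G N"
  shows "convergent (\<lambda>m::nat. real (mixed_cl G N (x [^] m)) / real m)"
proof (rule fekete_convergent)
  interpret M: subgroup "mixed_commutator_subgroup G N" G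
    by (rule mixed_commutator_subgroup_subgroup[OF N])
  have pow: "x [^] m \<in> mixed_commutator_subgroup G N" for m :: nat
    by (induction m) (use x in auto)
  have sub: "mixed_commutators G N \<subseteq> carrier G"
    using N by (intro mixed_commutators_carrier) (simp add: normal_imp_subgroup subgroup.subset)
  fix m n :: nat
  obtain cs where cs: "length cs = mixed_cl G N (x [^] m)" "set cs \<subseteq> mixed_commutators G N"
    "list_prod G cs = x [^] m" using mixed_cl_attained[OF N pow] by blast
  obtain ds where ds: "length ds = mixed_cl G N (x [^] n)" "set ds \<subseteq> mixed_commutators G N"
    "list_prod G ds = x [^] n" using mixed_cl_attained[OF N pow] by blast
  have "x \<in> carrier G" using x M.subset by auto
  then have "list_prod G (cs @ ds) = x [^] (m + n)"
    using cs ds sub by (subst list_prod_append) (auto simp: nat_pow_mult simp del: foldr_append)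
  then have "mixed_cl G N (x [^] (m + n)) \<le> length (cs @ ds)"
    using cs ds by (intro mixed_cl_le) auto
  then show "real (mixed_cl G N (x [^] (m + n))) \<le> real (mixed_cl G N (x [^] m)) + real (mixed_cl G N (x [^] n))"
    using cs ds by simp
qed simp

lemma scl_le_length:
  assumes cs: "set cs \<subseteq> mixed_commutators G (carrier G)" and x: "list_prod G cs = x"
  shows "scl G x \<le> real (length cs)"
proof -
  have N: "carrier G \<lhd> G" by (rule normal_self)
  have sub: "set cs \<subseteq> carrier G" using cs mixed_commutators_carrier[of "carrier G"] by auto
  interpret M: subgroup "mixed_commutator_subgroup G (carrier G)" G
    by (rule mixed_commutator_subgroup_subgroup[OF N])
  have "list_prod G ds \<in> mixed_commutator_subgroup G (carrier G)" 
    if "set ds \<subseteq> mixed_commutators G (carrier G)" for ds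
    using that by (induction ds) (auto simp: mixed_commutator_subgroup_def intro: generate.intros)
  then have xM: "x \<in> mixed_commutator_subgroup G (carrier G)" using cs x by auto
  have xG: "x \<in> carrier G" using xM M.subset by auto
  have "mixed_cl G (carrier G) (x [^] m) \<le> m * length cs" for m :: nat
  proof -
    have "list_prod G (concat (replicate m cs)) = x [^] m \<and> set (concat (replicate m cs)) \<subseteq> set cs"
    proof (induction m)
      case (Suc m)
      have "list_prod G (cs @ concat (replicate m cs)) = x \<otimes> x [^] m"
        using Suc sub x by (subst list_prod_append) (auto simp del: foldr_append)
      moreover have "x [^] Suc m = x \<otimes> x [^] m" by (rule nat_pow_Suc2[OF xG])
      ultimately show ?case using Suc by (simp del: foldr_append nat_pow_Suc)
    qed simp
    then have "mixed_cl G (carrier G) (x [^] m) \<le> length (concat (replicate m cs))"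
      using cs by (intro mixed_cl_le) auto
    then show ?thesis by (simp add: length_concat sum_list_replicate)
  qed
  then have "real (mixed_cl G (carrier G) (x [^] m)) / real m \<le> real (length cs)" for m :: nat
    by (cases "m = 0") (auto simp: field_simps simp flip: of_nat_mult)
  moreover have "(\<lambda>m::nat. real (mixed_cl G (carrier G) (x [^] m)) / real m) \<longlonglongrightarrow> scl G x"
    using mixed_scl_convergent[OF N xM] unfolding mixed_scl_def by (simp add: convergent_LIMSEQ_iff)
  ultimately show ?thesis by (intro LIMSEQ_le_const2) auto
qed

lemma mixed_scl_ge:
  assumes N: "N \<lhd> G" and x: "x \<in> mixed_commutator_subgroup G N"
    and bound: "\<And>(m::nat) cs. set cs \<subseteq> mixed_commutators G N \<Longrightarrow> list_prod G cs = x [^] m \<Longrightarrow>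
       \<kappa> * real m - c \<le> real (length cs)"
  shows "\<kappa> \<le> mixed_scl G N x"
proof -
  interpret M: subgroup "mixed_commutator_subgroup G N" G
    by (rule mixed_commutator_subgroup_subgroup[OF N])
  have pow: "x [^] m \<in> mixed_commutator_subgroup G N" for m :: nat
    by (induction m) (use x in auto)
  have lim: "(\<lambda>m::nat. real (mixed_cl G N (x [^] m)) / real m) \<longlonglongrightarrow> mixed_scl G N x"
    using mixed_scl_convergent[OF N x] unfolding mixed_scl_def by (simp add: convergent_LIMSEQ_iff)
  have "\<kappa> * real m - c \<le> real (mixed_cl G N (x [^] m))" for m :: nat
    using mixed_cl_attained[OF N pow[of m]] bound[of _ m] by metis
  then have *: "\<kappa> - c / real m \<le> real (mixed_cl G N (x [^] m)) / real m" if "m \<ge> 1" for m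
  proof -
    have "\<kappa> - c / real m = (\<kappa> * real m - c) / real m" using that by (simp add: field_simps)
    also have "\<dots> \<le> real (mixed_cl G N (x [^] m)) / real m"
      by (rule divide_right_mono) (use \<open>\<And>m. \<kappa> * real m - c \<le> real (mixed_cl G N (x [^] m))\<close> in auto)
    finally show ?thesis .
  qed
  have "(\<lambda>m::nat. \<kappa> - c / real m) \<longlonglongrightarrow> \<kappa> - 0"
    by (intro tendsto_intros lim_const_over_n)
  from LIMSEQ_le[OF this lim] * show ?thesis by auto
qed

end

section \<open>Locally constant transport with values in a group\<close>

text \<open>The value \<open>\<tau> x y\<close> stands for the parallel transport from \<open>x\<close> to \<open>y\<close> in a flat principal bundle and
  is meaningful for \<open>y\<close> near \<open>x\<close> only. For the same reason \<open>germ_cocycle\<close> below asks for the cocycle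
  condition for \<open>u\<close> near \<open>s\<close> and \<open>w\<close> near \<open>u\<close>, where the last neighbourhood depends on both points:
  a set of points that are close to \<open>s\<close> may meet a set of points close to \<open>u\<close> in several pieces,
  on which the transports differ.\<close>

definition transports ::
  "('g, 'm) monoid_scheme \<Rightarrow> ('s::topological_space \<Rightarrow> 's \<Rightarrow> 'g) \<Rightarrow> 's set \<Rightarrow> ('s \<Rightarrow> 'g) \<Rightarrow> 's \<Rightarrow> bool" where
  "transports \<Gamma> \<tau> A \<phi> x \<longleftrightarrow>
     (\<exists>V. openin (top_of_set A) V \<and> x \<in> V \<and> (\<forall>y\<in>V. \<phi> y = \<phi> x \<otimes>\<^bsub>\<Gamma>\<^esub> \<tau> x y))"

definition horizontal ::
  "('g, 'm) monoid_scheme \<Rightarrow> ('s::topological_space \<Rightarrow> 's \<Rightarrow> 'g) \<Rightarrow> 's set \<Rightarrow> ('s \<Rightarrow> 'g) \<Rightarrow> bool" where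
  "horizontal \<Gamma> \<tau> A \<phi> \<longleftrightarrow> (\<forall>x\<in>A. \<phi> x \<in> carrier \<Gamma> \<and> transports \<Gamma> \<tau> A \<phi> x)"

definition germ_cocycle ::
  "('g, 'm) monoid_scheme \<Rightarrow> ('s::topological_space \<Rightarrow> 's \<Rightarrow> 'g) \<Rightarrow> 's set \<Rightarrow> bool" where
  "germ_cocycle \<Gamma> \<tau> S \<longleftrightarrow> (\<forall>s u. \<tau> s u \<in> carrier \<Gamma>) \<and>
     (\<forall>s\<in>S. \<exists>U. openin (top_of_set S) U \<and> s \<in> U \<and> (\<forall>u\<in>U. transports \<Gamma> \<tau> S (\<tau> s) u))"

lemma transportsI:
  "openin (top_of_set A) V \<Longrightarrow> x \<in> V \<Longrightarrow> (\<And>y. y \<in> V \<Longrightarrow> \<phi> y = \<phi> x \<otimes>\<^bsub>\<Gamma>\<^esub> \<tau> x y) \<Longrightarrow> transports \<Gamma> \<tau> A \<phi> x"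
  unfolding transports_def by (intro exI[of _ V] conjI ballI)

lemma transportsE:
  assumes "transports \<Gamma> \<tau> A \<phi> x"
  obtains V where "openin (top_of_set A) V" "x \<in> V" "\<And>y. y \<in> V \<Longrightarrow> \<phi> y = \<phi> x \<otimes>\<^bsub>\<Gamma>\<^esub> \<tau> x y"
proof -
  obtain V where V: "openin (top_of_set A) V \<and> x \<in> V \<and> (\<forall>y\<in>V. \<phi> y = \<phi> x \<otimes>\<^bsub>\<Gamma>\<^esub> \<tau> x y)"
    using assms unfolding transports_def by (rule exE)
  show thesis
    by (rule that[OF conjunct1[OF V] conjunct1[OF conjunct2[OF V]] bspec[OF conjunct2[OF conjunct2[OF V]]]])
qed

lemma germ_cocycleE:
  assumes "germ_cocycle \<Gamma> \<tau> S" "s \<in> S"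
  obtains U where "openin (top_of_set S) U" "s \<in> U" "\<forall>u\<in>U. transports \<Gamma> \<tau> S (\<tau> s) u"
proof -
  obtain U where U: "openin (top_of_set S) U \<and> s \<in> U \<and> (\<forall>u\<in>U. transports \<Gamma> \<tau> S (\<tau> s) u)"
    using bspec[OF conjunct2[OF assms(1)[unfolded germ_cocycle_def]] assms(2)] by (rule exE)
  show thesis
    by (rule that[OF conjunct1[OF U] conjunct1[OF conjunct2[OF U]] conjunct2[OF conjunct2[OF U]]])
qed

lemma transports_subset:
  assumes "transports \<Gamma> \<tau> A \<phi> x" "B \<subseteq> A" "x \<in> B"
  shows "transports \<Gamma> \<tau> B \<phi> x"
proof -
  obtain V where V: "openin (top_of_set A) V" "x \<in> V" "\<And>y. y \<in> V \<Longrightarrow> \<phi> y = \<phi> x \<otimes>\<^bsub>\<Gamma>\<^esub> \<tau> x y"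
    by (rule transportsE[OF assms(1)]) (rule that)
  show ?thesis
  proof (rule transportsI)
    obtain T where T: "open T" "V = A \<inter> T" using V(1) by (auto simp: openin_open)
    then have "B \<inter> V = B \<inter> T" using assms(2) by blast
    then show "openin (top_of_set B) (B \<inter> V)" using T by (simp add: openin_open_Int)
    show "x \<in> B \<inter> V" using V assms by simp
    show "\<phi> y = \<phi> x \<otimes>\<^bsub>\<Gamma>\<^esub> \<tau> x y" if "y \<in> B \<inter> V" for y using that by (intro V(3)) simp
  qed
qed

lemma transports_compose:
  assumes t: "transports \<Gamma> \<tau> A \<phi> (j x)" and j: "continuous_on B j" "j ` B \<subseteq> A" and x: "x \<in> B"
  shows "transports \<Gamma> (\<lambda>x y. \<tau> (j x) (j y)) B (\<phi> \<circ> j) x"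
proof -
  obtain V where V: "openin (top_of_set A) V" "j x \<in> V" "\<And>y. y \<in> V \<Longrightarrow> \<phi> y = \<phi> (j x) \<otimes>\<^bsub>\<Gamma>\<^esub> \<tau> (j x) y"
    by (rule transportsE[OF t]) (rule that)
  show ?thesis
  proof (rule transportsI)
    show "openin (top_of_set B) (B \<inter> j -` V)"
      using V(1) j by (metis continuous_openin_preimage image_subset_iff_funcset)
    show "x \<in> B \<inter> j -` V" using V x by simp
    show "(\<phi> \<circ> j) y = (\<phi> \<circ> j) x \<otimes>\<^bsub>\<Gamma>\<^esub> \<tau> (j x) (j y)" if "y \<in> B \<inter> j -` V" for y
      unfolding o_def using that by (intro V(3)) simp
  qed
qed

lemma horizontal_subset: "horizontal \<Gamma> \<tau> A \<phi> \<Longrightarrow> B \<subseteq> A \<Longrightarrow> horizontal \<Gamma> \<tau> B \<phi>"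
  unfolding horizontal_def by (auto intro: transports_subset)

lemma horizontal_compose:
  assumes "horizontal \<Gamma> \<tau> A \<phi>" "continuous_on B j" "j ` B \<subseteq> A"
  shows "horizontal \<Gamma> (\<lambda>x y. \<tau> (j x) (j y)) B (\<phi> \<circ> j)"
  using assms unfolding horizontal_def by (auto intro!: transports_compose)

lemma horizontal_cong:
  assumes h: "horizontal \<Gamma> \<tau> A \<phi>" and eq: "\<And>x y. x \<in> A \<Longrightarrow> y \<in> A \<Longrightarrow> \<tau> x y = \<tau>' x y"
  shows "horizontal \<Gamma> \<tau>' A \<phi>"
  unfolding horizontal_def
proof (intro ballI conjI)
  fix x assume x: "x \<in> A"
  have \<phi>: "\<phi> x \<in> carrier \<Gamma>" "transports \<Gamma> \<tau> A \<phi> x" using h x by (auto simp: horizontal_def)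
  show "\<phi> x \<in> carrier \<Gamma>" by (rule \<phi>)
  obtain V where V: "openin (top_of_set A) V" "x \<in> V" "\<And>y. y \<in> V \<Longrightarrow> \<phi> y = \<phi> x \<otimes>\<^bsub>\<Gamma>\<^esub> \<tau> x y"
    by (rule transportsE[OF \<phi>(2)]) (rule that)
  show "transports \<Gamma> \<tau>' A \<phi> x"
  proof (rule transportsI[OF V(1,2)])
    fix y assume y: "y \<in> V"
    then have "y \<in> A" using openin_imp_subset[OF V(1)] by blast
    then show "\<phi> y = \<phi> x \<otimes>\<^bsub>\<Gamma>\<^esub> \<tau>' x y" using V(3)[OF y] eq[OF x] by simp
  qed
qed

lemma germ_cocycle_pullback:
  assumes g: "germ_cocycle \<Gamma> \<tau> S" and f: "continuous_on K f" "f ` K \<subseteq> S"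
  shows "germ_cocycle \<Gamma> (\<lambda>x y. \<tau> (f x) (f y)) K"
  unfolding germ_cocycle_def
proof (intro conjI ballI allI)
  show "\<tau> (f s) (f u) \<in> carrier \<Gamma>" for s u using g by (auto simp: germ_cocycle_def)
  fix x assume x: "x \<in> K"
  then have fx: "f x \<in> S" using f by blast
  obtain U where U: "openin (top_of_set S) U" "f x \<in> U" "\<forall>u\<in>U. transports \<Gamma> \<tau> S (\<tau> (f x)) u"
    by (rule germ_cocycleE[OF g fx]) (rule that)
  have "transports \<Gamma> (\<lambda>x y. \<tau> (f x) (f y)) K (\<tau> (f x) \<circ> f) u" if "u \<in> K \<inter> f -` U" for u
  proof (rule transports_compose[OF _ f])
    show "transports \<Gamma> \<tau> S (\<tau> (f x)) (f u)" using U(3) that by simp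
    show "u \<in> K" using that by simp
  qed
  moreover have "openin (top_of_set K) (K \<inter> f -` U)"
    using U(1) f by (metis continuous_openin_preimage image_subset_iff_funcset)
  ultimately show "\<exists>U. openin (top_of_set K) U \<and> x \<in> U \<and>
      (\<forall>u\<in>U. transports \<Gamma> (\<lambda>x y. \<tau> (f x) (f y)) K (\<lambda>y. \<tau> (f x) (f y)) u)"
    using U(2) x unfolding o_def by (intro exI[of _ "K \<inter> f -` U"] conjI ballI) simp_all
qed

context group
begin

lemma transports_self:
  assumes "transports G \<tau> A \<phi> x" "\<phi> x \<in> carrier G" "\<tau> x x \<in> carrier G"
  shows "\<tau> x x = \<one>"
proof -
  obtain V where V: "openin (top_of_set A) V" "x \<in> V" "\<And>y. y \<in> V \<Longrightarrow> \<phi> y = \<phi> x \<otimes> \<tau> x y"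
    by (rule transportsE[OF assms(1)]) (rule that)
  have "\<phi> x \<otimes> \<tau> x x = \<phi> x" using V(3)[OF V(2)] by simp
  then show ?thesis using assms by (simp add: r_cancel_one)
qed

lemma horizontal_unique:
  assumes A: "connected A" and h: "horizontal G \<tau> A \<phi>" "horizontal G \<tau> A \<phi>'"
    and \<tau>: "\<And>x y. \<tau> x y \<in> carrier G" and ab: "a \<in> A" "b \<in> A"
  shows "\<phi>' a \<otimes> inv (\<phi> a) = \<phi>' b \<otimes> inv (\<phi> b)"
proof -
  have "(\<lambda>x. \<phi>' x \<otimes> inv (\<phi> x)) constant_on A"
  proof (rule locally_constant_imp_constant[OF A])
    fix x assume x: "x \<in> A"
    have c: "\<phi> x \<in> carrier G" "\<phi>' x \<in> carrier G" "transports G \<tau> A \<phi> x" "transports G \<tau> A \<phi>' x"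
      using h x by (auto simp: horizontal_def)
    obtain V where V: "openin (top_of_set A) V" "x \<in> V" "\<And>y. y \<in> V \<Longrightarrow> \<phi> y = \<phi> x \<otimes> \<tau> x y"
      by (rule transportsE[OF c(3)]) (rule that)
    obtain V' where V': "openin (top_of_set A) V'" "x \<in> V'" "\<And>y. y \<in> V' \<Longrightarrow> \<phi>' y = \<phi>' x \<otimes> \<tau> x y"
      by (rule transportsE[OF c(4)]) (rule that)
    have "\<phi>' y \<otimes> inv (\<phi> y) = \<phi>' x \<otimes> inv (\<phi> x)" if y: "y \<in> V \<inter> V'" for y
    proof -
      have "y \<in> V" "y \<in> V'" using y by auto
      show ?thesis unfolding V(3)[OF \<open>y \<in> V\<close>] V'(3)[OF \<open>y \<in> V'\<close>]
        using c(1,2) \<tau> by (simp add: inv_mult_group m_assoc)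
    qed
    then have "\<forall>y\<in>V \<inter> V'. \<phi>' y \<otimes> inv (\<phi> y) = \<phi>' x \<otimes> inv (\<phi> x)" by (rule ballI)
    moreover have "openin (top_of_set A) (V \<inter> V')" "x \<in> V \<inter> V'" using V(1,2) V'(1,2) by auto
    ultimately show "\<exists>T. openin (top_of_set A) T \<and> x \<in> T \<and> (\<forall>y\<in>T. \<phi>' y \<otimes> inv (\<phi> y) = \<phi>' x \<otimes> inv (\<phi> x))"
      by (intro exI[of _ "V \<inter> V'"] conjI)
  qed
  then obtain c where "\<And>x. x \<in> A \<Longrightarrow> \<phi>' x \<otimes> inv (\<phi> x) = c" unfolding constant_on_def by auto
  then show ?thesis using ab by simp
qed

lemma horizontal_mult_left:
  assumes h: "horizontal G \<tau> A \<phi>" and c: "c \<in> carrier G" and \<tau>: "\<And>x y. \<tau> x y \<in> carrier G"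
  shows "horizontal G \<tau> A (\<lambda>x. c \<otimes> \<phi> x)"
  unfolding horizontal_def
proof (intro conjI ballI)
  fix x assume x: "x \<in> A"
  have \<phi>: "\<phi> x \<in> carrier G" "transports G \<tau> A \<phi> x" using h x by (auto simp: horizontal_def)
  show "c \<otimes> \<phi> x \<in> carrier G" using c \<phi> by simp
  obtain V where V: "openin (top_of_set A) V" "x \<in> V" "\<And>y. y \<in> V \<Longrightarrow> \<phi> y = \<phi> x \<otimes> \<tau> x y"
    by (rule transportsE[OF \<phi>(2)]) (rule that)
  show "transports G \<tau> A (\<lambda>x. c \<otimes> \<phi> x) x"
  proof (rule transportsI[OF V(1,2)])
    show "c \<otimes> \<phi> y = c \<otimes> \<phi> x \<otimes> \<tau> x y" if "y \<in> V" for y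
      unfolding V(3)[OF that] using c \<phi> \<tau> by (simp add: m_assoc)
  qed
qed

lemma horizontal_local:
  assumes g: "germ_cocycle G \<tau> K" and x: "x \<in> K"
  obtains U where "openin (top_of_set K) U" "x \<in> U" "horizontal G \<tau> U (\<tau> x)"
proof -
  obtain U where U: "openin (top_of_set K) U" "x \<in> U" "\<forall>u\<in>U. transports G \<tau> K (\<tau> x) u"
    by (rule germ_cocycleE[OF g x]) (rule that)
  have "U \<subseteq> K" using U(1) by (rule openin_imp_subset)
  have "horizontal G \<tau> U (\<tau> x)"
    unfolding horizontal_def
  proof (intro ballI conjI)
    fix u assume u: "u \<in> U"
    show "\<tau> x u \<in> carrier G" using g by (simp add: germ_cocycle_def)
    show "transports G \<tau> U (\<tau> x) u" by (rule transports_subset[OF bspec[OF U(3) u] \<open>U \<subseteq> K\<close> u])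
  qed
  then show thesis using that U(1,2) by blast
qed

text \<open>Up to a Lebesgue number there are horizontal functions on all balls, and they differ by constants
  on the (convex) intersections. Hence transport between close points is an honest cocycle \<open>\<sigma>\<close>, and
  transport along the segment from a fixed point, cut into short steps, is horizontal: two nearby
  segments are joined by a ladder of small quadrilaterals, around each of which \<open>\<sigma>\<close> is trivial.
  Applied to the interval and to the square this gives the holonomy of paths and its invariance
  under homotopies.\<close>

proposition horizontal_exists:
  fixes \<tau> :: "'x::real_normed_vector \<Rightarrow> 'x \<Rightarrow> 'a"
  assumes g: "germ_cocycle G \<tau> K" and K: "compact K" "convex K"
  shows "\<exists>\<phi>. horizontal G \<tau> K \<phi>"
proof (cases "K = {}")
  case True
  then show ?thesis by (simp add: horizontal_def)
next
  case False
  then obtain x0 where x0: "x0 \<in> K" by blast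
  have \<tau>: "\<tau> x y \<in> carrier G" for x y using g by (auto simp: germ_cocycle_def)
  obtain d where d: "\<And>x. x \<in> K \<Longrightarrow> d x > 0" "\<And>x. x \<in> K \<Longrightarrow> horizontal G \<tau> (K \<inter> ball x (d x)) (\<tau> x)"
  proof -
    have "\<exists>d>0. horizontal G \<tau> (K \<inter> ball x d) (\<tau> x)" if xK: "x \<in> K" for x
    proof -
      obtain U where U: "openin (top_of_set K) U" "x \<in> U" "horizontal G \<tau> U (\<tau> x)"
        by (rule horizontal_local[OF g xK]) (rule that)
      then obtain d where "d > 0" "ball x d \<inter> K \<subseteq> U" unfolding openin_contains_ball by blast
      then show ?thesis using horizontal_subset[OF U(3)] by (metis inf_commute)
    qed
    then show thesis using that by metis
  qed
  obtain \<epsilon>' where \<epsilon>': "\<epsilon>' > 0" "\<And>T. T \<subseteq> K \<Longrightarrow> diameter T < \<epsilon>' \<Longrightarrow> \<exists>B\<in>(\<lambda>x. ball x (d x)) ` K. T \<subseteq> B"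
    by (rule Lebesgue_number_lemma[of K "(\<lambda>x. ball x (d x)) ` K"]) (use K False d in auto)
  \<comment> \<open>balls of radius \<open>\<epsilon>\<close> have diameter below the Lebesgue number\<close>
  define \<epsilon> where "\<epsilon> = \<epsilon>' / 4"
  have \<epsilon>: "\<epsilon> > 0" using \<epsilon>' by (simp add: \<epsilon>_def)
  have "\<exists>\<sigma>. horizontal G \<tau> (K \<inter> ball x \<epsilon>) \<sigma> \<and> \<sigma> x = \<one>" if x: "x \<in> K" for x
  proof -
    have "diameter (K \<inter> ball x \<epsilon>) \<le> 2 * \<epsilon>"
    proof (rule diameter_le)
      show "norm (y - z) \<le> 2 * \<epsilon>" if "y \<in> K \<inter> ball x \<epsilon>" "z \<in> K \<inter> ball x \<epsilon>" for y z
      proof -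
        have "dist x y < \<epsilon>" "dist x z < \<epsilon>" using that by auto
        then show ?thesis using dist_triangle3[of y z x] by (simp add: dist_norm)
      qed
    qed (use \<epsilon> in auto)
    also have "\<dots> < \<epsilon>'" using \<epsilon>'(1) by (simp add: \<epsilon>_def)
    finally obtain c where c: "c \<in> K" "K \<inter> ball x \<epsilon> \<subseteq> ball c (d c)" using \<epsilon>'(2)[of "K \<inter> ball x \<epsilon>"] by auto
    have "horizontal G \<tau> (K \<inter> ball x \<epsilon>) (\<lambda>y. inv (\<tau> c x) \<otimes> \<tau> c y)"
      by (rule horizontal_mult_left[OF horizontal_subset[OF d(2)[OF c(1)]]]) (use c \<tau> in auto)
    then show ?thesis using \<tau> by (intro exI[of _ "\<lambda>y. inv (\<tau> c x) \<otimes> \<tau> c y"]) auto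
  qed
  then obtain \<sigma> where \<sigma>: "\<And>x. x \<in> K \<Longrightarrow> horizontal G \<tau> (K \<inter> ball x \<epsilon>) (\<sigma> x)" "\<And>x. x \<in> K \<Longrightarrow> \<sigma> x x = \<one>"
    by metis
  have \<sigma>c: "\<sigma> x y \<in> carrier G" if "x \<in> K" "y \<in> K" "dist x y < \<epsilon>" for x y
    using \<sigma>(1)[OF that(1)] that unfolding horizontal_def by auto
  have cocycle: "\<sigma> x w = \<sigma> x y \<otimes> \<sigma> y w"
    if "x \<in> K" "y \<in> K" "w \<in> K" "dist x y < \<epsilon>" "dist x w < \<epsilon>" "dist y w < \<epsilon>" for x y w
  proof -
    let ?A = "K \<inter> ball x \<epsilon> \<inter> ball y \<epsilon>"
    have "connected ?A" using K by (intro convex_connected convex_Int) auto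
    moreover have "horizontal G \<tau> ?A (\<sigma> y)" "horizontal G \<tau> ?A (\<sigma> x)"
      by (rule horizontal_subset[OF \<sigma>(1)]; use that in auto)+
    ultimately have "\<sigma> x w \<otimes> inv (\<sigma> y w) = \<sigma> x y \<otimes> inv (\<sigma> y y)"
      by (rule horizontal_unique[where a = w and b = y]) (use that \<tau> \<epsilon> in \<open>auto simp: dist_commute\<close>)
    moreover have "\<sigma> x w \<in> carrier G" "\<sigma> y w \<in> carrier G" "\<sigma> x y \<in> carrier G"
      using \<sigma>c that by auto
    ultimately show ?thesis using \<sigma>(2) that by (simp add: inv_solve_right')
  qed
  obtain R where R: "\<And>x. x \<in> K \<Longrightarrow> dist x0 x \<le> R" using K(1) x0 
    using bounded_any_center[of K x0] compact_imp_bounded[OF K(1)] by auto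
  obtain n :: nat where n: "R / (\<epsilon> / 2) < real n" "n > 0"
  proof -
    obtain n :: nat where "max 1 (R / (\<epsilon> / 2)) < real n" using reals_Archimedean2 by blast
    then show thesis by (intro that[of n]) auto
  qed
  \<comment> \<open>the \<open>i\<close>-th of the points that cut the segment from \<open>x0\<close> to \<open>x\<close> into \<open>n\<close> steps\<close>
  define p where "p i x = x0 + (real i / real n) *\<^sub>R (x - x0)" for i x
  have pK: "p i x \<in> K" if "x \<in> K" "i \<le> n" for i x
  proof -
    have "p i x = (1 - real i / real n) *\<^sub>R x0 + (real i / real n) *\<^sub>R x" 
      by (simp add: p_def algebra_simps)
    then show ?thesis using convexD_alt[OF K(2) x0 that(1), of "real i / real n"] that n by simp
  qed
  have step: "dist (p i x) (p (Suc i) x) < \<epsilon> / 2" if "x \<in> K" for i x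
  proof -
    have "p i x - p (Suc i) x = - ((1 / real n) *\<^sub>R (x - x0))"
      by (simp add: p_def add_divide_distrib scaleR_left_distrib)
    then have "dist (p i x) (p (Suc i) x) = dist x0 x / real n"
      using n by (simp add: dist_norm norm_minus_commute)
    also have "\<dots> \<le> R / real n" using R[OF that] n by (simp add: divide_right_mono)
    also have "\<dots> < \<epsilon> / 2" using n \<epsilon> by (simp add: field_simps)
    finally show ?thesis .
  qed
  have shrink: "dist (p i x) (p i y) \<le> dist x y" if "i \<le> n" for i x y
  proof -
    have "p i x - p i y = (real i / real n) *\<^sub>R (x - y)" by (simp add: p_def algebra_simps)
    then have "dist (p i x) (p i y) = (real i / real n) * dist x y" by (simp add: dist_norm)
    also have "\<dots> \<le> 1 * dist x y" by (rule mult_right_mono) (use that n in auto)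
    finally show ?thesis by simp
  qed
  define \<Phi> where "\<Phi> = rec_nat (\<lambda>x. \<one>) (\<lambda>i f x. f x \<otimes> \<sigma> (p i x) (p (Suc i) x))"
  have \<Phi>: "\<Phi> 0 x = \<one>" "\<Phi> (Suc i) x = \<Phi> i x \<otimes> \<sigma> (p i x) (p (Suc i) x)" for i x
    by (simp_all add: \<Phi>_def)
  have \<Phi>c: "\<Phi> i x \<in> carrier G" if "x \<in> K" "i \<le> n" for i x
    using that(2)
  proof (induction i)
    case (Suc i)
    then have "\<sigma> (p i x) (p (Suc i) x) \<in> carrier G"
      using pK[OF that(1)] step[OF that(1), of i] \<epsilon> by (intro \<sigma>c) auto
    then show ?case using Suc by (auto simp: \<Phi>)
  qed (simp add: \<Phi>)
  \<comment> \<open>the first \<open>i\<close> rungs of the ladder between the segments to \<open>x\<close> and \<open>y\<close>\<close>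
  have key: "\<Phi> i y = \<Phi> i x \<otimes> \<sigma> (p i x) (p i y)"
    if xy: "x \<in> K" "y \<in> K" "dist x y < \<epsilon> / 2" and "i \<le> n" for i x y
    using that(4)
  proof (induction i)
    case 0
    then show ?case using \<sigma>(2)[OF x0] by (simp add: \<Phi> p_def)
  next
    case (Suc i)
    have in_K: "p i x \<in> K" "p i y \<in> K" "p (Suc i) x \<in> K" "p (Suc i) y \<in> K" using Suc.prems xy pK by auto
    have ds: "dist (p i x) (p (Suc i) x) < \<epsilon>/2" "dist (p i y) (p (Suc i) y) < \<epsilon>/2"
      "dist (p i x) (p i y) < \<epsilon>/2" "dist (p (Suc i) x) (p (Suc i) y) < \<epsilon>/2"
      using step xy shrink[of i x y] shrink[of "Suc i" x y] Suc.prems by auto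
    have d5: "dist (p i x) (p (Suc i) y) < \<epsilon>"
      using ds dist_triangle[of "p i x" "p (Suc i) y" "p i y"] by linarith
    have "\<Phi> (Suc i) y = \<Phi> i x \<otimes> \<sigma> (p i x) (p i y) \<otimes> \<sigma> (p i y) (p (Suc i) y)" using Suc by (simp add: \<Phi>)
    also have "\<dots> = \<Phi> i x \<otimes> \<sigma> (p i x) (p (Suc i) y)"
      using cocycle[of "p i x" "p i y" "p (Suc i) y"] in_K ds d5 \<epsilon> \<Phi>c[of x i] xy Suc.prems
      by (simp add: m_assoc \<sigma>c)
    also have "\<dots> = \<Phi> i x \<otimes> (\<sigma> (p i x) (p (Suc i) x) \<otimes> \<sigma> (p (Suc i) x) (p (Suc i) y))"
      using cocycle[of "p i x" "p (Suc i) x" "p (Suc i) y"] in_K ds d5 \<epsilon> by simp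
    also have "\<dots> = \<Phi> (Suc i) x \<otimes> \<sigma> (p (Suc i) x) (p (Suc i) y)"
      using in_K ds \<epsilon> \<Phi>c[of x i] xy Suc.prems by (simp add: m_assoc \<sigma>c \<Phi>)
    finally show ?case .
  qed
  have pn: "p n x = x" for x using n by (simp add: p_def)
  have "horizontal G \<tau> K (\<Phi> n)"
    unfolding horizontal_def
  proof (intro conjI ballI)
    fix x assume x: "x \<in> K"
    show "\<Phi> n x \<in> carrier G" using \<Phi>c x by simp
    have "x \<in> K \<inter> ball x \<epsilon>" using x \<epsilon> by simp
    then have tx: "transports G \<tau> (K \<inter> ball x \<epsilon>) (\<sigma> x) x" using \<sigma>(1)[OF x] by (auto simp: horizontal_def)
    obtain V where V: "openin (top_of_set (K \<inter> ball x \<epsilon>)) V" "x \<in> V" "\<And>y. y \<in> V \<Longrightarrow> \<sigma> x y = \<sigma> x x \<otimes> \<tau> x y"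
      by (rule transportsE[OF tx]) (rule that)
    show "transports G \<tau> K (\<Phi> n) x"
    proof (rule transportsI)
      show "openin (top_of_set K) (V \<inter> ball x (\<epsilon> / 2))"
        by (rule openin_trans[OF openin_Int_open[OF V(1)]]) (auto intro: openin_open_Int)
      show "x \<in> V \<inter> ball x (\<epsilon> / 2)" using V(2) \<epsilon> by simp
      fix y assume y: "y \<in> V \<inter> ball x (\<epsilon> / 2)"
      have "V \<subseteq> K" using openin_imp_subset[OF V(1)] by blast
      then have yK: "y \<in> K" "dist x y < \<epsilon> / 2" "y \<in> V" using y by auto
      have "\<Phi> n y = \<Phi> n x \<otimes> \<sigma> x y" using key[OF x yK(1,2), of n] by (simp add: pn)
      also have "\<sigma> x y = \<tau> x y" using V(3)[OF yK(3)] \<sigma>(2)[OF x] \<tau> by simp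
      finally show "\<Phi> n y = \<Phi> n x \<otimes> \<tau> x y" .
    qed
  qed
  then show ?thesis by blast
qed

end

section \<open>Holonomy along paths\<close>

definition holonomy :: "('g, 'm) monoid_scheme \<Rightarrow> ('s::topological_space \<Rightarrow> 's \<Rightarrow> 'g) \<Rightarrow> (real \<Rightarrow> 's) \<Rightarrow> 'g" where
  "holonomy \<Gamma> \<tau> p = (let \<phi> = (SOME \<phi>. horizontal \<Gamma> (\<lambda>x y. \<tau> (p x) (p y)) {0..1} \<phi>) in
     inv\<^bsub>\<Gamma>\<^esub> (\<phi> 0) \<otimes>\<^bsub>\<Gamma>\<^esub> \<phi> 1)"

context group
begin

lemma holonomy_eq:
  assumes \<tau>: "\<And>x y. \<tau> x y \<in> carrier G" and h: "horizontal G (\<lambda>x y. \<tau> (p x) (p y)) {0..1} \<phi>"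
  shows "holonomy G \<tau> p = inv (\<phi> 0) \<otimes> \<phi> 1"
proof -
  define \<psi> where "\<psi> = (SOME \<phi>. horizontal G (\<lambda>x y. \<tau> (p x) (p y)) {0..1} \<phi>)"
  have h': "horizontal G (\<lambda>x y. \<tau> (p x) (p y)) {0..1} \<psi>"
    unfolding \<psi>_def by (rule someI[where P = "horizontal G (\<lambda>x y. \<tau> (p x) (p y)) {0..1}"]) (rule h)
  have c: "\<phi> 0 \<in> carrier G" "\<phi> 1 \<in> carrier G" "\<psi> 0 \<in> carrier G" "\<psi> 1 \<in> carrier G"
    using h h' by (auto simp: horizontal_def)
  have "\<psi> 0 \<otimes> inv (\<phi> 0) = \<psi> 1 \<otimes> inv (\<phi> 1)"
    by (rule horizontal_unique[OF _ h h']) (use \<tau> in auto)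
  then have "\<psi> 1 = \<psi> 0 \<otimes> inv (\<phi> 0) \<otimes> \<phi> 1" using c by (simp add: inv_solve_right)
  then show ?thesis using c by (simp add: holonomy_def Let_def \<psi>_def[symmetric] m_assoc)
qed

context
  fixes \<tau> :: "'s::topological_space \<Rightarrow> 's \<Rightarrow> 'a" and S
  assumes germ: "germ_cocycle G \<tau> S"
begin

lemma transport_closed: "\<tau> x y \<in> carrier G"
  using germ by (auto simp: germ_cocycle_def)

lemma horizontal_along_path:
  assumes "path p" "path_image p \<subseteq> S"
  shows "\<exists>\<phi>. horizontal G (\<lambda>x y. \<tau> (p x) (p y)) {0..1} \<phi>"
  using assms by (intro horizontal_exists germ_cocycle_pullback[OF germ]) (auto simp: path_def path_image_def)

lemma holonomy_closed:
  assumes "path p" "path_image p \<subseteq> S"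
  shows "holonomy G \<tau> p \<in> carrier G"
proof -
  obtain \<phi> where "horizontal G (\<lambda>x y. \<tau> (p x) (p y)) {0..1} \<phi>" using horizontal_along_path[OF assms] by blast
  then show ?thesis using holonomy_eq[of \<tau> p \<phi>] transport_closed by (auto simp: horizontal_def)
qed

lemma holonomy_join:
  assumes p: "path p" "path_image p \<subseteq> S" and q: "path q" "path_image q \<subseteq> S" and pq: "pathfinish p = pathstart q"
  shows "holonomy G \<tau> (p +++ q) = holonomy G \<tau> p \<otimes> holonomy G \<tau> q"
proof -
  have "path (p +++ q)" "path_image (p +++ q) \<subseteq> S" using assms by (auto simp: path_image_join)
  then obtain \<phi> where h: "horizontal G (\<lambda>x y. \<tau> ((p +++ q) x) ((p +++ q) y)) {0..1} \<phi>"
    using horizontal_along_path by blast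
  have c: "\<phi> t \<in> carrier G" if "t \<in> {0..1}" for t using h that by (auto simp: horizontal_def)
  have "horizontal G (\<lambda>x y. \<tau> ((p +++ q) (x / 2)) ((p +++ q) (y / 2))) {0..1} (\<phi> \<circ> (\<lambda>x. x / 2))"
    by (rule horizontal_compose[OF h]) (auto intro!: continuous_intros)
  then have "horizontal G (\<lambda>x y. \<tau> (p x) (p y)) {0..1} (\<phi> \<circ> (\<lambda>x. x / 2))"
    by (rule horizontal_cong) (simp add: joinpaths_def)
  then have 1: "holonomy G \<tau> p = inv (\<phi> 0) \<otimes> \<phi> (1/2)"
    using holonomy_eq[OF transport_closed] by force
  have q': "(p +++ q) ((1 + x) / 2) = q x" if "x \<in> {0..1}" for x
    using pq that by (cases "x = 0") (auto simp: joinpaths_def pathfinish_def pathstart_def add_divide_distrib)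
  have "horizontal G (\<lambda>x y. \<tau> ((p +++ q) ((1 + x) / 2)) ((p +++ q) ((1 + y) / 2))) {0..1} (\<phi> \<circ> (\<lambda>x. (1 + x) / 2))"
    by (rule horizontal_compose[OF h]) (auto intro!: continuous_intros)
  then have "horizontal G (\<lambda>x y. \<tau> (q x) (q y)) {0..1} (\<phi> \<circ> (\<lambda>x. (1 + x) / 2))"
    by (rule horizontal_cong) (simp only: q')
  then have 2: "holonomy G \<tau> q = inv (\<phi> (1/2)) \<otimes> \<phi> 1"
    using holonomy_eq[OF transport_closed] by force
  have 3: "holonomy G \<tau> (p +++ q) = inv (\<phi> 0) \<otimes> \<phi> 1"
    by (rule holonomy_eq[where p = "p +++ q", OF transport_closed]) (rule h)
  show ?thesis unfolding 1 2 3
    using c[of 0] c[of "1/2"] c[of 1] by (simp add: m_assoc)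
qed

text \<open>A horizontal function on the square restricts to horizontal functions on its four sides, and the
  homotopy is constant on two of them.\<close>

lemma holonomy_homotopic:
  assumes "homotopic_paths S p q"
  shows "holonomy G \<tau> p = holonomy G \<tau> q"
proof -
  obtain h :: "real \<times> real \<Rightarrow> 's" where h: "continuous_on ({0..1} \<times> {0..1}) h" "h ` ({0..1} \<times> {0..1}) \<subseteq> S"
    "\<And>x. x \<in> {0..1} \<Longrightarrow> h (0, x) = p x" "\<And>x. x \<in> {0..1} \<Longrightarrow> h (1, x) = q x"
    "\<And>t. t \<in> {0..1} \<Longrightarrow> h (t, 0) = p 0" "\<And>t. t \<in> {0..1} \<Longrightarrow> h (t, 1) = p 1"
    using assms unfolding homotopic_paths by (fastforce simp: pathstart_def pathfinish_def)
  have "\<exists>\<phi>. horizontal G (\<lambda>x y. \<tau> (h x) (h y)) ({0..1} \<times> {0..1}) \<phi>"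
    by (intro horizontal_exists germ_cocycle_pullback[OF germ] h) (auto intro: compact_Times convex_Times)
  then obtain \<phi> where \<phi>: "horizontal G (\<lambda>x y. \<tau> (h x) (h y)) ({0..1} \<times> {0..1}) \<phi>" by blast
  have c: "\<phi> (s, t) \<in> carrier G" if "s \<in> {0..1}" "t \<in> {0..1}" for s t using \<phi> that by (auto simp: horizontal_def)
  have "horizontal G (\<lambda>x y. \<tau> (h (0, x)) (h (0, y))) {0..1} (\<phi> \<circ> (\<lambda>x. (0, x)))"
    by (rule horizontal_compose[OF \<phi>]) (auto intro!: continuous_intros)
  then have "horizontal G (\<lambda>x y. \<tau> (p x) (p y)) {0..1} (\<phi> \<circ> (\<lambda>x. (0, x)))"
    by (rule horizontal_cong) (simp only: h)
  then have p: "holonomy G \<tau> p = inv (\<phi> (0,0)) \<otimes> \<phi> (0,1)"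
    using holonomy_eq[OF transport_closed] by force
  have "horizontal G (\<lambda>x y. \<tau> (h (1, x)) (h (1, y))) {0..1} (\<phi> \<circ> (\<lambda>x. (1, x)))"
    by (rule horizontal_compose[OF \<phi>]) (auto intro!: continuous_intros)
  then have "horizontal G (\<lambda>x y. \<tau> (q x) (q y)) {0..1} (\<phi> \<circ> (\<lambda>x. (1, x)))"
    by (rule horizontal_cong) (simp only: h)
  then have q: "holonomy G \<tau> q = inv (\<phi> (1,0)) \<otimes> \<phi> (1,1)"
    using holonomy_eq[OF transport_closed] by force
  have side: "\<phi> (0, e) = \<phi> (1, e)" if e: "e = 0 \<or> e = 1" for e
  proof -
    have "horizontal G (\<lambda>x y. \<tau> (h (x, e)) (h (y, e))) {0..1} (\<phi> \<circ> (\<lambda>x. (x, e)))"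
      by (rule horizontal_compose[OF \<phi>]) (use e in \<open>auto intro!: continuous_intros\<close>)
    then have 1: "horizontal G (\<lambda>x y. \<tau> (p e) (p e)) {0..1} (\<phi> \<circ> (\<lambda>x. (x, e)))"
      by (rule horizontal_cong) (use h e in auto)
    have "\<tau> (p e) (p e) = \<one>"
    proof -
      have "h (0, e) \<in> S" using h(2) e by (auto simp: image_subset_iff)
      then have "p e \<in> S" using h(3)[of e] e by auto
      then obtain U where "p e \<in> U" "\<forall>u\<in>U. transports G \<tau> S (\<tau> (p e)) u"
        by (rule germ_cocycleE[OF germ]) (rule that)
      then show ?thesis using transports_self[of \<tau> S "\<tau> (p e)" "p e"] transport_closed by blast
    qed
    then have 2: "horizontal G (\<lambda>x y. \<tau> (p e) (p e)) {0..1::real} (\<lambda>x. \<one>)"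
      by (auto simp: horizontal_def intro!: transportsI[of _ "{0..1}"])
    have "\<one> \<otimes> inv ((\<phi> \<circ> (\<lambda>x. (x, e))) 0) = \<one> \<otimes> inv ((\<phi> \<circ> (\<lambda>x. (x, e))) 1)"
      by (rule horizontal_unique[OF _ 1 2]) (use transport_closed in auto)
    then have "inv (\<phi> (0, e)) = inv (\<phi> (1, e))" using c[of 0 e] c[of 1 e] e by auto
    then have "inv (inv (\<phi> (0, e))) = inv (inv (\<phi> (1, e)))" by simp
    then show ?thesis using c[of 0 e] c[of 1 e] e by auto
  qed
  show ?thesis unfolding p q using side by simp
qed

end

end

section \<open>The fundamental group\<close>

definition path_in :: "'a::topological_space set \<Rightarrow> (real \<Rightarrow> 'a) \<Rightarrow> bool" where
  "path_in S p \<longleftrightarrow> path p \<and> path_image p \<subseteq> S"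

lemma path_in_join [simp]:
  "path_in S p \<Longrightarrow> path_in S q \<Longrightarrow> pathfinish p = pathstart q \<Longrightarrow> path_in S (p +++ q)"
  by (auto simp: path_in_def path_image_join)

lemma path_in_reverse [simp]: "path_in S (reversepath p) \<longleftrightarrow> path_in S p"
  by (simp add: path_in_def)

lemma path_in_const [simp]: "s \<in> S \<Longrightarrow> path_in S (\<lambda>_. s)"
  by (auto simp: path_in_def path_def path_image_def)

lemma path_class_eq_iff:
  assumes "path_in S p"
  shows "path_class S p = path_class S q \<longleftrightarrow> homotopic_paths S p q"
proof
  assume "path_class S p = path_class S q"
  moreover have "p \<in> path_class S p" using assms by (simp add: path_class_def path_in_def)
  ultimately show "homotopic_paths S p q" by (simp add: path_class_def homotopic_paths_sym)
next
  assume "homotopic_paths S p q"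
  then show "path_class S p = path_class S q" unfolding path_class_def
    by (blast intro: homotopic_paths_trans homotopic_paths_sym)
qed

lemma path_class_cong: "homotopic_paths S p q \<Longrightarrow> path_class S p = path_class S q"
  using path_class_eq_iff[of S p q] homotopic_paths_imp_path homotopic_paths_imp_subset
  by (fastforce simp: path_in_def)

lemma path_class_cong_eq:
  assumes "path_in S p" "\<And>t. t \<in> {0..1} \<Longrightarrow> p t = q t"
  shows "path_class S p = path_class S q"
  using assms by (intro path_class_cong homotopic_paths_eq) (auto simp: path_in_def)

lemma path_class_join:
  assumes "path_class S p = path_class S p'" "path_class S q = path_class S q'"
    and "path_in S p" "path_in S q" "pathfinish p = pathstart q"
  shows "path_class S (p +++ q) = path_class S (p' +++ q')"
  using assms by (intro path_class_cong homotopic_paths_join) (auto simp: path_class_eq_iff)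

lemma path_class_assoc:
  assumes "path_in S p" "path_in S q" "path_in S r" "pathfinish p = pathstart q" "pathfinish q = pathstart r"
  shows "path_class S ((p +++ q) +++ r) = path_class S (p +++ (q +++ r))"
  using assms by (intro path_class_cong homotopic_paths_sym[OF homotopic_paths_assoc]) (auto simp: path_in_def)

lemma linepath_const: "linepath s s = (\<lambda>_. s)"
  by (auto simp: linepath_def algebra_simps)

lemma path_class_reverse:
  assumes "path_class S p = path_class S q" "path_in S p"
  shows "path_class S (reversepath p) = path_class S (reversepath q)"
  using assms by (intro path_class_cong homotopic_paths_reversepath_D) (simp add: path_class_eq_iff)


lemma compose_linepath_01 [simp]: "p \<circ> linepath 0 (1::real) = p" "p \<circ> linepath s s = (\<lambda>_. p s)"
  by (auto simp: linepath_def fun_eq_iff algebra_simps)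

text \<open>All laws for a single path hold for the identity path of the unit interval, which is convex, and
  are transported along the path.\<close>

lemma homotopic_paths_01:
  fixes p :: "real \<Rightarrow> 'a::topological_space"
  assumes "path_in S p" "homotopic_paths {0..1} a b"
  shows "homotopic_paths S (p \<circ> a) (p \<circ> b)"
  using assms by (intro homotopic_paths_continuous_image[of "{0..1}"]) (auto simp: path_in_def path_def path_image_def)

lemma path_class_const_right:
  assumes "path_in S p" shows "path_class S (p +++ (\<lambda>_. pathfinish p)) = path_class S p"
proof -
  have "homotopic_paths {0..1} (linepath 0 (1::real) +++ linepath 1 1) (linepath 0 1)"
    by (rule homotopic_paths_rid') (auto simp: closed_segment_eq_real_ivl)
  from homotopic_paths_01[OF assms this] show ?thesis
    by (intro path_class_cong) (simp add: path_compose_join pathfinish_def)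
qed

lemma path_class_const_left:
  assumes "path_in S p" shows "path_class S ((\<lambda>_. pathstart p) +++ p) = path_class S p"
proof -
  have "homotopic_paths {0..1} (linepath 0 0 +++ linepath 0 (1::real)) (linepath 0 1)"
    by (rule homotopic_paths_lid') (auto simp: closed_segment_eq_real_ivl)
  from homotopic_paths_01[OF assms this] show ?thesis
    by (intro path_class_cong) (simp add: path_compose_join pathstart_def)
qed

lemma path_class_inverse_right:
  assumes "path_in S p" shows "path_class S (p +++ reversepath p) = path_class S (\<lambda>_. pathstart p)"
proof -
  have "homotopic_paths {0..1} (linepath 0 (1::real) +++ reversepath (linepath 0 1)) (linepath 0 0)"
    using homotopic_paths_rinv[of "linepath 0 (1::real)" "{0..1}"] by (simp add: closed_segment_eq_real_ivl)
  from homotopic_paths_01[OF assms this] show ?thesis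
    by (intro path_class_cong) (simp add: path_compose_join path_compose_reversepath pathstart_def del: reversepath_linepath)
qed

lemma path_class_inverse_left:
  assumes "path_in S p" shows "path_class S (reversepath p +++ p) = path_class S (\<lambda>_. pathfinish p)"
  using path_class_inverse_right[of S "reversepath p"] assms by simp

lemma pathstart_const [simp]: "pathstart (\<lambda>_. s) = s" "pathfinish (\<lambda>_. s) = s"
  by (simp_all add: pathstart_def pathfinish_def)

lemma path_class_cancel:
  assumes "path_in S p" "path_in S q" "path_in S r" "pathfinish p = pathstart q" "pathstart r = pathstart q"
  shows "path_class S ((p +++ q) +++ (reversepath q +++ r)) = path_class S (p +++ r)"
proof -
  have "path_class S ((p +++ q) +++ (reversepath q +++ r)) = path_class S (p +++ (q +++ (reversepath q +++ r)))"
    using assms by (intro path_class_assoc) auto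
  also have "\<dots> = path_class S (p +++ ((q +++ reversepath q) +++ r))"
    using assms by (intro path_class_join refl path_class_assoc[symmetric]) auto
  also have "\<dots> = path_class S (p +++ ((\<lambda>_. pathstart r) +++ r))"
    using assms path_class_inverse_right[of S q] by (intro path_class_join refl) auto
  also have "\<dots> = path_class S (p +++ r)"
    using assms path_class_const_left[of S r]
    by (intro path_class_join refl path_in_join path_in_const)
      (auto simp: path_in_def path_image_def pathstart_def joinpaths_def)
  finally show ?thesis .
qed

abbreviation loop_at :: "'a::topological_space set \<Rightarrow> 'a \<Rightarrow> (real \<Rightarrow> 'a) \<Rightarrow> bool" where
  "loop_at S s p \<equiv> path_in S p \<and> pathstart p = s \<and> pathfinish p = s"

lemma carrier_fundamental_group: "carrier (fundamental_group S s) = path_class S ` {p. loop_at S s p}"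
  by (simp add: fundamental_group_def path_in_def conj_assoc)

lemma one_fundamental_group: "\<one>\<^bsub>fundamental_group S s\<^esub> = path_class S (\<lambda>_. s)"
  by (simp add: fundamental_group_def)

lemma mult_fundamental_group:
  assumes "path_in S p" "path_in S q" "pathfinish p = pathstart q"
  shows "path_class S p \<otimes>\<^bsub>fundamental_group S s\<^esub> path_class S q = path_class S (p +++ q)"
proof -
  have "(\<exists>p'\<in>path_class S p. \<exists>q'\<in>path_class S q. homotopic_paths S (p' +++ q') r) \<longleftrightarrow> homotopic_paths S (p +++ q) r" for r
  proof
    assume "\<exists>p'\<in>path_class S p. \<exists>q'\<in>path_class S q. homotopic_paths S (p' +++ q') r"
    then obtain p' q' where pq: "homotopic_paths S p p'" "homotopic_paths S q q'" "homotopic_paths S (p' +++ q') r"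
      by (auto simp: path_class_def)
    then have "homotopic_paths S (p +++ q) (p' +++ q')" using assms by (intro homotopic_paths_join) auto
    then show "homotopic_paths S (p +++ q) r" using pq homotopic_paths_trans by blast
  next
    assume "homotopic_paths S (p +++ q) r"
    moreover have "p \<in> path_class S p" "q \<in> path_class S q" using assms by (auto simp: path_class_def path_in_def)
    ultimately show "\<exists>p'\<in>path_class S p. \<exists>q'\<in>path_class S q. homotopic_paths S (p' +++ q') r" by blast
  qed
  then show ?thesis by (simp add: fundamental_group_def path_class_def)
qed

lemma group_fundamental_group:
  assumes s: "s \<in> S" shows "group (fundamental_group S s)"
proof (rule groupI)
  show "\<one>\<^bsub>fundamental_group S s\<^esub> \<in> carrier (fundamental_group S s)"
    using s by (auto simp: one_fundamental_group carrier_fundamental_group)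
next
  fix x y assume "x \<in> carrier (fundamental_group S s)" "y \<in> carrier (fundamental_group S s)"
  then obtain p q where pq: "loop_at S s p" "x = path_class S p" "loop_at S s q" "y = path_class S q"
    by (auto simp: carrier_fundamental_group)
  then have "x \<otimes>\<^bsub>fundamental_group S s\<^esub> y = path_class S (p +++ q)" by (simp add: mult_fundamental_group)
  moreover have "loop_at S s (p +++ q)" using pq by auto
  ultimately show "x \<otimes>\<^bsub>fundamental_group S s\<^esub> y \<in> carrier (fundamental_group S s)" 
    by (auto simp: carrier_fundamental_group)
next
  fix x y z assume "x \<in> carrier (fundamental_group S s)" "y \<in> carrier (fundamental_group S s)" "z \<in> carrier (fundamental_group S s)"
  then obtain p q r where pq: "loop_at S s p" "x = path_class S p" "loop_at S s q" "y = path_class S q"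
    "loop_at S s r" "z = path_class S r"
    by (auto simp: carrier_fundamental_group)
  then show "x \<otimes>\<^bsub>fundamental_group S s\<^esub> y \<otimes>\<^bsub>fundamental_group S s\<^esub> z =
      x \<otimes>\<^bsub>fundamental_group S s\<^esub> (y \<otimes>\<^bsub>fundamental_group S s\<^esub> z)"
    by (simp add: mult_fundamental_group path_class_assoc)
next
  fix x assume "x \<in> carrier (fundamental_group S s)"
  then obtain p where p: "loop_at S s p" "x = path_class S p" by (auto simp: carrier_fundamental_group)
  show "\<one>\<^bsub>fundamental_group S s\<^esub> \<otimes>\<^bsub>fundamental_group S s\<^esub> x = x"
    using p s path_class_const_left[of S p] by (simp add: one_fundamental_group mult_fundamental_group)
  have "path_class S (reversepath p) \<otimes>\<^bsub>fundamental_group S s\<^esub> x = \<one>\<^bsub>fundamental_group S s\<^esub>"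
    using p path_class_inverse_left[of S p] by (simp add: one_fundamental_group mult_fundamental_group)
  moreover have "path_class S (reversepath p) \<in> carrier (fundamental_group S s)"
    using p by (auto simp: carrier_fundamental_group)
  ultimately show "\<exists>y\<in>carrier (fundamental_group S s). y \<otimes>\<^bsub>fundamental_group S s\<^esub> x = \<one>\<^bsub>fundamental_group S s\<^esub>" by blast
qed

lemma holonomy_hom:
  assumes "group \<Gamma>" and germ: "germ_cocycle \<Gamma> \<tau> S"
  shows "\<exists>\<rho>\<in>hom (fundamental_group S s) \<Gamma>. \<forall>p. loop_at S s p \<longrightarrow> \<rho> (path_class S p) = holonomy \<Gamma> \<tau> p"
proof -
  interpret group \<Gamma> by fact
  define \<rho> where "\<rho> A = holonomy \<Gamma> \<tau> (SOME p. p \<in> A)" for A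
  have \<rho>: "\<rho> (path_class S p) = holonomy \<Gamma> \<tau> p" if "path_in S p" for p
  proof -
    have "p \<in> path_class S p" using that by (simp add: path_class_def path_in_def)
    then have "(SOME q. q \<in> path_class S p) \<in> path_class S p" by (metis someI)
    then have "homotopic_paths S p (SOME q. q \<in> path_class S p)" by (simp add: path_class_def)
    then show ?thesis unfolding \<rho>_def by (rule holonomy_homotopic[OF germ, symmetric])
  qed
  have "\<rho> \<in> hom (fundamental_group S s) \<Gamma>"
  proof (rule homI)
    fix x assume "x \<in> carrier (fundamental_group S s)"
    then show "\<rho> x \<in> carrier \<Gamma>"
      using holonomy_closed[OF germ] by (auto simp: carrier_fundamental_group \<rho> path_in_def)
  next
    fix x y assume "x \<in> carrier (fundamental_group S s)" "y \<in> carrier (fundamental_group S s)"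
    then obtain p q where "loop_at S s p" "x = path_class S p" "loop_at S s q" "y = path_class S q"
      by (auto simp: carrier_fundamental_group)
    then show "\<rho> (x \<otimes>\<^bsub>fundamental_group S s\<^esub> y) = \<rho> x \<otimes>\<^bsub>\<Gamma>\<^esub> \<rho> y"
      by (simp add: mult_fundamental_group \<rho>) (simp add: holonomy_join[OF germ] path_in_def)
  qed
  then show ?thesis using \<rho> by auto
qed

section \<open>Quotients of convex sets with contractible neighbourhoods\<close>

lemma prod_topology_top_of_set:
  "prod_topology (top_of_set A) (top_of_set B) = top_of_set (A \<times> B)"
proof -
  have "prod_topology euclidean euclidean = (euclidean :: ('a \<times> 'b) topology)"
    unfolding topology_eq openin_prod_topology by (simp add: open_product_open_eq flip: open_openin)
  then show ?thesis using subtopology_Times[of euclidean euclidean A B] by simp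
qed

text \<open>A star of \<open>s\<close> is the preimage \<open>W\<close> of a neighbourhood of \<open>s\<close> with a contraction \<open>K\<close> onto points over
  \<open>s\<close> that respects each of the gluing relations \<open>R k\<close> separately. The set \<open>W\<close> may have several
  components, one around each point over \<open>s\<close>; that \<open>K z 1\<close> is locally constant says that each of
  them shrinks to a single point.\<close>

definition star ::
  "(complex \<Rightarrow> 's) \<Rightarrow> complex set \<Rightarrow> ('k \<Rightarrow> complex \<Rightarrow> complex \<Rightarrow> bool) \<Rightarrow> 's \<Rightarrow> complex set \<Rightarrow> (complex \<Rightarrow> real \<Rightarrow> complex) \<Rightarrow> bool" where
  "star q D R s W K \<longleftrightarrow> openin (top_of_set D) W \<and>
     (\<exists>c\<in>W. q c = s \<and> (\<forall>t\<in>{0..1}. K c t = c)) \<and>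
     continuous_on (W \<times> {0..1}) (\<lambda>(z, t). K z t) \<and>
     (\<forall>z\<in>W. K z 0 = z \<and> q (K z 1) = s \<and> (\<forall>t\<in>{0..1}. K z t \<in> D) \<and>
        (\<exists>T. openin (top_of_set D) T \<and> z \<in> T \<and> T \<subseteq> W \<and> (\<forall>y\<in>T. K y 1 = K z 1))) \<and>
     (\<forall>k z w. R k z w \<longrightarrow> (z \<in> W \<longleftrightarrow> w \<in> W) \<and> (z \<in> W \<longrightarrow> (\<forall>t\<in>{0..1}. R k (K z t) (K w t))))"

locale star_quotient =
  fixes q :: "complex \<Rightarrow> 's::topological_space" and D S and R :: "'k \<Rightarrow> complex \<Rightarrow> complex \<Rightarrow> bool"
  assumes quotient: "quotient_map (top_of_set D) (top_of_set S) q"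
    and convex: "convex D"
    and R_in: "R k z w \<Longrightarrow> z \<in> D \<and> w \<in> D"
    and fibres: "z \<in> D \<Longrightarrow> w \<in> D \<Longrightarrow> q z = q w \<longleftrightarrow> equivclp (\<lambda>z w. \<exists>k. R k z w) z w"
    and stars: "s \<in> S \<Longrightarrow> \<exists>W K. star q D R s W K"
begin

lemma q_cont: "continuous_on D q" and q_image: "q ` D = S"
  using quotient quotient_imp_continuous_map quotient_imp_surjective_map by force+

lemma q_R: "R k z w \<Longrightarrow> q z = q w"
  using fibres R_in by (blast intro: r_into_equivclp)

lemma fibre_induct:
  assumes "z \<in> D" "w \<in> D" "q z = q w" "P z"
    and "\<And>k u v. R k u v \<Longrightarrow> P u \<longleftrightarrow> P v"
  shows "P w"
proof -
  have "equivclp (\<lambda>z w. \<exists>k. R k z w) z w" using fibres assms by blast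
  then show ?thesis by (induction rule: equivclp_induct) (use assms in blast)+
qed

definition W where "W s = fst (SOME WK. star q D R s (fst WK) (snd WK))"
definition K where "K s = snd (SOME WK. star q D R s (fst WK) (snd WK))"
definition U where "U s = q ` W s"

lemma star_WK: assumes "s \<in> S" shows "star q D R s (W s) (K s)"
proof -
  obtain A B where "star q D R s A B" using stars[OF assms] by blast
  then have "star q D R s (fst (A, B)) (snd (A, B))" by simp
  then show ?thesis unfolding W_def K_def by (rule someI[where P = "\<lambda>WK. star q D R s (fst WK) (snd WK)"])
qed

context
  fixes s assumes s: "s \<in> S"
begin

lemma W_open: "openin (top_of_set D) (W s)"
  and W_sub: "W s \<subseteq> D"
  and K_cont: "continuous_on (W s \<times> {0..1}) (\<lambda>(z, t). K s z t)"
  using star_WK[OF s] openin_imp_subset by (auto simp: star_def)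

lemma K_props: assumes "z \<in> W s"
  shows "K s z 0 = z" "q (K s z 1) = s" "t \<in> {0..1} \<Longrightarrow> K s z t \<in> D"
  using star_WK[OF s] assms by (auto simp: star_def)

lemma K_local: assumes "z \<in> W s"
  obtains T where "openin (top_of_set D) T" "z \<in> T" "T \<subseteq> W s" "\<And>y. y \<in> T \<Longrightarrow> K s y 1 = K s z 1"
proof -
  have "\<forall>z\<in>W s. K s z 0 = z \<and> q (K s z 1) = s \<and> (\<forall>t\<in>{0..1}. K s z t \<in> D) \<and>
        (\<exists>T. openin (top_of_set D) T \<and> z \<in> T \<and> T \<subseteq> W s \<and> (\<forall>y\<in>T. K s y 1 = K s z 1))"
    using star_WK[OF s] unfolding star_def by (elim conjE)
  from bspec[OF this assms] have "\<exists>T. openin (top_of_set D) T \<and> z \<in> T \<and> T \<subseteq> W s \<and> (\<forall>y\<in>T. K s y 1 = K s z 1)"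
    by (elim conjE)
  then obtain T where T: "openin (top_of_set D) T \<and> z \<in> T \<and> T \<subseteq> W s \<and> (\<forall>y\<in>T. K s y 1 = K s z 1)"
    by (rule exE)
  note rest = conjunct2[OF T] conjunct2[OF conjunct2[OF T]]
  show thesis
    by (rule that[OF conjunct1[OF T] conjunct1[OF rest(1)] conjunct1[OF rest(2)] bspec[OF conjunct2[OF rest(2)]]])
qed

lemma center: obtains c where "c \<in> W s" "q c = s" "\<And>t. t \<in> {0..1} \<Longrightarrow> K s c t = c"
proof -
  have "\<exists>c\<in>W s. q c = s \<and> (\<forall>t\<in>{0..1}. K s c t = c)"
    using star_WK[OF s] unfolding star_def by (elim conjE)
  then show thesis using that by blast
qed

lemma gluing: "\<forall>k z w. R k z w \<longrightarrow> (z \<in> W s \<longleftrightarrow> w \<in> W s) \<and> (z \<in> W s \<longrightarrow> (\<forall>t\<in>{0..1}. R k (K s z t) (K s w t)))"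
  using star_WK[OF s] unfolding star_def by (elim conjE)

lemma W_R: "R k z w \<Longrightarrow> z \<in> W s \<longleftrightarrow> w \<in> W s"
  using gluing by metis

lemma K_R: "R k z w \<Longrightarrow> z \<in> W s \<Longrightarrow> t \<in> {0..1} \<Longrightarrow> R k (K s z t) (K s w t)"
  using gluing by metis

lemma W_saturated:
  assumes "z \<in> W s" "w \<in> D" "q z = q w" shows "w \<in> W s"
  using fibre_induct[of z w "\<lambda>w. w \<in> W s"] assms W_R W_sub by blast

lemma K_fibre:
  assumes "z \<in> W s" "w \<in> D" "q z = q w" "t \<in> {0..1}" shows "q (K s z t) = q (K s w t)"
proof -
  have "w \<in> W s \<and> q (K s z t) = q (K s w t)"
  proof (rule fibre_induct[of z w "\<lambda>w. w \<in> W s \<and> q (K s z t) = q (K s w t)"])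
    show "z \<in> W s \<and> q (K s z t) = q (K s z t)" using assms by simp
    show "(u \<in> W s \<and> q (K s z t) = q (K s u t)) \<longleftrightarrow> (v \<in> W s \<and> q (K s z t) = q (K s v t))" if "R k u v" for k u v
      using that W_R[OF that] K_R[OF that _ assms(4)] q_R by metis
  qed (use assms W_sub in auto)
  then show ?thesis by simp
qed

lemma q_W_vimage: "{z \<in> D. q z \<in> U s} = W s"
  using W_saturated W_sub by (auto simp: U_def)

lemma U_open: "openin (top_of_set S) (U s)"
proof -
  have "U s \<subseteq> S" using W_sub q_image by (auto simp: U_def)
  then show ?thesis using quotient q_W_vimage W_open unfolding quotient_map_def by (metis topspace_euclidean_subtopology)
qed

lemma s_in_U: "s \<in> U s"
  using center by (auto simp: U_def)

text \<open>The interval is locally compact, so the product of \<open>q\<close> with the interval is again a quotient map,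
  and the contraction of \<open>W\<close> descends to the surface.\<close>

lemma homotopy_exists:
  "\<exists>H. continuous_on (U s \<times> {0..1}) H \<and> (\<forall>z\<in>W s. \<forall>t\<in>{0..1}. H (q z, t) = q (K s z t))"
proof -
  have "quotient_map (top_of_set (W s)) (top_of_set (U s)) q"
  proof -
    have "quotient_map (subtopology (top_of_set D) {x \<in> topspace (top_of_set D). q x \<in> U s}) (subtopology (top_of_set S) (U s)) q"
      by (rule quotient_map_restriction[OF quotient]) (use U_open in auto)
    moreover have "D \<inter> W s = W s" "S \<inter> U s = U s" using W_sub openin_imp_subset[OF U_open] by auto
    ultimately show ?thesis using q_W_vimage by (simp add: subtopology_subtopology)
  qed
  then have quo: "quotient_map (prod_topology (top_of_set (W s)) (top_of_set {0..1::real}))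
     (prod_topology (top_of_set (U s)) (top_of_set {0..1})) (\<lambda>(x, y). (q x, y))"
    by (intro quotient_map_prod_left disjI1 compact_imp_locally_compact_space)
      (auto simp: compact_space_subtopology Hausdorff_space_subtopology)
  have contK: "continuous_map (prod_topology (top_of_set (W s)) (top_of_set {0..1::real})) (top_of_set S) (\<lambda>(z, t). q (K s z t))"
  proof -
    have "continuous_on (W s \<times> {0..1}) (q \<circ> (\<lambda>(z, t). K s z t))"
      by (rule continuous_on_compose[OF K_cont]) (auto intro!: continuous_on_subset[OF q_cont] K_props)
    moreover have "(q \<circ> (\<lambda>(z, t). K s z t)) ` (W s \<times> {0..1}) \<subseteq> S" using K_props q_image by auto
    ultimately show ?thesis
      by (simp add: prod_topology_top_of_set o_def case_prod_unfold image_subset_iff_funcset)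
  qed
  obtain H where H: "continuous_map (prod_topology (top_of_set (U s)) (top_of_set {0..1::real})) (top_of_set S) H"
    "\<And>x. x \<in> W s \<times> {0..1} \<Longrightarrow> H ((\<lambda>(x, y). (q x, y)) x) = (\<lambda>(z, t). q (K s z t)) x"
  proof (rule quotient_map_lift_exists[OF quo contK])
    show "(case x of (z, t) \<Rightarrow> q (K s z t)) = (case y of (z, t) \<Rightarrow> q (K s z t))"
      if "x \<in> topspace (prod_topology (top_of_set (W s)) (top_of_set {0..1::real}))"
        "y \<in> topspace (prod_topology (top_of_set (W s)) (top_of_set {0..1::real}))"
        "(case x of (x, y) \<Rightarrow> (q x, y)) = (case y of (x, y) \<Rightarrow> (q x, y))" for x y
      using that W_sub by (auto intro!: K_fibre)
  qed auto
  have "continuous_on (U s \<times> {0..1}) H"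
    using H(1) by (simp add: prod_topology_top_of_set)
  then show ?thesis using H(2) by (intro exI[of _ H]) fastforce
qed

end

subsection \<open>Holonomy of a labelling of the gluings\<close>

context
  fixes \<Gamma> :: "('g, 'm) monoid_scheme" and \<pi> :: "complex \<Rightarrow> 'g" and h :: "'k \<Rightarrow> 'g"
  assumes \<Gamma>: "group \<Gamma>" and \<pi>: "\<And>z. \<pi> z \<in> carrier \<Gamma>" and h: "\<And>k. h k \<in> carrier \<Gamma>"
    and \<pi>_R: "\<And>k z w. R k z w \<Longrightarrow> \<pi> w = \<pi> z \<otimes>\<^bsub>\<Gamma>\<^esub> h k"
begin

interpretation group \<Gamma> by (rule \<Gamma>)

text \<open>The labels \<open>\<pi>\<close> jump by \<open>h k\<close> across the gluing \<open>k\<close>. A star contracts glued points through points that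
  are glued by the same \<open>k\<close>; hence the change of label along the contraction of a lift depends on
  the point of the surface only (\<open>step_fibre\<close>), and defines a transport.\<close>

definition step where "step s y = \<pi> (K s y 1) \<otimes>\<^bsub>\<Gamma>\<^esub> inv\<^bsub>\<Gamma>\<^esub> \<pi> y"

definition \<tau> where "\<tau> s u = (if s \<in> S \<and> u \<in> U s then step s (SOME y. y \<in> W s \<and> q y = u) else \<one>\<^bsub>\<Gamma>\<^esub>)"

lemma step_closed: "step s y \<in> carrier \<Gamma>"
  by (simp add: step_def \<pi>)

lemma \<tau>_closed: "\<tau> s u \<in> carrier \<Gamma>"
  by (simp add: \<tau>_def step_closed)

lemma step_fibre:
  assumes s: "s \<in> S" and "z \<in> W s" "w \<in> D" "q z = q w"
  shows "step s z = step s w"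
proof -
  have "w \<in> W s \<and> step s z = step s w"
  proof (rule fibre_induct[of z w "\<lambda>w. w \<in> W s \<and> step s z = step s w"])
    have "step s u = step s v" if "R k u v" "u \<in> W s" for k u v
    proof -
      have "R k (K s u 1) (K s v 1)" using K_R[OF s that] by simp
      then show ?thesis using \<pi>_R[OF that(1)] \<pi>_R[of k "K s u 1" "K s v 1"] \<pi> h
        by (simp add: step_def m_assoc inv_mult_group)
    qed
    then show "(u \<in> W s \<and> step s z = step s u) \<longleftrightarrow> (v \<in> W s \<and> step s z = step s v)" if "R k u v" for k u v
      using that W_R[OF s that] by metis
  qed (use assms W_sub[OF s] in auto)
  then show ?thesis by simp
qed

lemma \<tau>_eq:
  assumes s: "s \<in> S" and y: "y \<in> W s" shows "\<tau> s (q y) = step s y"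
proof -
  have "(SOME z. z \<in> W s \<and> q z = q y) \<in> W s \<and> q (SOME z. z \<in> W s \<and> q z = q y) = q y"
    by (rule someI[where P = "\<lambda>z. z \<in> W s \<and> q z = q y"]) (use y in simp)
  then have "step s (SOME z. z \<in> W s \<and> q z = q y) = step s y"
    using y W_sub[OF s] by (intro step_fibre[OF s]) auto
  then show ?thesis using s y by (simp add: \<tau>_def U_def)
qed

text \<open>The contraction fixes one point over \<open>s\<close>, where the step is trivial, so it is trivial at all
  points over \<open>s\<close>.\<close>

lemma \<pi>_retract:
  assumes "y \<in> D" shows "y \<in> W (q y)" "\<pi> (K (q y) y 1) = \<pi> y"
proof -
  have s: "q y \<in> S" using assms q_image by auto
  obtain c where c: "c \<in> W (q y)" "q c = q y" "K (q y) c 1 = c" by (rule center[OF s]) auto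
  show "y \<in> W (q y)" using W_saturated[OF s c(1) assms] c by simp
  have "step (q y) y = \<one>\<^bsub>\<Gamma>\<^esub>" using step_fibre[OF s c(1) assms] c \<pi> by (simp add: step_def)
  then show "\<pi> (K (q y) y 1) = \<pi> y"
    using \<pi> inv_equality[of "\<pi> (K (q y) y 1)" "inv\<^bsub>\<Gamma>\<^esub> \<pi> y"] by (simp add: step_def)
qed

text \<open>For \<open>w\<close> near \<open>u\<close> the whole contraction of \<open>w\<close> towards \<open>u\<close> stays inside the star of \<open>s\<close>, by the tube
  lemma. Along it the end of the contraction towards \<open>s\<close> is locally constant, hence constant, and
  the steps from \<open>s\<close> to \<open>u\<close> and from \<open>u\<close> to \<open>w\<close> compose.\<close>

lemma \<tau>_transports:
  assumes s: "s \<in> S" and u: "u \<in> U s" shows "transports \<Gamma> \<tau> S (\<tau> s) u"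
proof -
  have uS: "u \<in> S" using u openin_imp_subset[OF U_open[OF s]] by auto
  obtain H where H: "continuous_on (U u \<times> {0..1}) H" "\<And>z t. z \<in> W u \<Longrightarrow> t \<in> {0..1} \<Longrightarrow> H (q z, t) = q (K u z t)"
    using homotopy_exists[OF uS] by blast
  define Z where "Z = (U u \<times> {0..1}) \<inter> H -` U s"
  have "openin (top_of_set (U u \<times> {0..1})) Z"
  proof -
    have "H ` (U u \<times> {0..1}) \<subseteq> S" using H(2) K_props[OF uS] q_image by (auto simp: U_def)
    then show ?thesis unfolding Z_def using H(1) U_open[OF s] 
      by (metis continuous_openin_preimage image_subset_iff_funcset)
  qed
  moreover have "{u} \<times> {0..1} \<subseteq> Z"
  proof -
    obtain c where "c \<in> W u" "q c = u" "\<And>t. t \<in> {0..1} \<Longrightarrow> K u c t = c" by (rule center[OF uS]) auto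
    then show ?thesis using u H(2) s_in_U[OF uS] by (fastforce simp: Z_def)
  qed
  ultimately obtain V T where V: "openin (top_of_set (U u)) V" "u \<in> V" "{0..1} \<subseteq> T" "V \<times> T \<subseteq> Z"
    using tube_lemma_right[of "top_of_set (U u)" "top_of_set {0..1::real}" Z "{0..1}" u] s_in_U[OF uS]
    by (auto simp: prod_topology_top_of_set compactin_subtopology)
  show ?thesis
  proof (rule transportsI)
    show "openin (top_of_set S) V" using V(1) U_open[OF uS] by (rule openin_trans)
    show "u \<in> V" by fact
    fix w assume w: "w \<in> V"
    then obtain y where y: "y \<in> W u" "w = q y" using openin_imp_subset[OF V(1)] by (auto simp: U_def)
    have in_W: "K u y t \<in> W s" if t: "t \<in> {0..1}" for t
    proof -
      have "(w, t) \<in> V \<times> T" using V(3) w t by blast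
      then have "H (w, t) \<in> U s" using V(4) unfolding Z_def by blast
      then have "q (K u y t) \<in> U s" using H(2)[OF y(1) t] y(2) by simp
      then show ?thesis using K_props(3)[OF uS y(1) t] q_W_vimage[OF s] by blast
    qed
    have "(\<lambda>t. K s (K u y t) 1) constant_on {0..1}"
    proof (rule locally_constant_imp_constant)
      fix t :: real assume t: "t \<in> {0..1}"
      obtain T where T: "openin (top_of_set D) T" "K u y t \<in> T" "T \<subseteq> W s"
        "\<And>x. x \<in> T \<Longrightarrow> K s x 1 = K s (K u y t) 1" by (rule K_local[OF s in_W[OF t]]) (rule that)
      have "continuous_on {0..1} ((\<lambda>(z, t). K u z t) \<circ> (\<lambda>t. (y, t)))"
        by (rule continuous_on_compose) (auto intro!: continuous_intros continuous_on_subset[OF K_cont[OF uS]] y)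
      then have cont: "continuous_on {0..1} (K u y)" by (simp add: o_def)
      have "openin (top_of_set {0..1}) ({0..1} \<inter> K u y -` T)"
        by (rule continuous_openin_preimage[OF cont _ T(1)]) (use K_props(3)[OF uS y(1)] in auto)
      moreover have "\<forall>x\<in>{0..1} \<inter> K u y -` T. K s (K u y x) 1 = K s (K u y t) 1"
      proof
        fix x assume "x \<in> {0..1} \<inter> K u y -` T"
        then have "K u y x \<in> T" by simp
        then show "K s (K u y x) 1 = K s (K u y t) 1" by (rule T(4))
      qed
      moreover have "t \<in> {0..1} \<inter> K u y -` T" using T(2) t by simp
      ultimately show "\<exists>T. openin (top_of_set {0..1}) T \<and> t \<in> T \<and> (\<forall>x\<in>T. K s (K u y x) 1 = K s (K u y t) 1)"
        by (intro exI[of _ "{0..1} \<inter> K u y -` T"] conjI)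
    qed auto
    then obtain e where "\<And>t. t \<in> {0..1} \<Longrightarrow> K s (K u y t) 1 = e" unfolding constant_on_def by auto
    from this[of 0] this[of 1] have same: "K s (K u y 1) 1 = K s y 1" using K_props(1)[OF uS y(1)] by simp
    have "\<tau> s w = step s y" using \<tau>_eq[OF s] in_W[of 0] K_props(1)[OF uS y(1)] y by simp
    moreover have "\<tau> s u = step s (K u y 1)" using \<tau>_eq[OF s in_W[of 1]] K_props(2)[OF uS y(1)] by simp
    moreover have "\<tau> u w = step u y" using \<tau>_eq[OF uS y(1)] y by simp
    ultimately show "\<tau> s w = \<tau> s u \<otimes>\<^bsub>\<Gamma>\<^esub> \<tau> u w"
      using same \<pi> by (simp add: step_def m_assoc)
  qed
qed

lemma \<tau>_germ: "germ_cocycle \<Gamma> \<tau> S"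
  unfolding germ_cocycle_def
proof (intro conjI allI ballI)
  show "\<tau> s u \<in> carrier \<Gamma>" for s u by (rule \<tau>_closed)
  show "\<exists>A. openin (top_of_set S) A \<and> s \<in> A \<and> (\<forall>u\<in>A. transports \<Gamma> \<tau> S (\<tau> s) u)" if "s \<in> S" for s
    using U_open[OF that] s_in_U[OF that] \<tau>_transports[OF that] by (intro exI[of _ "U s"]) auto
qed

text \<open>Along a path that lifts to \<open>D\<close> the inverse of the label is horizontal.\<close>

lemma holonomy_lifted:
  assumes \<delta>: "path \<delta>" "path_image \<delta> \<subseteq> D"
  shows "holonomy \<Gamma> \<tau> (q \<circ> \<delta>) = \<pi> (\<delta> 0) \<otimes>\<^bsub>\<Gamma>\<^esub> inv\<^bsub>\<Gamma>\<^esub> \<pi> (\<delta> 1)"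
proof -
  have \<delta>D: "\<delta> t \<in> D" if "t \<in> {0..1}" for t using \<delta> that by (auto simp: path_image_def)
  have "horizontal \<Gamma> (\<lambda>x y. \<tau> ((q \<circ> \<delta>) x) ((q \<circ> \<delta>) y)) {0..1} (\<lambda>t. inv\<^bsub>\<Gamma>\<^esub> \<pi> (\<delta> t))"
    unfolding horizontal_def
  proof (intro ballI conjI)
    fix t :: real assume t: "t \<in> {0..1}"
    show "inv\<^bsub>\<Gamma>\<^esub> \<pi> (\<delta> t) \<in> carrier \<Gamma>" using \<pi> by simp
    have s: "q (\<delta> t) \<in> S" using \<delta>D[OF t] q_image by auto
    obtain T where T: "openin (top_of_set D) T" "\<delta> t \<in> T" "T \<subseteq> W (q (\<delta> t))"
        "\<And>x. x \<in> T \<Longrightarrow> K (q (\<delta> t)) x 1 = K (q (\<delta> t)) (\<delta> t) 1"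
      by (rule K_local[OF s \<pi>_retract(1)[OF \<delta>D[OF t]]]) (rule that)
    show "transports \<Gamma> (\<lambda>x y. \<tau> ((q \<circ> \<delta>) x) ((q \<circ> \<delta>) y)) {0..1} (\<lambda>t. inv\<^bsub>\<Gamma>\<^esub> \<pi> (\<delta> t)) t"
    proof (rule transportsI)
      show "openin (top_of_set {0..1}) ({0..1} \<inter> \<delta> -` T)"
        by (rule continuous_openin_preimage[OF _ _ T(1)]) (use \<delta> \<delta>D in \<open>auto simp: path_def\<close>)
      show "t \<in> {0..1} \<inter> \<delta> -` T" using t T(2) by simp
      fix x assume "x \<in> {0..1} \<inter> \<delta> -` T"
      then have x: "\<delta> x \<in> T" by simp
      have "\<tau> (q (\<delta> t)) (q (\<delta> x)) = step (q (\<delta> t)) (\<delta> x)" using \<tau>_eq[OF s] x T(3) by blast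
      also have "\<dots> = \<pi> (\<delta> t) \<otimes>\<^bsub>\<Gamma>\<^esub> inv\<^bsub>\<Gamma>\<^esub> \<pi> (\<delta> x)"
        unfolding step_def T(4)[OF x] \<pi>_retract(2)[OF \<delta>D[OF t]] ..
      finally show "inv\<^bsub>\<Gamma>\<^esub> \<pi> (\<delta> x) = inv\<^bsub>\<Gamma>\<^esub> \<pi> (\<delta> t) \<otimes>\<^bsub>\<Gamma>\<^esub> \<tau> ((q \<circ> \<delta>) t) ((q \<circ> \<delta>) x)"
        using \<pi> by simp
    qed
  qed
  from holonomy_eq[where p = "q \<circ> \<delta>", OF \<tau>_closed this] show ?thesis
    using \<pi> by simp
qed

end

end

section \<open>Generators of the fundamental group of the quotient\<close>

context star_quotient
begin

context
  fixes z0 assumes z0: "z0 \<in> D"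
begin

definition ray where "ray z = q \<circ> linepath z0 z"

text \<open>The loop that runs inside \<open>D\<close> from \<open>z0\<close> to \<open>z\<close>, passes to the glued point \<open>w\<close>, and returns.\<close>

definition crossing where "crossing z w = path_class S (ray z +++ reversepath (ray w))"

lemma path_in_q: "path \<delta> \<Longrightarrow> path_image \<delta> \<subseteq> D \<Longrightarrow> path_in S (q \<circ> \<delta>)"
  unfolding path_in_def using q_image
  by (auto simp: path_image_compose intro!: path_continuous_image continuous_on_subset[OF q_cont])

lemma segment_in: "z \<in> D \<Longrightarrow> closed_segment z0 z \<subseteq> D"
  using z0 convex by (simp add: closed_segment_subset)

lemma ray_props [simp]:
  assumes "z \<in> D"
  shows "path_in S (ray z)" "pathstart (ray z) = q z0" "pathfinish (ray z) = q z"
  using segment_in[OF assms] unfolding ray_def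
  by (auto intro!: path_in_q simp: pathstart_compose pathfinish_compose)

lemma crossing_loop:
  assumes "z \<in> D" "w \<in> D" "q z = q w"
  shows "loop_at S (q z0) (ray z +++ reversepath (ray w))" 
    "crossing z w \<in> carrier (fundamental_group S (q z0))"
  using assms by (auto simp: crossing_def carrier_fundamental_group)

lemma crossing_mult:
  assumes "x \<in> D" "y \<in> D" "z \<in> D" "q x = q y" "q y = q z"
  shows "crossing x y \<otimes>\<^bsub>fundamental_group S (q z0)\<^esub> crossing y z = crossing x z"
proof -
  have "crossing x y \<otimes>\<^bsub>fundamental_group S (q z0)\<^esub> crossing y z =
      path_class S ((ray x +++ reversepath (ray y)) +++ (reversepath (reversepath (ray y)) +++ reversepath (ray z)))"
    using assms unfolding crossing_def by (simp add: mult_fundamental_group)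
  also have "\<dots> = crossing x z"
    unfolding crossing_def using assms by (intro path_class_cancel) auto
  finally show ?thesis .
qed

lemma crossing_self: "z \<in> D \<Longrightarrow> crossing z z = \<one>\<^bsub>fundamental_group S (q z0)\<^esub>"
  using path_class_inverse_right[of S "ray z"] by (simp add: crossing_def one_fundamental_group)

lemma ray_extend:
  assumes "path \<delta>" "path_image \<delta> \<subseteq> D"
  shows "path_class S (ray (\<delta> 0) +++ (q \<circ> \<delta>)) = path_class S (ray (\<delta> 1))"
proof -
  have d: "\<delta> 0 \<in> D" "\<delta> 1 \<in> D" using assms by (auto simp: path_image_def)
  have "simply_connected D" using convex by (rule convex_imp_simply_connected)
  moreover have "path (linepath z0 (\<delta> 0) +++ \<delta>)" "path_image (linepath z0 (\<delta> 0) +++ \<delta>) \<subseteq> D"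
    using assms segment_in[OF d(1)] by (auto simp: path_image_join pathstart_def)
  moreover have "path (linepath z0 (\<delta> 1))" "path_image (linepath z0 (\<delta> 1)) \<subseteq> D"
    using segment_in[OF d(2)] by auto
  moreover have "pathstart (linepath z0 (\<delta> 1)) = pathstart (linepath z0 (\<delta> 0) +++ \<delta>)" by simp
  moreover have "pathfinish (linepath z0 (\<delta> 1)) = pathfinish (linepath z0 (\<delta> 0) +++ \<delta>)"
    by (simp add: pathfinish_def[of \<delta>])
  ultimately have "homotopic_paths D (linepath z0 (\<delta> 0) +++ \<delta>) (linepath z0 (\<delta> 1))"
    unfolding simply_connected_eq_homotopic_paths by blast
  then have "homotopic_paths S (q \<circ> (linepath z0 (\<delta> 0) +++ \<delta>)) (q \<circ> linepath z0 (\<delta> 1))"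
    using q_cont q_image by (intro homotopic_paths_continuous_image) auto
  then show ?thesis unfolding ray_def by (intro path_class_cong) (simp add: path_compose_join)
qed

text \<open>If both ends of a crossing move along glued paths, the two additional pieces of the loop are each
  other's inverses.\<close>

lemma crossing_along:
  assumes "path \<delta>" "path_image \<delta> \<subseteq> D" "path \<epsilon>" "path_image \<epsilon> \<subseteq> D"
    and same: "\<And>t. t \<in> {0..1} \<Longrightarrow> q (\<delta> t) = q (\<epsilon> t)"
  shows "crossing (\<delta> 0) (\<epsilon> 0) = crossing (\<delta> 1) (\<epsilon> 1)"
proof -
  have d: "\<delta> 0 \<in> D" "\<delta> 1 \<in> D" "\<epsilon> 0 \<in> D" "\<epsilon> 1 \<in> D" using assms by (auto simp: path_image_def)
  have e: "q (\<delta> 0) = q (\<epsilon> 0)" "q (\<delta> 1) = q (\<epsilon> 1)" using same by auto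
  have ends: "pathstart (q \<circ> \<delta>) = q (\<delta> 0)" "pathfinish (q \<circ> \<delta>) = q (\<delta> 1)" 
    "pathstart (q \<circ> \<epsilon>) = q (\<epsilon> 0)" "pathfinish (q \<circ> \<epsilon>) = q (\<epsilon> 1)"
    by (auto simp: pathstart_def pathfinish_def)
  have in_S: "path_in S (q \<circ> \<delta>)" "path_in S (q \<circ> \<epsilon>)" using assms by (auto intro!: path_in_q)
  have "crossing (\<delta> 1) (\<epsilon> 1) = path_class S ((ray (\<delta> 0) +++ (q \<circ> \<delta>)) +++ reversepath (ray (\<epsilon> 0) +++ (q \<circ> \<epsilon>)))"
    unfolding crossing_def using d e ends in_S ray_extend assms
    by (intro path_class_join path_class_reverse) auto
  also have "\<dots> = path_class S ((ray (\<delta> 0) +++ (q \<circ> \<delta>)) +++ (reversepath (q \<circ> \<epsilon>) +++ reversepath (ray (\<epsilon> 0))))"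
    using d e ends by (simp add: reversepath_joinpaths)
  also have "\<dots> = path_class S ((ray (\<delta> 0) +++ (q \<circ> \<delta>)) +++ (reversepath (q \<circ> \<delta>) +++ reversepath (ray (\<epsilon> 0))))"
    using d e ends in_S same
    by (intro path_class_join refl path_class_reverse path_class_cong_eq path_in_join) auto
  also have "\<dots> = crossing (\<delta> 0) (\<epsilon> 0)"
    unfolding crossing_def using d e ends in_S by (intro path_class_cancel) auto
  finally show ?thesis by simp
qed

text \<open>Inside a star every path issuing from the centre contracts onto the track of its endpoint:
  the square \<open>(x, t) \<mapsto> H (p x, t)\<close> has two constant sides.\<close>

lemma path_in_star:
  assumes s: "s \<in> S" and p: "path p" "path_image p \<subseteq> U s" "pathstart p = s"
    and y: "y \<in> W s" "q y = pathfinish p"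
  shows "path_class S p = path_class S (reversepath (q \<circ> K s y))"
proof -
  obtain H where H: "continuous_on (U s \<times> {0..1}) H" "\<And>z t. z \<in> W s \<Longrightarrow> t \<in> {0..1} \<Longrightarrow> H (q z, t) = q (K s z t)"
    using homotopy_exists[OF s] by blast
  obtain c where c: "c \<in> W s" "q c = s" "\<And>t. t \<in> {0..1} \<Longrightarrow> K s c t = c" by (rule center[OF s]) (rule that)
  have pU: "p x \<in> U s" if "x \<in> {0..1}" for x using p that by (auto simp: path_image_def)
  have US: "U s \<subseteq> S" using openin_imp_subset[OF U_open[OF s]] .
  have H0: "H (u, 0) = u" if "u \<in> U s" for u
    using that H(2)[of _ 0] K_props(1)[OF s] by (auto simp: U_def)
  have H1: "H (u, 1) = s" if "u \<in> U s" for u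
    using that H(2)[of _ 1] K_props(2)[OF s] by (auto simp: U_def)
  have Hs: "H (s, t) = s" if "t \<in> {0..1}" for t using H(2)[OF c(1) that] c that by simp
  have HS: "H (u, t) \<in> S" if "u \<in> U s" "t \<in> {0..1}" for u t
    using that H(2) K_props(3)[OF s] q_image by (fastforce simp: U_def)
  define F where "F = (\<lambda>(x, t). H (p x, t))"
  let ?Q = "{0..1::real} \<times> {0..1::real}"
  have F: "continuous_on ?Q F" "F ` ?Q \<subseteq> S"
  proof -
    have "continuous_on ?Q (H \<circ> (\<lambda>(x, t). (p x, t)))"
    proof (rule continuous_on_compose)
      have "continuous_on ?Q (p \<circ> fst)"
        by (rule continuous_on_compose) (use p in \<open>auto simp: path_def intro!: continuous_intros\<close>)
      then show "continuous_on ?Q (\<lambda>(x, t). (p x, t))"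
        unfolding case_prod_unfold o_def by (intro continuous_on_Pair continuous_on_snd continuous_on_id)
      show "continuous_on ((\<lambda>(x, t). (p x, t)) ` ?Q) H"
        by (rule continuous_on_subset[OF H(1)]) (use pU in auto)
    qed
    then show "continuous_on ?Q F" by (simp add: F_def o_def case_prod_unfold)
    show "F ` ?Q \<subseteq> S" using HS pU by (auto simp: F_def)
  qed
  let ?a = "linepath (0::real, 0::real) (1, 0)"
  let ?b = "linepath (0::real, 0::real) (0, 1)" and ?c = "linepath (0::real, 1::real) (1, 1)"
  let ?d = "linepath (1::real, 1::real) (1, 0)"
  have Q: "simply_connected ?Q" by (intro convex_imp_simply_connected convex_Times) auto
  have cQ: "convex ?Q" by (intro convex_Times) auto
  have im: "path_image ?a \<subseteq> ?Q" "path_image ?b \<subseteq> ?Q" "path_image ?c \<subseteq> ?Q" "path_image ?d \<subseteq> ?Q"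
    unfolding path_image_linepath by (intro closed_segment_subset cQ; simp)+
  have "homotopic_paths ?Q ?a (?b +++ (?c +++ ?d))"
    using Q im unfolding simply_connected_eq_homotopic_paths by (auto simp: path_image_join)
  then have "homotopic_paths S (F \<circ> ?a) (F \<circ> (?b +++ (?c +++ ?d)))"
    by (rule homotopic_paths_continuous_image) (use F in auto)
  then have main: "path_class S (F \<circ> ?a) = path_class S ((F \<circ> ?b) +++ ((F \<circ> ?c) +++ (F \<circ> ?d)))"
    by (intro path_class_cong) (simp add: path_compose_join)
  have in_S: "path_in S (F \<circ> ?b)" "path_in S (F \<circ> ?c)" "path_in S (F \<circ> ?d)" "path_in S (F \<circ> ?a)"
  proof -
    have FS: "path_in S (F \<circ> g)" if "path g" "path_image g \<subseteq> ?Q" for g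
      unfolding path_in_def path_image_compose
      using that F(2) by (intro conjI path_continuous_image continuous_on_subset[OF F(1)]) blast+
    show "path_in S (F \<circ> ?b)" "path_in S (F \<circ> ?c)" "path_in S (F \<circ> ?d)" "path_in S (F \<circ> ?a)"
      by (intro FS path_linepath im)+
  qed
  have a: "(F \<circ> ?a) x = p x" if "x \<in> {0..1}" for x
    using H0[OF pU[OF that]] by (simp add: F_def linepath_def)
  have b: "(F \<circ> ?b) x = s" if "x \<in> {0..1}" for x
    using Hs[OF that] p by (simp add: F_def linepath_def pathstart_def)
  have c: "(F \<circ> ?c) x = s" if "x \<in> {0..1}" for x
    using H1[OF pU[OF that]] by (simp add: F_def linepath_def)
  have d: "(F \<circ> ?d) x = reversepath (q \<circ> K s y) x" if "x \<in> {0..1}" for x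
    using H(2)[OF y(1), of "1 - x"] that y(2) by (simp add: F_def linepath_def reversepath_def pathfinish_def)
  let ?r = "reversepath (q \<circ> K s y)"
  have rs: "pathstart ?r = s" using K_props(2)[OF s y(1)] by (simp add: pathstart_def reversepath_def)
  have cont: "continuous_on {0..1} (q \<circ> K s y)"
  proof (rule continuous_on_compose)
    have "continuous_on {0..1} ((\<lambda>(z, t). K s z t) \<circ> (\<lambda>t. (y, t)))"
      by (rule continuous_on_compose) (auto intro!: continuous_intros continuous_on_subset[OF K_cont[OF s]] y)
    then show "continuous_on {0..1} (K s y)" by (simp add: o_def)
    show "continuous_on (K s y ` {0..1}) q" 
      by (rule continuous_on_subset[OF q_cont]) (use K_props(3)[OF s y(1)] in auto)
  qed
  then have "path_in S (q \<circ> K s y)"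
    using K_props(3)[OF s y(1)] q_image by (auto simp: path_in_def path_def path_image_def)
  then have r_in: "path_in S ?r" by simp
  have cr: "path_class S ((\<lambda>_. s) +++ ?r) = path_class S ?r" using path_class_const_left[OF r_in] unfolding rs .
  have "path_class S p = path_class S (F \<circ> ?a)"
    by (rule path_class_cong_eq[symmetric, OF in_S(4)]) (rule a)
  also note main
  also have "path_class S ((F \<circ> ?b) +++ ((F \<circ> ?c) +++ (F \<circ> ?d))) = path_class S ((\<lambda>_. s) +++ ((\<lambda>_. s) +++ ?r))"
    using in_S by (intro path_class_join path_class_cong_eq path_in_join b c d) (auto simp: pathstart_compose pathfinish_compose)
  also have "\<dots> = path_class S ((\<lambda>_. s) +++ ?r)"
    by (intro path_class_join refl cr path_in_const s path_in_join r_in) (simp_all only: pathstart_join pathstart_const rs)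
  also note cr
  finally show ?thesis .
qed

text \<open>Follow a loop \<open>\<gamma>\<close> up to time \<open>t\<close> and return along the ray to a lift of \<open>\<gamma> t\<close>. Another lift changes this
  loop by a crossing, and a small change of \<open>t\<close> changes it, by \<open>path_in_star\<close>, only by the choice of
  the lift. So whether it lies in the subgroup generated by the crossings does not depend on \<open>t\<close>. It does
  for \<open>t = 0\<close>, and for \<open>t = 1\<close> and the lift \<open>z0\<close> it is \<open>\<gamma>\<close> itself.\<close>

lemma crossings_generate:
  "carrier (fundamental_group S (q z0)) =
     generate (fundamental_group S (q z0)) {crossing z w | z w. z \<in> D \<and> w \<in> D \<and> q z = q w}"
    (is "carrier ?G = generate ?G ?X")
proof
  have s0: "q z0 \<in> S" using z0 q_image by auto
  interpret group ?G by (rule group_fundamental_group[OF s0])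
  have X: "?X \<subseteq> carrier ?G" using crossing_loop by auto
  then show "generate ?G ?X \<subseteq> carrier ?G" by (rule generate_incl)
  interpret H: subgroup "generate ?G ?X" ?G by (rule generate_is_subgroup[OF X])
  show "carrier ?G \<subseteq> generate ?G ?X"
  proof
    fix x assume "x \<in> carrier ?G"
    then obtain \<gamma> where \<gamma>: "loop_at S (q z0) \<gamma>" "x = path_class S \<gamma>" by (auto simp: carrier_fundamental_group)
    have \<gamma>_path: "path \<gamma>" "path_image \<gamma> \<subseteq> S" "\<gamma> 0 = q z0" "\<gamma> 1 = q z0"
      using \<gamma> by (auto simp: path_in_def pathstart_def pathfinish_def)
    have \<gamma>S: "\<gamma> t \<in> S" if "t \<in> {0..1}" for t using \<gamma>_path that by (auto simp: path_image_def)
    define piece where "piece a b = \<gamma> \<circ> linepath a b" for a b :: real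
    have seg01: "path_image (linepath a b) \<subseteq> {0..1}" if "a \<in> {0..1}" "b \<in> {0..1}" for a b :: real
      using that by (simp add: closed_segment_eq_real_ivl)
    have sub: "path_in S (piece a b)" if "a \<in> {0..1}" "b \<in> {0..1}" for a b
      unfolding path_in_def piece_def path_image_compose
    proof
      have "continuous_on {0..1} \<gamma>" using \<gamma>_path(1) by (simp add: path_def)
      then show "path (\<gamma> \<circ> linepath a b)"
        by (intro path_continuous_image path_linepath continuous_on_subset[OF _ seg01[OF that]])
      show "\<gamma> ` path_image (linepath a b) \<subseteq> S" using seg01[OF that] \<gamma>S by blast
    qed
    have [simp]: "pathstart (piece a b) = \<gamma> a" "pathfinish (piece a b) = \<gamma> b" for a b
      by (simp_all add: piece_def pathstart_compose pathfinish_compose)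
    define c where "c t y = path_class S (piece 0 t +++ reversepath (ray y))" for t y
    have c_in: "c t y \<in> carrier ?G" if "t \<in> {0..1}" "y \<in> D" "q y = \<gamma> t" for t y
      using that sub[of 0 t] \<gamma>_path by (auto simp: c_def carrier_fundamental_group)
    have c_lift: "c t y = c t y' \<otimes>\<^bsub>?G\<^esub> crossing y' y"
      if "t \<in> {0..1}" "y \<in> D" "q y = \<gamma> t" "y' \<in> D" "q y' = \<gamma> t" for t y y'
    proof -
      have "c t y' \<otimes>\<^bsub>?G\<^esub> crossing y' y =
          path_class S ((piece 0 t +++ reversepath (ray y')) +++ (reversepath (reversepath (ray y')) +++ reversepath (ray y)))"
        unfolding c_def crossing_def using that sub[of 0 t] by (simp add: mult_fundamental_group)
      also have "\<dots> = c t y"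
        unfolding c_def using that sub[of 0 t] by (intro path_class_cancel) auto
      finally show ?thesis by simp
    qed
    define P where "P t \<longleftrightarrow> (\<exists>y\<in>D. q y = \<gamma> t \<and> c t y \<in> generate ?G ?X)" for t
    have P_iff: "P t \<longleftrightarrow> c t y \<in> generate ?G ?X" if t: "t \<in> {0..1}" "y \<in> D" "q y = \<gamma> t" for t y
    proof
      assume "P t"
      then obtain y' where y': "y' \<in> D" "q y' = \<gamma> t" "c t y' \<in> generate ?G ?X" by (auto simp: P_def)
      have "q y' = q y" using y' t by simp
      then have "crossing y' y \<in> generate ?G ?X" using y'(1) t(2) by (intro generate.incl) blast
      then show "c t y \<in> generate ?G ?X" using c_lift[OF t y'(1,2)] y'(3) by simp
    qed (use t in \<open>auto simp: P_def\<close>)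
    have "P constant_on {0..1}"
    proof (rule locally_constant_imp_constant)
      fix t :: real assume t: "t \<in> {0..1}"
      let ?s = "\<gamma> t"
      have s: "?s \<in> S" by (rule \<gamma>S[OF t])
      have "openin (top_of_set {0..1}) ({0..1} \<inter> \<gamma> -` U ?s)"
        by (rule continuous_openin_preimage[OF _ _ U_open[OF s]]) (use \<gamma>_path \<gamma>S in \<open>auto simp: path_def\<close>)
      moreover have "t \<in> {0..1} \<inter> \<gamma> -` U ?s" using t s_in_U[OF s] by simp
      ultimately obtain d where d: "d > 0" "ball t d \<inter> {0..1} \<subseteq> {0..1} \<inter> \<gamma> -` U ?s"
        unfolding openin_contains_ball by blast
      have "P x = P t" if x: "x \<in> ball t d \<inter> {0..1}" for x
      proof -
        have x01: "x \<in> {0..1}" and xU: "\<gamma> x \<in> U ?s" using x d by auto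
        obtain y where y: "y \<in> W ?s" "q y = \<gamma> x" using xU by (auto simp: U_def)
        have yD: "y \<in> D" using y W_sub[OF s] by auto
        let ?r = "K ?s y 1" and ?T = "q \<circ> K ?s y"
        have rD: "?r \<in> D" "q ?r = ?s" using K_props[OF s y(1)] by auto
        have contK: "continuous_on {0..1} ((\<lambda>(z, t). K ?s z t) \<circ> (\<lambda>t. (y, t)))"
          by (rule continuous_on_compose) (auto intro!: continuous_intros continuous_on_subset[OF K_cont[OF s]] y)
        then have pathK: "path (K ?s y)" "path_image (K ?s y) \<subseteq> D"
          using K_props(3)[OF s y(1)] by (auto simp: path_def o_def path_image_def)
        have K0: "K ?s y 0 = y" by (rule K_props(1)[OF s y(1)])
        have T: "path_in S ?T" "pathstart ?T = \<gamma> x" "pathfinish ?T = ?s"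
          using path_in_q[OF pathK] K0 y(2) rD(2) by (auto simp: pathstart_def pathfinish_def)
        have "path_image (piece t x) \<subseteq> U ?s"
        proof -
          have "closed_segment t x \<subseteq> ball t d \<inter> {0..1}"
            using x t d(1) by (intro closed_segment_subset convex_Int) auto
          then show ?thesis using d(2) unfolding piece_def path_image_compose path_image_linepath by blast
        qed
        then have in_star: "path_class S (piece t x) = path_class S (reversepath ?T)"
          using y t x01 sub[OF t x01] by (intro path_in_star[OF s]) (auto simp: path_in_def)
        have "c x y = path_class S ((piece 0 t +++ piece t x) +++ reversepath (ray y))"
        proof -
          have "simply_connected {0..1::real}" by (intro convex_imp_simply_connected) auto
          then have "homotopic_paths {0..1} (linepath 0 t +++ linepath t x) (linepath 0 x)"
            unfolding simply_connected_eq_homotopic_paths using seg01[of 0 t] seg01[of t x] seg01[of 0 x] t x01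
            by (simp add: path_image_join)
          then have "homotopic_paths S (piece 0 t +++ piece t x) (piece 0 x)"
            using homotopic_paths_01[of S \<gamma>] \<gamma> by (simp add: piece_def flip: path_compose_join)
          then have "path_class S (piece 0 t +++ piece t x) = path_class S (piece 0 x)"
            by (rule path_class_cong)
          then show ?thesis unfolding c_def using t x01 yD y sub 
            by (intro path_class_join) auto
        qed
        also have "\<dots> = path_class S (piece 0 t +++ (piece t x +++ reversepath (ray y)))"
          using t x01 yD y sub by (intro path_class_assoc) auto
        also have "\<dots> = path_class S (piece 0 t +++ (reversepath ?T +++ reversepath (ray y)))"
          using t x01 yD y sub T in_star by (intro path_class_join refl) auto
        also have "reversepath ?T +++ reversepath (ray y) = reversepath (ray y +++ ?T)"
          using T yD y by (simp add: reversepath_joinpaths)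
        also have "path_class S (piece 0 t +++ reversepath (ray y +++ ?T)) = c t ?r"
          unfolding c_def using ray_extend[OF pathK] K0 t yD y sub T rD
          by (intro path_class_join path_class_reverse refl) auto
        finally have "c x y = c t ?r" .
        then show ?thesis using P_iff[OF x01 yD y(2)] P_iff[OF t rD] by simp
      qed
      then have "\<forall>x\<in>{0..1} \<inter> ball t d. P x = P t" by blast
      moreover have "openin (top_of_set {0..1}) ({0..1} \<inter> ball t d)" by (rule openin_open_Int) simp
      moreover have "t \<in> {0..1} \<inter> ball t d" using t d(1) by simp
      ultimately show "\<exists>T. openin (top_of_set {0..1}) T \<and> t \<in> T \<and> (\<forall>x\<in>T. P x = P t)"
        by (intro exI[of _ "{0..1} \<inter> ball t d"] conjI)
    qed auto
    then obtain e where e: "\<forall>t\<in>{0..1}. P t = e" unfolding constant_on_def by (rule exE)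
    have "P 0 = P 1" using bspec[OF e, of 0] bspec[OF e, of 1] by simp
    moreover have "P 0"
    proof -
      have r: "path_class S (ray z0) = path_class S (\<lambda>_. q z0)"
        by (simp add: ray_def compose_linepath_01 linepath_const o_def)
      have "c 0 z0 = crossing z0 z0"
        unfolding c_def crossing_def using \<gamma>_path z0 sub[of 0 0] r
        by (intro path_class_join refl) (auto simp: piece_def)
      then show ?thesis using P_iff[of 0 z0] z0 \<gamma>_path crossing_self[OF z0] by (simp add: generate.one)
    qed
    ultimately have "c 1 z0 \<in> generate ?G ?X" using P_iff[of 1 z0] z0 \<gamma>_path by simp
    moreover have "c 1 z0 = x"
    proof -
      have r: "ray z0 = (\<lambda>_. q z0)" by (simp add: ray_def linepath_const o_def)
      have "reversepath (\<lambda>_. q z0) = (\<lambda>_. pathfinish \<gamma>)" using \<gamma> by (simp add: reversepath_def)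
      then show ?thesis using \<gamma> path_class_const_right[of S \<gamma>] unfolding c_def r piece_def by simp
    qed
    ultimately show "x \<in> generate ?G ?X" by simp
  qed
qed

text \<open>Along a crossing the holonomy only sees the labels of its two lifts.\<close>

lemma hom_of_labels:
  fixes \<Gamma> :: "('g, 'm) monoid_scheme"
  assumes \<Gamma>: "group \<Gamma>" and \<pi>: "\<And>z. \<pi> z \<in> carrier \<Gamma>" and h: "\<And>k. h k \<in> carrier \<Gamma>"
    and \<pi>_R: "\<And>k z w. R k z w \<Longrightarrow> \<pi> w = \<pi> z \<otimes>\<^bsub>\<Gamma>\<^esub> h k"
  shows "\<exists>\<rho>\<in>hom (fundamental_group S (q z0)) \<Gamma>. \<forall>z\<in>D. \<forall>w\<in>D. q z = q w \<longrightarrow>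
     \<rho> (crossing z w) = inv\<^bsub>\<Gamma>\<^esub> \<pi> z \<otimes>\<^bsub>\<Gamma>\<^esub> \<pi> w"
proof -
  interpret \<Gamma>: group \<Gamma> by fact
  obtain tau where germ: "germ_cocycle \<Gamma> tau S"
    and lifted: "\<And>\<delta>. path \<delta> \<Longrightarrow> path_image \<delta> \<subseteq> D \<Longrightarrow>
      holonomy \<Gamma> tau (q \<circ> \<delta>) = \<pi> (\<delta> 0) \<otimes>\<^bsub>\<Gamma>\<^esub> inv\<^bsub>\<Gamma>\<^esub> \<pi> (\<delta> 1)"
    by (rule that[OF \<tau>_germ[OF \<Gamma> \<pi> h \<pi>_R] holonomy_lifted[OF \<Gamma> \<pi> h \<pi>_R]])
  obtain \<rho> where \<rho>: "\<rho> \<in> hom (fundamental_group S (q z0)) \<Gamma>"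
    "\<And>p. loop_at S (q z0) p \<Longrightarrow> \<rho> (path_class S p) = holonomy \<Gamma> tau p"
    using holonomy_hom[OF \<Gamma> germ] by blast
  have val: "\<rho> (crossing z w) = \<pi> z0 \<otimes>\<^bsub>\<Gamma>\<^esub> (inv\<^bsub>\<Gamma>\<^esub> \<pi> z \<otimes>\<^bsub>\<Gamma>\<^esub> \<pi> w) \<otimes>\<^bsub>\<Gamma>\<^esub> inv\<^bsub>\<Gamma>\<^esub> \<pi> z0"
    if zw: "z \<in> D" "w \<in> D" "q z = q w" for z w
  proof -
    have seg: "path_image (linepath z0 z) \<subseteq> D" "path_image (linepath w z0) \<subseteq> D"
      using segment_in[OF zw(1)] segment_in[OF zw(2)]
      by (simp_all only: path_image_linepath closed_segment_commute[of w z0])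
    have rev: "reversepath (ray w) = q \<circ> linepath w z0"
      by (simp add: ray_def flip: path_compose_reversepath)
    have "\<rho> (crossing z w) = holonomy \<Gamma> tau (ray z +++ reversepath (ray w))"
      unfolding crossing_def by (rule \<rho>(2)[OF crossing_loop(1)[OF zw]])
    also have "\<dots> = holonomy \<Gamma> tau (ray z) \<otimes>\<^bsub>\<Gamma>\<^esub> holonomy \<Gamma> tau (reversepath (ray w))"
      by (rule \<Gamma>.holonomy_join[OF germ]) (use zw ray_props in \<open>auto simp: path_in_def\<close>)
    also have "\<dots> = (\<pi> z0 \<otimes>\<^bsub>\<Gamma>\<^esub> inv\<^bsub>\<Gamma>\<^esub> \<pi> z) \<otimes>\<^bsub>\<Gamma>\<^esub> (\<pi> w \<otimes>\<^bsub>\<Gamma>\<^esub> inv\<^bsub>\<Gamma>\<^esub> \<pi> z0)"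
      unfolding rev unfolding ray_def
      using lifted[OF path_linepath seg(1)] lifted[OF path_linepath seg(2)]
      by (simp add: linepath_0' linepath_1')
    finally show ?thesis using \<pi> by (simp add: \<Gamma>.m_assoc)
  qed
  \<comment> \<open>conjugation removes the label of the base point\<close>
  define \<rho>' where "\<rho>' x = inv\<^bsub>\<Gamma>\<^esub> \<pi> z0 \<otimes>\<^bsub>\<Gamma>\<^esub> \<rho> x \<otimes>\<^bsub>\<Gamma>\<^esub> \<pi> z0" for x
  have "\<rho>' \<in> hom (fundamental_group S (q z0)) \<Gamma>"
    using \<rho>(1) \<pi> by (auto simp: hom_def \<rho>'_def Pi_iff \<Gamma>.m_assoc)
  moreover have "\<rho>' (crossing z w) = inv\<^bsub>\<Gamma>\<^esub> \<pi> z \<otimes>\<^bsub>\<Gamma>\<^esub> \<pi> w" if "z \<in> D" "w \<in> D" "q z = q w" for z w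
    unfolding \<rho>'_def val[OF that] using \<pi> by (simp add: \<Gamma>.m_assoc)
  ultimately show ?thesis by blast
qed

end

end

section \<open>Stars in the polygon model of a surface\<close>

text \<open>A side is named by the parameter \<open>m\<close> of its first vertex. Sides \<open>m\<close> and \<open>m + 2\<close> are glued for
  \<open>m mod 4 < 2\<close>, and with this numbering both kinds of side pairing are given by the same formula.\<close>

definition is_side :: "nat \<Rightarrow> nat \<Rightarrow> bool" where
  "is_side l m \<longleftrightarrow> m < 4 * l \<and> m mod 4 < 2"

definition glued :: "nat \<Rightarrow> nat \<Rightarrow> complex \<Rightarrow> complex \<Rightarrow> bool" where
  "glued l m z w \<longleftrightarrow> is_side l m \<and>
     (\<exists>t\<in>{0..1}. z = polygon_point l (real m + t) \<and> w = polygon_point l (real m + 3 - t))"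

lemma side_pairing_iff: "side_pairing l z w \<longleftrightarrow> (\<exists>m. glued l m z w)"
proof
  assume "side_pairing l z w"
  then show "\<exists>m. glued l m z w"
  proof cases
    case (side_a j t)
    then show ?thesis by (intro exI[of _ "4 * j"]) (auto simp: glued_def is_side_def intro!: bexI[of _ t])
  next
    case (side_b j t)
    have "is_side l (4 * j + 1)" using side_b(3) unfolding is_side_def by presburger
    then show ?thesis
      using side_b by (intro exI[of _ "4 * j + 1"]) (auto simp: glued_def algebra_simps intro!: bexI[of _ t])
  qed
next
  assume "\<exists>m. glued l m z w"
  then obtain m t where m: "m < 4 * l" "m mod 4 < 2" "0 \<le> t" "t \<le> 1"
    and zw: "z = polygon_point l (real m + t)" "w = polygon_point l (real m + 3 - t)"
    by (auto simp: glued_def is_side_def)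
  define j where "j = m div 4"
  have j: "j < l" using m by (simp add: j_def)
  have "m = 4 * j \<or> m = 4 * j + 1" using m(2) by (simp add: j_def) presburger
  then show "side_pairing l z w"
  proof
    assume "m = 4 * j"
    then show ?thesis using zw side_pairing.side_a[OF j m(3,4)] by simp
  next
    assume "m = 4 * j + 1"
    then show ?thesis using zw side_pairing.side_b[OF j m(3,4)] by (simp add: algebra_simps)
  qed
qed

context
  fixes l :: nat assumes l: "l \<ge> 1"
begin

abbreviation pp where "pp \<equiv> polygon_point l"

definition \<kappa> where "\<kappa> = 2 * pi / (4 * real l)"

lemma \<kappa>: "\<kappa> > 0" "\<kappa> \<le> pi / 2" "\<kappa> * (4 * real l) = 2 * pi"
  using l pi_gt_zero by (auto simp: \<kappa>_def field_simps)

lemma pp_cis: "pp u = cis (\<kappa> * u)"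
  by (simp add: polygon_point_def \<kappa>_def)

lemma norm_pp [simp]: "norm (pp u) = 1"
  by (simp add: pp_cis)

lemma pp_nonzero [simp]: "pp u \<noteq> 0"
  using norm_pp[of u] by force

lemma pp_eq_iff: "pp u = pp v \<longleftrightarrow> (\<exists>i::int. u = v + 4 * real l * of_int i)"
proof -
  have "pp u = pp v \<longleftrightarrow> (\<exists>i::int. \<kappa> * u = \<kappa> * v + 2 * pi * of_int i)"
  proof -
    have "pp u = pp v \<longleftrightarrow> exp (\<i> * of_real (\<kappa> * u)) = exp (\<i> * of_real (\<kappa> * v))"
      by (simp add: pp_cis cis_conv_exp)
    also have "\<dots> \<longleftrightarrow> (\<exists>i::int. \<kappa> * u = \<kappa> * v + 2 * pi * of_int i)"
      unfolding exp_eq by (simp add: complex_eq_iff mult_ac)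
    finally show ?thesis .
  qed
  also have "\<dots> \<longleftrightarrow> (\<exists>i::int. \<kappa> * u = \<kappa> * (v + 4 * real l * of_int i))"
  proof -
    have "\<kappa> * (4 * real l * of_int i) = 2 * pi * of_int i" for i :: int
      unfolding \<kappa>(3)[symmetric] by simp
    then show ?thesis by (simp only: distrib_left)
  qed
  also have "\<dots> \<longleftrightarrow> (\<exists>i::int. u = v + 4 * real l * of_int i)"
    using \<kappa>(1) by simp
  finally show ?thesis .
qed

lemma pp_path: "path (\<lambda>s. pp (c + s * t))"
  unfolding path_def pp_cis by (intro continuous_intros)

lemma boundary_point:
  assumes "norm z = 1" obtains u where "0 \<le> u" "u < 4 * real l" "z = pp u"
proof -
  have "z = cis (Arg2pi z)" using assms Arg2pi_eq[of z] by (simp add: cis_conv_exp mult.commute)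
  moreover have "0 \<le> Arg2pi z" "Arg2pi z < 2 * pi" by (auto simp: Arg2pi_ge_0 Arg2pi_lt_2pi)
  ultimately show thesis using \<kappa> that[of "Arg2pi z / \<kappa>"] by (simp add: pp_cis field_simps)
qed

text \<open>The points whose angle, measured in sides of the polygon, is within \<open>\<epsilon>\<close> of \<open>c\<close>.\<close>

definition sector :: "real \<Rightarrow> real \<Rightarrow> complex set" where
  "sector \<epsilon> c = {z. 0 < Re (z / pp c)} \<inter> {z. \<bar>Im (Ln (z / pp c))\<bar> < \<kappa> * \<epsilon>}"

lemma open_sector: "open (sector \<epsilon> c)"
proof -
  have o: "open {z. 0 < Re (z / pp c)}" by (intro open_Collect_less continuous_intros) auto
  have "continuous_on {z. 0 < Re (z / pp c)} (\<lambda>z. \<bar>Im (Ln (z / pp c))\<bar>)"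
    by (intro continuous_intros) (auto simp: complex_nonpos_Reals_iff)
  from continuous_open_preimage[OF this o open_lessThan[of "\<kappa> * \<epsilon>"]] show ?thesis
    unfolding sector_def vimage_def lessThan_def by simp
qed

lemma sector_polar:
  assumes "z \<in> sector \<epsilon> c"
  obtains v where "\<bar>v\<bar> < \<epsilon>" "z = of_real (norm z) * pp (c + v)" "z \<noteq> 0" "Ln (z / pp c) = of_real (ln (norm z)) + \<i> * of_real (\<kappa> * v)"
proof -
  define w where "w = z / pp c"
  have w: "w \<noteq> 0" "\<bar>Im (Ln w)\<bar> < \<kappa> * \<epsilon>" using assms by (auto simp: sector_def w_def)
  have nw: "norm w = norm z" by (simp add: w_def norm_divide)
  define v where "v = Im (Ln w) / \<kappa>"
  have kv: "\<kappa> * v = Im (Ln w)" using \<kappa> by (simp add: v_def)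
  have "Ln w = of_real (ln (norm w)) + \<i> * of_real (Im (Ln w))"
    using w by (simp add: complex_eq_iff)
  then have L: "Ln w = of_real (ln (norm z)) + \<i> * of_real (\<kappa> * v)" using nw kv by simp
  have "w = exp (Ln w)" using w by simp
  also have "\<dots> = of_real (norm z) * cis (\<kappa> * v)"
  proof -
    have "norm z \<noteq> 0" using w(1) nw by (metis norm_eq_zero)
    then have "exp (of_real (ln (norm z))) = (of_real (norm z) :: complex)"
      by (simp only: exp_of_real exp_ln_iff) simp
    then show ?thesis unfolding L exp_add cis_conv_exp by simp
  qed
  finally have "z = of_real (norm z) * pp (c + v)"
    by (simp add: w_def field_simps pp_cis cis_mult distrib_left)
  moreover have "\<bar>v\<bar> < \<epsilon>" using w(2) \<kappa> kv by (metis abs_mult abs_of_pos mult_less_cancel_left_pos)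
  moreover have "z \<noteq> 0" using w(1) unfolding w_def by auto
  ultimately show thesis using that L by (simp add: w_def)
qed

lemma Ln_pp_divide: assumes "\<bar>u - c\<bar> \<le> 1" shows "Ln (pp u / pp c) = \<i> * of_real (\<kappa> * (u - c))"
proof -
  have "\<bar>\<kappa> * (u - c)\<bar> \<le> pi / 2" 
    using assms \<kappa> mult_mono[of \<kappa> "pi/2" "\<bar>u - c\<bar>" 1] by (simp add: abs_mult)
  then have "- pi < \<kappa> * (u - c)" "\<kappa> * (u - c) \<le> pi" using pi_gt_zero by linarith+
  then have "Ln (exp (\<i> * of_real (\<kappa> * (u - c)))) = \<i> * of_real (\<kappa> * (u - c))"
    by (intro Ln_exp) auto
  moreover have "pp u / pp c = exp (\<i> * of_real (\<kappa> * (u - c)))"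
    unfolding cis_conv_exp[symmetric] by (simp add: pp_cis cis_divide right_diff_distrib)
  ultimately show ?thesis by simp
qed

lemma pp_in_sector: assumes "\<bar>u - c\<bar> < \<epsilon>" "\<epsilon> \<le> 1/2" shows "pp u \<in> sector \<epsilon> c"
proof -
  have "\<bar>\<kappa> * (u - c)\<bar> < \<kappa> * \<epsilon>" using assms \<kappa> by (simp add: abs_mult)
  also have "\<dots> \<le> (pi/2) * (1/2)" using assms \<kappa> by (intro mult_mono) auto
  finally have "\<bar>\<kappa> * (u - c)\<bar> < pi / 2" using pi_gt_zero by simp
  then have "0 < cos (\<kappa> * (u - c))" by (intro cos_gt_zero_pi) auto
  then have "0 < Re (pp u / pp c)" by (simp add: pp_cis cis_divide right_diff_distrib)
  moreover have "\<bar>Im (Ln (pp u / pp c))\<bar> < \<kappa> * \<epsilon>"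
    using Ln_pp_divide[of u c] assms \<kappa> by (simp add: abs_mult)
  ultimately show ?thesis by (simp add: sector_def)
qed

text \<open>Here \<open>s\<close> is a point on the image of the boundary and \<open>Y\<close> is the set of all parameters of its lifts.
  The number \<open>\<epsilon>\<close> is so small that sectors around different parameters are disjoint and that a side
  comes within \<open>\<epsilon>\<close> of a parameter only if it contains it.\<close>

context
  fixes q :: "complex \<Rightarrow> 's" and Y :: "real set" and \<epsilon> :: real and s
  assumes \<epsilon>: "0 < \<epsilon>" "\<epsilon> \<le> 1/2" and Y_ne: "Y \<noteq> {}"
    and Y_shift: "\<And>c i. c \<in> Y \<Longrightarrow> c + 4 * real l * of_int i \<in> Y"
    and Y_side: "\<And>c k u. c \<in> Y \<Longrightarrow> \<bar>u - c\<bar> < \<epsilon> \<Longrightarrow> of_int k \<le> u \<Longrightarrow> u \<le> of_int k + 1 \<Longrightarrow> of_int k \<le> c \<and> c \<le> of_int k + 1"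
    and Y_sep: "\<And>c c'. c \<in> Y \<Longrightarrow> c' \<in> Y \<Longrightarrow> \<bar>c - c'\<bar> < 2 * \<epsilon> \<Longrightarrow> c = c'"
    and Y_q: "\<And>c. c \<in> Y \<Longrightarrow> q (pp c) = s"
    and Y_refl: "\<And>c m. c \<in> Y \<Longrightarrow> is_side l m \<Longrightarrow> real m \<le> c \<and> c \<le> real m + 1 \<or> real m + 2 \<le> c \<and> c \<le> real m + 3 \<Longrightarrow>
       2 * real m + 3 - c \<in> Y"
begin

definition cen where "cen z = (SOME c. c \<in> Y \<and> z \<in> sector \<epsilon> c)"

text \<open>In polar coordinates this moves the radius to one and the angle to that of the centre. It preserves
  the unit circle, and it respects the gluings because they are isometries between arcs.\<close>

definition contract where "contract z t = pp (cen z) * exp (of_real (1 - t) * Ln (z / pp (cen z)))"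

lemma cen_eq: assumes "c \<in> Y" "z \<in> sector \<epsilon> c" shows "pp (cen z) = pp c"
proof -
  have "cen z \<in> Y \<and> z \<in> sector \<epsilon> (cen z)"
    unfolding cen_def by (rule someI[where P = "\<lambda>c. c \<in> Y \<and> z \<in> sector \<epsilon> c"]) (use assms in simp)
  then have c': "cen z \<in> Y" "z \<in> sector \<epsilon> (cen z)" by auto
  obtain v where v: "\<bar>v\<bar> < \<epsilon>" "z = of_real (norm z) * pp (c + v)" "z \<noteq> 0"
    by (rule sector_polar[OF assms(2)]) (rule that)
  obtain v' where v': "\<bar>v'\<bar> < \<epsilon>" "z = of_real (norm z) * pp (cen z + v')" 
    by (rule sector_polar[OF c'(2)]) (rule that)
  have "of_real (norm z) * pp (c + v) = of_real (norm z) * pp (cen z + v')" using v(2) v'(2) by simp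
  then have "pp (c + v) = pp (cen z + v')" using v(3) by simp
  then obtain i :: int where i: "c + v = cen z + v' + 4 * real l * of_int i" unfolding pp_eq_iff by blast
  have "cen z + 4 * real l * of_int i = c"
    by (rule Y_sep[OF Y_shift[OF c'(1)] assms(1)]) (use i v(1) v'(1) in linarith)
  then show ?thesis unfolding pp_eq_iff by (intro exI[of _ "- i"]) (simp add: algebra_simps)
qed

lemma contract_eq:
  assumes "c \<in> Y" "z \<in> sector \<epsilon> c" shows "contract z t = pp c * exp (of_real (1 - t) * Ln (z / pp c))"
  using cen_eq[OF assms] by (simp add: contract_def)

lemma contract_pp:
  assumes "c \<in> Y" "\<bar>u - c\<bar> < \<epsilon>" shows "contract (pp u) t = pp (c + (1 - t) * (u - c))"
proof -
  have "contract (pp u) t = pp c * exp (of_real (1 - t) * Ln (pp u / pp c))"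
    by (rule contract_eq[OF assms(1) pp_in_sector[OF assms(2) \<epsilon>(2)]])
  also have "\<dots> = cis (\<kappa> * c) * cis (\<kappa> * ((1 - t) * (u - c)))"
    using assms \<epsilon> by (subst Ln_pp_divide) (auto simp: pp_cis cis_conv_exp mult_ac)
  finally show ?thesis by (simp add: pp_cis cis_mult distrib_left)
qed

lemma sector_pp:
  assumes "c \<in> Y" "pp u \<in> sector \<epsilon> c" obtains c' where "c' \<in> Y" "\<bar>u - c'\<bar> < \<epsilon>"
proof -
  obtain v where v: "\<bar>v\<bar> < \<epsilon>" "pp u = of_real (norm (pp u)) * pp (c + v)"
    by (rule sector_polar[OF assms(2)]) (rule that)
  then have "pp u = pp (c + v)" by simp
  then obtain i :: int where "u = c + v + 4 * real l * of_int i" unfolding pp_eq_iff by blast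
  then show thesis using that[OF Y_shift[OF assms(1), of i]] v(1) by simp
qed

definition nbhd where "nbhd = cball 0 1 \<inter> (\<Union>c\<in>Y. sector \<epsilon> c)"

lemma glued_in:
  assumes "glued l m z w" and "z \<in> nbhd \<or> w \<in> nbhd"
  obtains c t where "c \<in> Y" "t \<in> {0..1}" "z = pp (real m + t)" "w = pp (real m + 3 - t)"
    "\<bar>real m + t - c\<bar> < \<epsilon>" "real m \<le> c" "c \<le> real m + 1" "2 * real m + 3 - c \<in> Y"
proof -
  obtain t where t: "is_side l m" "t \<in> {0..1}" "z = pp (real m + t)" "w = pp (real m + 3 - t)"
    using assms(1) by (auto simp: glued_def)
  show thesis
  proof (cases "z \<in> nbhd")
    case True
    then obtain c0 where "c0 \<in> Y" "pp (real m + t) \<in> sector \<epsilon> c0" using t by (auto simp: nbhd_def)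
    then obtain c where c: "c \<in> Y" "\<bar>real m + t - c\<bar> < \<epsilon>" by (rule sector_pp)
    have "real m \<le> c \<and> c \<le> real m + 1" using Y_side[OF c, of "int m"] t(2) by simp
    then show thesis using that[OF c(1) t(2,3,4) c(2)] Y_refl[OF c(1) t(1)] by simp
  next
    case False
    then obtain c0 where "c0 \<in> Y" "pp (real m + 3 - t) \<in> sector \<epsilon> c0" using t assms(2) by (auto simp: nbhd_def)
    then obtain c where c: "c \<in> Y" "\<bar>real m + 3 - t - c\<bar> < \<epsilon>" by (rule sector_pp)
    have c2: "real m + 2 \<le> c \<and> c \<le> real m + 3" using Y_side[OF c, of "int m + 2"] t(2) by simp
    let ?c = "2 * real m + 3 - c"
    have "?c \<in> Y" using Y_refl[OF c(1) t(1)] c2 by simp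
    moreover have "\<bar>real m + t - ?c\<bar> < \<epsilon>" using c(2) by linarith
    ultimately show thesis using that[of ?c t] t c(1) c2 by simp
  qed
qed

lemma boundary_star: "star q (cball 0 1) (glued l) s nbhd contract"
  unfolding star_def
proof (intro conjI ballI allI impI)
  show "openin (top_of_set (cball 0 1)) nbhd"
    unfolding nbhd_def by (intro openin_open_Int open_UN ballI open_sector)
  obtain c where c: "c \<in> Y" using Y_ne by blast
  then have "pp c \<in> nbhd" using pp_in_sector[of c c] \<epsilon> by (auto simp: nbhd_def)
  moreover have "contract (pp c) t = pp c" for t using contract_pp[OF c, of c] \<epsilon> by simp
  ultimately show "\<exists>c\<in>nbhd. q c = s \<and> (\<forall>t\<in>{0..1}. contract c t = c)"
    using Y_q[OF c] by (intro bexI[of _ "pp c"]) auto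
  have "continuous_on (\<Union>c\<in>Y. sector \<epsilon> c \<times> UNIV) (\<lambda>(z, t). contract z t)"
  proof (rule continuous_on_open_UN)
    fix c assume c: "c \<in> Y"
    show "open (sector \<epsilon> c \<times> UNIV)" by (intro open_Times open_sector open_UNIV)
    have "continuous_on (sector \<epsilon> c \<times> UNIV) (\<lambda>(z, t). pp c * exp (of_real (1 - t) * Ln (z / pp c)))"
      unfolding case_prod_unfold
      by (intro continuous_intros) (auto simp: sector_def complex_nonpos_Reals_iff)
    moreover have "continuous_on (sector \<epsilon> c \<times> UNIV) (\<lambda>(z, t). pp c * exp (of_real (1 - t) * Ln (z / pp c))) \<longleftrightarrow>
        continuous_on (sector \<epsilon> c \<times> UNIV) (\<lambda>(z, t). contract z t)"
      by (rule continuous_on_cong) (auto simp: contract_eq[OF c])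
    ultimately show "continuous_on (sector \<epsilon> c \<times> UNIV) (\<lambda>(z, t). contract z t)" by blast
  qed
  then show "continuous_on (nbhd \<times> {0..1}) (\<lambda>(z, t). contract z t)"
    by (rule continuous_on_subset) (auto simp: nbhd_def)
next
  fix z assume "z \<in> nbhd"
  then obtain c where c: "c \<in> Y" "z \<in> sector \<epsilon> c" and z: "norm z \<le> 1" by (auto simp: nbhd_def)
  obtain v where v: "z \<noteq> 0" "Ln (z / pp c) = of_real (ln (norm z)) + \<i> * of_real (\<kappa> * v)"
    by (rule sector_polar[OF c(2)]) (rule that)
  show "contract z 0 = z" using v(1) by (simp add: contract_eq[OF c])
  show "q (contract z 1) = s" using Y_q[OF c(1)] by (simp add: contract_eq[OF c])
  show "contract z t \<in> cball 0 1" if t: "t \<in> {0..1}" for t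
  proof -
    have "norm (contract z t) = exp ((1 - t) * ln (norm z))"
      unfolding contract_eq[OF c] v(2) by (simp add: norm_mult norm_exp_eq_Re)
    also have "\<dots> \<le> 1" using t z v(1) by (simp add: mult_nonneg_nonpos)
    finally show ?thesis by simp
  qed
  let ?T = "cball 0 1 \<inter> sector \<epsilon> c"
  have "\<forall>y\<in>?T. contract y 1 = contract z 1"
    using contract_eq[OF c(1), of _ 1] contract_eq[OF c, of 1] by simp
  moreover have "openin (top_of_set (cball 0 1)) ?T" by (intro openin_open_Int open_sector)
  moreover have "z \<in> ?T" "?T \<subseteq> nbhd" using c z by (auto simp: nbhd_def)
  ultimately show "\<exists>T. openin (top_of_set (cball 0 1)) T \<and> z \<in> T \<and> T \<subseteq> nbhd \<and> (\<forall>y\<in>T. contract y 1 = contract z 1)"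
    by (intro exI[of _ ?T] conjI)
next
  fix m z w assume g: "glued l m z w"
  {
    assume "z \<in> nbhd \<or> w \<in> nbhd"
    from glued_in[OF g this] obtain c t where ct: "c \<in> Y" "t \<in> {0..1}" "z = pp (real m + t)"
      "w = pp (real m + 3 - t)" "\<bar>real m + t - c\<bar> < \<epsilon>" "real m \<le> c" "c \<le> real m + 1" "2 * real m + 3 - c \<in> Y" .
    have near: "\<bar>real m + 3 - t - (2 * real m + 3 - c)\<bar> < \<epsilon>" using ct(5) by linarith
    have "z \<in> nbhd" "w \<in> nbhd"
      using pp_in_sector[OF ct(5) \<epsilon>(2)] pp_in_sector[OF near \<epsilon>(2)] ct by (auto simp: nbhd_def)
    moreover have "glued l m (contract z x) (contract w x)" if x: "x \<in> {0..1}" for x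
    proof -
      define t' where "t' = x * (c - real m) + (1 - x) * t"
      have "0 \<le> t'" unfolding t'_def using x ct by (intro add_nonneg_nonneg mult_nonneg_nonneg) auto
      moreover have "t' \<le> 1" unfolding t'_def using x ct by (intro convex_bound_le) auto
      moreover have "contract z x = pp (real m + t')"
        unfolding ct(3) contract_pp[OF ct(1,5)] by (simp add: t'_def algebra_simps)
      moreover have "contract w x = pp (real m + 3 - t')"
        unfolding ct(4) contract_pp[OF ct(8) near] by (simp add: t'_def algebra_simps)
      ultimately show ?thesis using g by (auto simp: glued_def)
    qed
    ultimately have "z \<in> nbhd \<and> w \<in> nbhd \<and> (\<forall>x\<in>{0..1}. glued l m (contract z x) (contract w x))" by blast
  }
  note * = this
  show "z \<in> nbhd \<longleftrightarrow> w \<in> nbhd" using * by blast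
  show "glued l m (contract z x) (contract w x)" if "z \<in> nbhd" "x \<in> {0..1}" for x using * that by blast
qed

end

lemma interior_star:
  assumes y: "norm y < 1"
  shows "star q (cball 0 1) (glued l) (q y) (ball 0 1) (\<lambda>z t. (1 - t) *\<^sub>R z + t *\<^sub>R y)"
proof -
  have in_ball: "(1 - t) *\<^sub>R z + t *\<^sub>R y \<in> ball 0 1" if "z \<in> ball 0 1" "t \<in> {0..1}" for z t
    using that y convexD_alt[OF convex_ball, of z 0 1 y t] by simp
  have not_glued: "z \<notin> ball 0 1 \<and> w \<notin> ball 0 1" if "glued l m z w" for m z w
    using that by (auto simp: glued_def)
  have op: "openin (top_of_set (cball 0 1)) (ball (0::complex) 1)"
    using openin_open_Int[of "ball (0::complex) 1" "cball 0 1"] by (simp add: Int_absorb1 ball_subset_cball)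
  show ?thesis
    unfolding star_def
  proof (intro conjI)
    show "\<exists>c\<in>ball 0 1. q c = q y \<and> (\<forall>t\<in>{0..1}. (1 - t) *\<^sub>R c + t *\<^sub>R y = c)"
      using y by (intro bexI[of _ y]) (auto simp: algebra_simps)
    show "continuous_on (ball 0 1 \<times> {0..1}) (\<lambda>(z, t). (1 - t) *\<^sub>R z + t *\<^sub>R y)"
      unfolding case_prod_unfold by (intro continuous_intros)
    show "\<forall>z\<in>ball 0 1. (1 - 0) *\<^sub>R z + 0 *\<^sub>R y = z \<and> q ((1 - 1) *\<^sub>R z + 1 *\<^sub>R y) = q y \<and>
      (\<forall>t\<in>{0..1}. (1 - t) *\<^sub>R z + t *\<^sub>R y \<in> cball 0 1) \<and>
      (\<exists>T. openin (top_of_set (cball 0 1)) T \<and> z \<in> T \<and> T \<subseteq> ball 0 1 \<and>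
        (\<forall>ya\<in>T. (1 - 1) *\<^sub>R ya + 1 *\<^sub>R y = (1 - 1) *\<^sub>R z + 1 *\<^sub>R y))"
      using in_ball op ball_subset_cball by (auto intro!: exI[of _ "ball 0 1"] less_imp_le)
    show "\<forall>k z w. glued l k z w \<longrightarrow> (z \<in> ball 0 1 \<longleftrightarrow> w \<in> ball 0 1) \<and> (z \<in> ball 0 1 \<longrightarrow>
       (\<forall>t\<in>{0..1}. glued l k ((1 - t) *\<^sub>R z + t *\<^sub>R y) ((1 - t) *\<^sub>R w + t *\<^sub>R y)))"
      using not_glued by blast
  qed (rule op)
qed

lemma pp_shift: "pp (u + 4 * real l * of_int i) = pp u"
  unfolding pp_eq_iff by blast

lemma glued_mid: "is_side l m \<Longrightarrow> 0 \<le> t \<Longrightarrow> t \<le> 1 \<Longrightarrow> glued l m (pp (real m + t)) (pp (real m + 3 - t))"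
  by (auto simp: glued_def)

lemma is_side_index: "j < l \<Longrightarrow> is_side l (4 * j)" "j < l \<Longrightarrow> is_side l (Suc (4 * j))"
  unfolding is_side_def by presburger+

context
  fixes q :: "complex \<Rightarrow> 's"
  assumes q_glued: "\<And>m z w. glued l m z w \<Longrightarrow> q z = q w"
begin

text \<open>The four identities of one handle link its five vertices in the order \<open>4j, 4j+3, 4j+2, 4j+1, 4j+4\<close>,
  so that all vertices of the polygon are one point of the surface.\<close>

lemma vertices_step:
  assumes "j < l"
  shows "q (pp (real (4 * j))) = q (pp (real (4 * j + 3)))" "q (pp (real (4 * j + 1))) = q (pp (real (4 * j + 2)))"
    "q (pp (real (4 * j + 1))) = q (pp (real (4 * j + 4)))" "q (pp (real (4 * j + 2))) = q (pp (real (4 * j + 3)))"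
  using q_glued[OF glued_mid[OF is_side_index(1)[OF assms], of 0]] q_glued[OF glued_mid[OF is_side_index(1)[OF assms], of 1]]
    q_glued[OF glued_mid[OF is_side_index(2)[OF assms], of 0]] q_glued[OF glued_mid[OF is_side_index(2)[OF assms], of 1]]
  by (simp_all add: add_ac)

lemma vertices_block: "j \<le> l \<Longrightarrow> q (pp (real (4 * j))) = q (pp 0)"
proof (induction j)
  case (Suc j)
  then have j: "j < l" by simp
  have e: "4 * Suc j = 4 * j + 4" by simp
  have ih: "q (pp (real (4 * j))) = q (pp 0)" using Suc by simp
  show ?case unfolding e vertices_step(3)[OF j, symmetric] vertices_step(2)[OF j]
    vertices_step(4)[OF j] vertices_step(1)[OF j, symmetric] by (rule ih)
qed simp

lemma vertices_nat: assumes "k < 4 * l" shows "q (pp (real k)) = q (pp 0)"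
proof -
  define j where "j = k div 4"
  have j: "j < l" using assms by (simp add: j_def)
  have "k = 4 * j \<or> k = 4 * j + 1 \<or> k = 4 * j + 2 \<or> k = 4 * j + 3" unfolding j_def by presburger
  moreover have "q (pp (real (4 * j))) = q (pp 0)" using vertices_block[of j] j by simp
  ultimately show ?thesis using vertices_step[OF j] by metis
qed

lemma vertices: "q (pp (of_int k)) = q (pp 0)"
proof -
  let ?r = "nat (k mod (4 * int l))"
  have "of_int k = real ?r + 4 * real l * of_int (k div (4 * int l))"
  proof -
    have "int ?r = k mod (4 * int l)" using l by simp
    then have "k = int ?r + 4 * int l * (k div (4 * int l))" by simp
    then have "real_of_int k = real_of_int (int ?r + 4 * int l * (k div (4 * int l)))" by simp
    then show ?thesis by simp
  qed
  then have "pp (of_int k) = pp (real ?r)" by (simp only: pp_shift)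
  moreover have "?r < 4 * l" using l by (simp add: nat_less_iff)
  ultimately show ?thesis using vertices_nat[of ?r] by (simp only:)
qed

lemma vertex_star: "star q (cball 0 1) (glued l) (q (pp 0)) (nbhd \<int> (1/2)) (contract \<int> (1/2))"
proof (rule boundary_star)
  show "c + 4 * real l * of_int i \<in> \<int>" if "c \<in> \<int>" for c i
    using that by (intro Ints_add Ints_mult) auto
  show "of_int k \<le> c \<and> c \<le> of_int k + 1" if c: "c \<in> \<int>" and "\<bar>u - c\<bar> < 1/2" "of_int k \<le> u" "u \<le> of_int k + 1" for c u :: real and k
  proof -
    obtain j where j: "c = of_int j" using c by (rule Ints_cases)
    have "of_int k < (of_int j + 1 :: real)" "of_int j < (of_int k + 2 :: real)" using that j by linarith+
    then have "of_int k < (of_int (j + 1) :: real)" "of_int j < (of_int (k + 2) :: real)" by simp_all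
    then have "k < j + 1" "j < k + 2" by (simp_all only: of_int_less_iff)
    then have "k = j \<or> j = k + 1" by linarith
    then show ?thesis using j by auto
  qed
  show "c = c'" if c: "c \<in> \<int>" "c' \<in> \<int>" and cc: "\<bar>c - c'\<bar> < 2 * (1/2)" for c c' :: real
  proof -
    obtain j j' where j: "c = of_int j" "c' = of_int j'" using c by (metis Ints_cases)
    have "\<bar>real_of_int (j - j')\<bar> < 1" using cc j by simp
    then have "\<bar>j - j'\<bar> < 1" by linarith
    then show ?thesis using j by simp
  qed
  show "q (pp c) = q (pp 0)" if "c \<in> \<int>" for c using that vertices by (elim Ints_cases) simp
  show "2 * real m + 3 - c \<in> \<int>" if "c \<in> \<int>" for m c using that by (intro Ints_diff Ints_add Ints_mult) auto
qed auto

text \<open>The lifts of an interior point of an edge have the parameters \<open>m + x\<close> and \<open>m + 3 - x\<close> modulo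
  \<open>4 * l\<close>. Within \<open>min x (1 - x)\<close> of them there is no vertex.\<close>

lemma edge_star:
  assumes m: "is_side l m" and x: "0 < x" "x < 1"
  shows "\<exists>W K. star q (cball 0 1) (glued l) (q (pp (real m + x))) W K"
proof -
  define Y where "Y = {c. \<exists>i::int. c = real m + x + 4 * real l * of_int i \<or> c = real m + 3 - x + 4 * real l * of_int i}"
  define \<epsilon> where "\<epsilon> = min x (1 - x)"
  have \<epsilon>: "0 < \<epsilon>" "\<epsilon> \<le> 1/2" "\<epsilon> \<le> x" "\<epsilon> \<le> 1 - x" using x unfolding \<epsilon>_def by linarith+
  have Y_cases: "(\<exists>i::int. c = of_int (int m + 4 * (int l * i)) + x) \<or> (\<exists>i::int. c = of_int (int m + 2 + 4 * (int l * i)) + (1 - x))"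
    if "c \<in> Y" for c
    using that by (auto simp: Y_def algebra_simps)
  have m': "int m < 4 * int l" "int m mod 4 < 2" using m unfolding is_side_def by presburger+
  have small: "i = 0" if "\<bar>4 * (int l * i)\<bar> < 4 * int l" for i
  proof (rule ccontr)
    assume "i \<noteq> 0"
    then have "int l * 1 \<le> int l * \<bar>i\<bar>" by (intro mult_left_mono) auto
    then show False using that by (simp add: abs_mult)
  qed
  have floor_eq: "k = k'" if "of_int k + f \<le> of_int k' + 1" "of_int k' \<le> of_int k + f" "0 < f" "f < 1" for k k' :: int and f :: real
  proof -
    have "of_int k < (of_int (k' + 1) :: real)" "of_int k' < (of_int (k + 1) :: real)" using that by auto
    then have "k < k' + 1" "k' < k + 1" by (simp_all only: of_int_less_iff)
    then show ?thesis by simp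
  qed
  have "star q (cball 0 1) (glued l) (q (pp (real m + x))) (nbhd Y \<epsilon>) (contract Y \<epsilon>)"
  proof (rule boundary_star[OF \<epsilon>(1,2)])
    show "Y \<noteq> {}" by (auto simp: Y_def)
    show "c + 4 * real l * of_int i \<in> Y" if "c \<in> Y" for c i
    proof -
      obtain j where "c = real m + x + 4 * real l * of_int j \<or> c = real m + 3 - x + 4 * real l * of_int j"
        using \<open>c \<in> Y\<close> by (auto simp: Y_def)
      then show ?thesis unfolding Y_def by (intro CollectI exI[of _ "j + i"]) (auto simp: algebra_simps)
    qed
    show "of_int k \<le> c \<and> c \<le> of_int k + 1" if c: "c \<in> Y" and u: "\<bar>u - c\<bar> < \<epsilon>" "of_int k \<le> u" "u \<le> of_int k + 1" for c k u
    proof -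
      obtain j :: int and f where jf: "c = of_int j + f" "f = x \<or> f = 1 - x" using Y_cases[OF c] by blast
      have f: "\<epsilon> \<le> f" "f \<le> 1 - \<epsilon>" using jf(2) \<epsilon> by auto
      have "k = j" using floor_eq[of j "u - of_int j" k] u jf(1) f by linarith
      then show ?thesis using jf f \<epsilon>(1) by auto
    qed
    show "c = c'" if c: "c \<in> Y" "c' \<in> Y" "\<bar>c - c'\<bar> < 2 * \<epsilon>" for c c'
    proof -
      have same: "of_int j + f = of_int j' + f" if "\<bar>(of_int j + f) - (of_int j' + f)\<bar> < 2 * \<epsilon>" for j j' :: int and f :: real
      proof -
        have "\<bar>real_of_int (j - j')\<bar> < 1" using that \<epsilon>(2) by simp
        then have "\<bar>j - j'\<bar> < 1" by linarith
        then show ?thesis by simp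
      qed
      have diff: False if "\<bar>(of_int (int m + 4 * i) + x) - (of_int (int m + 2 + 4 * i') + (1 - x))\<bar> < 2 * \<epsilon>" for i i' :: int
      proof -
        have "\<bar>real_of_int (4 * (i - i') - 2) + (2 * x - 1)\<bar> < 2 * \<epsilon>" using that by (simp add: algebra_simps)
        moreover have "\<bar>2 * x - 1\<bar> \<le> 1 - 2 * \<epsilon>" using \<epsilon> by linarith
        ultimately have "\<bar>real_of_int (4 * (i - i') - 2)\<bar> < 1" by linarith
        then have "\<bar>4 * (i - i') - 2\<bar> < 1" by linarith
        then show False by presburger
      qed
      from Y_cases[OF c(1)] Y_cases[OF c(2)] show ?thesis
        using same c(3) diff by (metis abs_minus_commute)
    qed
    show "q (pp c) = q (pp (real m + x))" if "c \<in> Y" for c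
      using that q_glued[OF glued_mid[OF m, of x]] x by (auto simp: Y_def pp_shift)
    show "2 * real k + 3 - c \<in> Y"
      if c: "c \<in> Y" and k: "is_side l k" and or: "real k \<le> c \<and> c \<le> real k + 1 \<or> real k + 2 \<le> c \<and> c \<le> real k + 3" for c k
    proof -
      have k': "int k < 4 * int l" "int k mod 4 < 2" using k unfolding is_side_def by presburger+
      from or show ?thesis
      proof
        assume r: "real k \<le> c \<and> c \<le> real k + 1"
        from Y_cases[OF c] show ?thesis
        proof (elim disjE exE)
          fix i assume i: "c = of_int (int m + 4 * (int l * i)) + x"
          have e: "int m + 4 * (int l * i) = int k" by (rule floor_eq[where f = "x"]) (use r x in \<open>simp_all add: i\<close>)
          then have "i = 0" using small[of i] m' k' by linarith
          then show ?thesis using e i by (auto simp: Y_def intro!: exI[of _ 0])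
        next
          fix i assume i: "c = of_int (int m + 2 + 4 * (int l * i)) + (1 - x)"
          have e: "int m + 2 + 4 * (int l * i) = int k" by (rule floor_eq[where f = "1 - x"]) (use r x in \<open>simp_all add: i\<close>)
          then have False using m' k' by presburger
          then show ?thesis ..
        qed
      next
        assume r: "real k + 2 \<le> c \<and> c \<le> real k + 3"
        from Y_cases[OF c] show ?thesis
        proof (elim disjE exE)
          fix i assume i: "c = of_int (int m + 4 * (int l * i)) + x"
          have e: "int m + 4 * (int l * i) = int k + 2" by (rule floor_eq[where f = "x"]) (use r x in \<open>simp_all add: i\<close>)
          then have False using m' k' by presburger
          then show ?thesis ..
        next
          fix i assume i: "c = of_int (int m + 2 + 4 * (int l * i)) + (1 - x)"
          have e: "int m + 2 + 4 * (int l * i) = int k + 2" by (rule floor_eq[where f = "1 - x"]) (use r x in \<open>simp_all add: i\<close>)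
          then have "i = 0" using small[of i] m' k' by linarith
          then show ?thesis using e i by (auto simp: Y_def intro!: exI[of _ 0])
        qed
      qed
    qed
  qed
  then show ?thesis by blast
qed

lemma polygon_star:
  assumes "z \<in> cball 0 1" shows "\<exists>W K. star q (cball 0 1) (glued l) (q z) W K"
proof (cases "norm z < 1")
  case True
  then show ?thesis using interior_star by blast
next
  case False
  then obtain u where u: "0 \<le> u" "u < 4 * real l" "z = pp u" using boundary_point[of z] assms by auto
  define k where "k = nat \<lfloor>u\<rfloor>"
  have k: "real k \<le> u" "u < real k + 1" using u(1) by (auto simp: k_def)
  have kl: "k < 4 * l" using k u(2) by linarith
  show ?thesis
  proof (cases "u = real k")
    case True
    then show ?thesis using vertex_star vertices_nat[OF kl] u(3) by metis
  next
    case False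
    show ?thesis
    proof (cases "k mod 4 < 2")
      case True
      then have "is_side l k" using kl by (simp add: is_side_def)
      from edge_star[OF this, of "u - real k"] show ?thesis using k False u by simp
    next
      case k2: False
      have "2 \<le> k"
      proof (rule ccontr)
        assume "\<not> 2 \<le> k"
        then show False using k2 by (simp add: not_le)
      qed
      then obtain k' where k': "k = k' + 2" by (metis add.commute le_Suc_ex)
      have "k' mod 4 < 2" using k2 unfolding k' by presburger
      then have s: "is_side l (k - 2)" using kl k' by (simp add: is_side_def)
      have e: "real (k - 2) = real k - 2" using k' by simp
      let ?x = "real (k - 2) + 3 - u"
      have x: "0 < ?x" "?x < 1" using k False e by auto
      have "q z = q (pp (real (k - 2) + ?x))" using q_glued[OF glued_mid[OF s, of ?x]] x u(3) by simp
      then show ?thesis using edge_star[OF s x] by simp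
    qed
  qed
qed

end

end

section \<open>The surface group\<close>

text \<open>A solution \<open>A, B\<close> of the surface relation prescribes the jumps across the sides. Going around the
  vertex of the surface, these jumps determine the labels of the corners from that of corner \<open>0\<close>;
  corner \<open>4 * l\<close>, which is corner \<open>0\<close> again, receives the value of the relation. Points on the
  second of two glued sides carry the jump itself, all other points the label one.\<close>

definition vertex_label :: "('g, 'm) monoid_scheme \<Rightarrow> (nat \<Rightarrow> 'g) \<Rightarrow> (nat \<Rightarrow> 'g) \<Rightarrow> nat \<Rightarrow> 'g" where
  "vertex_label \<Gamma> A B k = (let j = k div 4; g = comm_prod \<Gamma> A B j in
     if k mod 4 = 0 then g
     else if k mod 4 = 1 then g \<otimes>\<^bsub>\<Gamma>\<^esub> (A j \<otimes>\<^bsub>\<Gamma>\<^esub> B j \<otimes>\<^bsub>\<Gamma>\<^esub> inv\<^bsub>\<Gamma>\<^esub> (A j))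
     else if k mod 4 = 2 then g \<otimes>\<^bsub>\<Gamma>\<^esub> (A j \<otimes>\<^bsub>\<Gamma>\<^esub> B j)
     else g \<otimes>\<^bsub>\<Gamma>\<^esub> A j)"

definition side_label :: "('g, 'm) monoid_scheme \<Rightarrow> (nat \<Rightarrow> 'g) \<Rightarrow> (nat \<Rightarrow> 'g) \<Rightarrow> nat \<Rightarrow> 'g" where
  "side_label \<Gamma> A B m = (if m mod 4 = 0 then A (m div 4) else inv\<^bsub>\<Gamma>\<^esub> (B (m div 4)))"

definition point_label :: "('g, 'm) monoid_scheme \<Rightarrow> nat \<Rightarrow> (nat \<Rightarrow> 'g) \<Rightarrow> (nat \<Rightarrow> 'g) \<Rightarrow> complex \<Rightarrow> 'g" where
  "point_label \<Gamma> l A B z = (if \<exists>k\<le>4 * l. z = polygon_point l (real k)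
     then vertex_label \<Gamma> A B (SOME k. k \<le> 4 * l \<and> z = polygon_point l (real k))
     else if \<exists>m t. is_side l m \<and> 0 < t \<and> t < 1 \<and> z = polygon_point l (real m + 2 + t)
     then side_label \<Gamma> A B (SOME m. \<exists>t. is_side l m \<and> 0 < t \<and> t < 1 \<and> z = polygon_point l (real m + 2 + t))
     else \<one>\<^bsub>\<Gamma>\<^esub>)"

lemma (in group) point_label:
  assumes l: "l \<ge> 1" and A: "\<And>j. A j \<in> carrier G" and B: "\<And>j. B j \<in> carrier G"
    and rel: "comm_prod G A B l = \<one>"
  shows "point_label G l A B z \<in> carrier G" "side_label G A B m \<in> carrier G"
    "k \<le> 4 * l \<Longrightarrow> point_label G l A B (polygon_point l (real k)) = vertex_label G A B k"
    "glued l m z w \<Longrightarrow> point_label G l A B w = point_label G l A B z \<otimes> side_label G A B m"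
proof -
  have cp: "comm_prod G A B j \<in> carrier G" for j using A B by (intro comm_prod_closed)
  have vl: "vertex_label G A B k \<in> carrier G" for k using A B cp by (simp add: vertex_label_def Let_def)
  have sl: "side_label G A B m \<in> carrier G" for m using A B by (simp add: side_label_def)
  show "side_label G A B m \<in> carrier G" by (rule sl)
  show "point_label G l A B z \<in> carrier G" using vl sl by (simp add: point_label_def)
  have vertex: "point_label G l A B (polygon_point l (real k)) = vertex_label G A B k" if k: "k \<le> 4 * l" for k
  proof -
    let ?P = "\<lambda>k'. k' \<le> 4 * l \<and> polygon_point l (real k) = polygon_point l (real k')"
    have "?P (SOME k'. ?P k')" by (rule someI[where P = ?P and x = k]) (use k in simp)
    then obtain k' where k': "k' = (SOME k'. ?P k')" "k' \<le> 4 * l" "polygon_point l (real k) = polygon_point l (real k')"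
      by blast
    obtain i :: int where "real k = real k' + 4 * real l * of_int i" using k'(3) pp_eq_iff[OF l] by blast
    then have "real_of_int (int k) = real_of_int (int k' + 4 * (int l * i))" by simp
    then have i: "int k = int k' + 4 * (int l * i)" by (simp only: of_int_eq_iff)
    have "i = 0 \<or> i = 1 \<or> i = -1"
    proof (rule ccontr)
      assume "\<not> ?thesis"
      then have "2 \<le> \<bar>i\<bar>" by linarith
      then have "int l * 2 \<le> int l * \<bar>i\<bar>" by (intro mult_left_mono) auto
      then have "2 * int l \<le> \<bar>int l * i\<bar>" by (simp add: abs_mult)
      then show False using i k k'(2) l by linarith
    qed
    then have "k = k' \<or> k = 0 \<and> k' = 4 * l \<or> k = 4 * l \<and> k' = 0" using i k k'(2) by auto
    then have "vertex_label G A B k' = vertex_label G A B k" using rel by (auto simp: vertex_label_def)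
    then show ?thesis using k k'(1) by (auto simp: point_label_def)
  qed
  then show "k \<le> 4 * l \<Longrightarrow> point_label G l A B (polygon_point l (real k)) = vertex_label G A B k" .
  have not_vertex: "polygon_point l (real m + t) \<noteq> polygon_point l (real k)" if "0 < t" "t < 1" for m k t
  proof
    assume "polygon_point l (real m + t) = polygon_point l (real k)"
    then obtain i :: int where "real m + t = real k + 4 * real l * of_int i" using pp_eq_iff[OF l] by blast
    then have "t = real_of_int (int k + 4 * int l * i - int m)" by simp
    then show False using that by (smt (verit) of_int_1_less_iff of_int_less_1_iff of_int_less_iff of_int_0 of_int_1)
  qed
  have same_side: "m + 2 = n \<and> t = t'" if eq: "polygon_point l (real m + 2 + t) = polygon_point l (real n + t')"
    and "0 < t" "t < 1" "0 < t'" "t' < 1" "m + 2 < 4 * l" "n < 4 * l" for m n t t'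
  proof -
    obtain i :: int where i: "real m + 2 + t = real n + t' + 4 * real l * of_int i" using eq unfolding pp_eq_iff[OF l] by blast
    define X where "X = int n + 4 * (int l * i) - int m - 2"
    have "t - t' = real_of_int X" using i by (simp add: X_def)
    moreover have "\<bar>t - t'\<bar> < 1" using that(2-5) by (simp add: abs_less_iff)
    ultimately have "\<bar>real_of_int X\<bar> < 1" by (simp only:)
    then have "X = 0" by linarith
    then have e: "int n + 4 * (int l * i) - int m - 2 = 0" by (simp only: X_def)
    have "i = 0"
    proof (rule ccontr)
      assume "i \<noteq> 0"
      then have "int l * 1 \<le> int l * \<bar>i\<bar>" by (intro mult_left_mono) auto
      then have "int l \<le> \<bar>int l * i\<bar>" by (simp add: abs_mult)
      then show False using e that(6,7) by linarith
    qed
    then show ?thesis using e i by auto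
  qed
  have side2: "m + 2 < 4 * l" if "is_side l m" for m using that unfolding is_side_def by presburger
  have first: "point_label G l A B (polygon_point l (real m + t)) = \<one>" if m: "is_side l m" "0 < t" "t < 1" for m t
  proof -
    have False if x: "is_side l n" "0 < t'" "t' < 1" "polygon_point l (real m + t) = polygon_point l (real n + 2 + t')" for n t'
    proof -
      have "n + 2 = m" using same_side[of n t' m t] x m side2 by (simp add: is_side_def)
      then show False using x(1) m(1) unfolding is_side_def by presburger
    qed
    then show ?thesis using not_vertex[OF m(2,3)] by (auto simp: point_label_def)
  qed
  have second: "point_label G l A B (polygon_point l (real m + 2 + t)) = side_label G A B m" if m: "is_side l m" "0 < t" "t < 1" for m t
  proof -
    have nv: "polygon_point l (real m + 2 + t) \<noteq> polygon_point l (real k)" for k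
      using not_vertex[OF m(2,3), of "m + 2"] by (simp add: add_ac)
    let ?P = "\<lambda>n. \<exists>t'. is_side l n \<and> 0 < t' \<and> t' < 1 \<and> polygon_point l (real m + 2 + t) = polygon_point l (real n + 2 + t')"
    have Pm: "?P m" using m by blast
    have "?P (SOME n. ?P n)" by (rule someI[where P = ?P, OF Pm])
    then obtain n t' where n: "n = (SOME n. ?P n)" and t': "is_side l n" "0 < t'" "t' < 1"
      "polygon_point l (real m + 2 + t) = polygon_point l (real n + 2 + t')" by blast
    have "n = m" using same_side[of m t "n + 2" t'] t' m side2 by (simp add: add_ac)
    then have some: "(SOME n. ?P n) = m" using n by (simp only:)
    have c1: "\<not> (\<exists>k\<le>4 * l. polygon_point l (real m + 2 + t) = polygon_point l (real k))" using nv by simp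
    have c2: "\<exists>n. ?P n" using Pm by (rule exI)
    show ?thesis unfolding point_label_def if_not_P[OF c1] if_P[OF c2] some ..
  qed
  show "point_label G l A B w = point_label G l A B z \<otimes> side_label G A B m" if g: "glued l m z w"
  proof -
    obtain t where t: "is_side l m" "0 \<le> t" "t \<le> 1" "z = polygon_point l (real m + t)" "w = polygon_point l (real m + 3 - t)"
      using g by (auto simp: glued_def)
    have m4: "m + 3 \<le> 4 * l" using side2[OF t(1)] by simp
    have vm: "point_label G l A B (polygon_point l (real m)) = vertex_label G A B m"
      "point_label G l A B (polygon_point l (real (m + 1))) = vertex_label G A B (m + 1)"
      "point_label G l A B (polygon_point l (real (m + 2))) = vertex_label G A B (m + 2)"
      "point_label G l A B (polygon_point l (real (m + 3))) = vertex_label G A B (m + 3)"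
      by (intro vertex; use m4 in simp)+
    consider "t = 0" | "t = 1" | "0 < t" "t < 1" using t by linarith
    then show ?thesis
    proof cases
      case 3
      then have "w = polygon_point l (real m + 2 + (1 - t))" using t by (simp add: algebra_simps)
      then show ?thesis using first[OF t(1) 3] second[OF t(1), of "1 - t"] 3 t(4) sl by simp
    next
      case 1
      then have zw: "z = polygon_point l (real m)" "w = polygon_point l (real (m + 3))" using t by (simp_all add: add_ac)
      have m: "m mod 4 = 0 \<or> m mod 4 = 1" using t(1) unfolding is_side_def by presburger
      then show ?thesis
      proof
        assume m0: "m mod 4 = 0"
        have "(m + 3) div 4 = m div 4" "(m + 3) mod 4 = 3" using m0 by presburger+
        then show ?thesis unfolding zw vm using A B m0 cp[of "m div 4"] by (simp add: vertex_label_def side_label_def Let_def)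
      next
        assume m1: "m mod 4 = 1"
        have "(m + 3) div 4 = Suc (m div 4)" "(m + 3) mod 4 = 0" using m1 by presburger+
        then show ?thesis unfolding zw vm using A B m1 cp[of "m div 4"]
          by (simp add: vertex_label_def side_label_def Let_def comm_def m_assoc)
      qed
    next
      case 2
      then have zw: "z = polygon_point l (real (m + 1))" "w = polygon_point l (real (m + 2))" using t by (simp_all add: add_ac)
      have m: "m mod 4 = 0 \<or> m mod 4 = 1" using t(1) unfolding is_side_def by presburger
      then show ?thesis
      proof
        assume m0: "m mod 4 = 0"
        have "(m + 1) div 4 = m div 4" "(m + 1) mod 4 = 1" "(m + 2) div 4 = m div 4" "(m + 2) mod 4 = 2" using m0 by presburger+
        then show ?thesis unfolding zw vm using A B m0 cp[of "m div 4"]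
          by (simp add: vertex_label_def side_label_def Let_def m_assoc)
      next
        assume m1: "m mod 4 = 1"
        have "(m + 1) div 4 = m div 4" "(m + 1) mod 4 = 2" "(m + 2) div 4 = m div 4" "(m + 2) mod 4 = 3" using m1 by presburger+
        then show ?thesis unfolding zw vm using A B m1 cp[of "m div 4"]
          by (simp add: vertex_label_def side_label_def Let_def m_assoc)
      qed
    qed
  qed
qed

text \<open>The generator \<open>a j\<close> crosses the side \<open>4 * j\<close> and \<open>b j\<close> crosses the side \<open>4 * j + 1\<close> backwards. Each
  crossing can be slid to either end of its side, so that its ends are vertices; the crossings from
  vertex to vertex around the handle \<open>j\<close> multiply to \<open>[a j, b j]\<close>, and those around the whole vertex of
  the surface multiply to one.\<close>

theorem surface_group_presentation:
  fixes S :: "'s::topological_space set"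
  assumes surface: "closed_surface_of_genus l S" and s: "s \<in> S" and l: "l \<ge> 1"
  shows "\<exists>a b. (\<forall>i<l. a i \<in> carrier (fundamental_group S s) \<and> b i \<in> carrier (fundamental_group S s)) \<and>
    comm_prod (fundamental_group S s) a b l = \<one>\<^bsub>fundamental_group S s\<^esub> \<and>
    carrier (fundamental_group S s) = generate (fundamental_group S s) (a ` {..<l} \<union> b ` {..<l}) \<and>
    (\<forall>(\<Gamma> :: 'g monoid) A B. group \<Gamma> \<longrightarrow> (\<forall>j. A j \<in> carrier \<Gamma> \<and> B j \<in> carrier \<Gamma>) \<longrightarrow>
       comm_prod \<Gamma> A B l = \<one>\<^bsub>\<Gamma>\<^esub> \<longrightarrow>
       (\<exists>\<rho>\<in>hom (fundamental_group S s) \<Gamma>. \<forall>i<l. \<rho> (a i) = A i \<and> \<rho> (b i) = B i))"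
proof -
  obtain q where q: "quotient_map (top_of_set (cball (0::complex) 1)) (top_of_set S) q"
    "\<And>z w. z \<in> cball 0 1 \<Longrightarrow> w \<in> cball 0 1 \<Longrightarrow> q z = q w \<longleftrightarrow> equivclp (side_pairing l) z w"
    using surface by (auto simp: closed_surface_of_genus_def)
  have rel: "side_pairing l = (\<lambda>z w. \<exists>m. glued l m z w)" by (auto simp: fun_eq_iff side_pairing_iff)
  have in_D: "z \<in> cball 0 1 \<and> w \<in> cball 0 1" if "glued l m z w" for m z w
    using that by (auto simp: glued_def norm_pp[OF l])
  have qg: "q z = q w" if "glued l m z w" for m z w
    using q(2) in_D[OF that] that unfolding rel by (blast intro: r_into_equivclp)
  have qS: "q ` cball 0 1 = S" using quotient_imp_surjective_map[OF q(1)] by simp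
  have stars: "\<exists>W K. star q (cball 0 1) (glued l) (q z) W K" if "z \<in> cball 0 1" for z
    by (rule polygon_star[where q = q, OF l _ that]) (rule qg)
  have vertex: "q (polygon_point l (of_int k)) = q (polygon_point l 0)" for k
    by (rule vertices[where q = q, OF l]) (rule qg)
  interpret star_quotient q "cball 0 1" S "glued l"
  proof
    show "\<exists>W K. star q (cball 0 1) (glued l) s W K" if "s \<in> S" for s
      using that stars qS by blast
  qed (use q in_D rel in auto)
  obtain z0 where z0: "z0 \<in> cball 0 1" "q z0 = s" using s qS by blast
  let ?G = "fundamental_group S s" and ?v = "\<lambda>k::nat. polygon_point l (real k)"
  interpret G: group ?G using group_fundamental_group[OF s] .
  let ?c = "crossing z0"
  have vD: "?v k \<in> cball 0 1" for k by (simp add: norm_pp[OF l])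
  have vq: "q (?v j) = q (?v k)" for j k using vertex[of "int j"] vertex[of "int k"] by simp
  have mult: "?c x y \<otimes>\<^bsub>?G\<^esub> ?c y z = ?c x z"
    if "x \<in> cball 0 1" "y \<in> cball 0 1" "z \<in> cball 0 1" "q x = q y" "q y = q z" for x y z
    using crossing_mult[OF z0(1) that] z0(2) by simp
  have self: "?c x x = \<one>\<^bsub>?G\<^esub>" if "x \<in> cball 0 1" for x using crossing_self[OF z0(1) that] z0(2) by simp
  have closed: "?c x y \<in> carrier ?G" if "x \<in> cball 0 1" "y \<in> cball 0 1" "q x = q y" for x y
    using crossing_loop(2)[OF z0(1) that] z0(2) by simp
  have inv: "inv\<^bsub>?G\<^esub> (?c x y) = ?c y x" if "x \<in> cball 0 1" "y \<in> cball 0 1" "q x = q y" for x y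
    by (rule G.inv_equality) (use that mult[of y x y] self closed in auto)
  have side: "?c z w = ?c (?v m) (?v (m + 3))" "?c (?v (m + 1)) (?v (m + 2)) = ?c (?v m) (?v (m + 3))"
    if g: "glued l m z w" for m z w
  proof -
    obtain t where t: "is_side l m" "0 \<le> t" "t \<le> 1" "z = polygon_point l (real m + t)" "w = polygon_point l (real m + 3 - t)"
      using g by (auto simp: glued_def)
    have "?c (?v m) (?v (m + 3)) = ?c (polygon_point l (real m + x)) (polygon_point l (real m + 3 - x))"
      if x: "0 \<le> x" "x \<le> 1" for x
    proof -
      have "?c (polygon_point l (real m + 0 * x)) (polygon_point l (real m + 3 + 0 * - x)) =
          ?c (polygon_point l (real m + 1 * x)) (polygon_point l (real m + 3 + 1 * - x))"
      proof (rule crossing_along[OF z0(1)])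
        show "q (polygon_point l (real m + r * x)) = q (polygon_point l (real m + 3 + r * - x))" if r: "r \<in> {0..1}" for r
        proof -
          have "0 \<le> r * x" "r * x \<le> 1" using r x mult_le_one[of r x] by auto
          from qg[OF glued_mid[OF l t(1) this]] show ?thesis by simp
        qed
      qed (use pp_path[OF l, of "real m" x] pp_path[OF l, of "real m + 3" "- x"] in
        \<open>auto simp: path_image_def norm_pp[OF l]\<close>)
      then show ?thesis by (simp add: add_ac)
    qed
    from this[OF t(2,3)] this[of 1] show "?c z w = ?c (?v m) (?v (m + 3))" "?c (?v (m + 1)) (?v (m + 2)) = ?c (?v m) (?v (m + 3))"
      using t(4,5) by (simp_all add: add_ac)
  qed
  define a where "a j = ?c (?v (4 * j)) (?v (4 * j + 3))" for j
  define b where "b j = ?c (?v (4 * j + 4)) (?v (4 * j + 1))" for j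
  have ab: "a i \<in> carrier ?G" "b i \<in> carrier ?G" for i
    unfolding a_def b_def by (intro closed vD vq)+
  have a_side: "?c z w = a j" "?c (?v (4 * j + 1)) (?v (4 * j + 2)) = a j" if "glued l (4 * j) z w" for j z w
    using side[OF that] by (simp_all add: a_def)
  have b_inv: "inv\<^bsub>?G\<^esub> (b j) = ?c (?v (4 * j + 1)) (?v (4 * j + 4))" for j
    unfolding b_def by (intro inv vD vq)
  have b_side: "?c z w = inv\<^bsub>?G\<^esub> (b j)" "?c (?v (4 * j + 2)) (?v (4 * j + 3)) = inv\<^bsub>?G\<^esub> (b j)" if "glued l (4 * j + 1) z w" for j z w
    using side[OF that] by (simp_all add: b_inv add_ac numeral_eq_Suc)
  have block: "?c (?v (4 * j)) (?v (4 * j + 4)) = comm ?G (a j) (b j)" if j: "j < l" for j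
  proof -
    note g = glued_mid[OF l is_side_index(1)[OF l j], of 0] glued_mid[OF l is_side_index(2)[OF l j], of 0]
    have "?c (?v (4 * j + 3)) (?v (4 * j + 2)) = inv\<^bsub>?G\<^esub> (inv\<^bsub>?G\<^esub> (b j))"
      using b_side(2)[of j] g(2) inv[OF vD vD vq, of "4 * j + 2" "4 * j + 3"] by simp
    then have 1: "?c (?v (4 * j + 3)) (?v (4 * j + 2)) = b j" using ab by simp
    have 2: "?c (?v (4 * j + 2)) (?v (4 * j + 1)) = inv\<^bsub>?G\<^esub> (a j)"
      using a_side(2)[of j] g(1) inv[OF vD vD vq, of "4 * j + 1" "4 * j + 2"] by simp
    have "?c (?v (4 * j)) (?v (4 * j + 4)) = ?c (?v (4 * j)) (?v (4 * j + 3)) \<otimes>\<^bsub>?G\<^esub> ?c (?v (4 * j + 3)) (?v (4 * j + 2))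
        \<otimes>\<^bsub>?G\<^esub> ?c (?v (4 * j + 2)) (?v (4 * j + 1)) \<otimes>\<^bsub>?G\<^esub> ?c (?v (4 * j + 1)) (?v (4 * j + 4))"
      by (simp only: mult[OF vD vD vD vq vq])
    then show ?thesis unfolding 1 2 b_inv[symmetric] a_def[symmetric] by (simp add: comm_def)
  qed
  have prods: "comm_prod ?G a b j = ?c (?v 0) (?v (4 * j))" if "j \<le> l" for j
    using that
  proof (induction j)
    case 0
    then show ?case using self vD[of 0] by simp
  next
    case (Suc j)
    have "comm_prod ?G a b (Suc j) = ?c (?v 0) (?v (4 * j)) \<otimes>\<^bsub>?G\<^esub> ?c (?v (4 * j)) (?v (4 * j + 4))"
      using Suc block by simp
    also have "\<dots> = ?c (?v 0) (?v (4 * j + 4))" by (rule mult[OF vD vD vD vq vq])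
    also have "4 * j + 4 = 4 * Suc j" by simp
    finally show ?case .
  qed
  have relation: "comm_prod ?G a b l = \<one>\<^bsub>?G\<^esub>"
  proof -
    have "?v (4 * l) = ?v 0" using pp_shift[OF l, of 0 1] by simp
    then show ?thesis using prods[of l] self[OF vD[of 0]] by simp
  qed
  have gens: "carrier ?G = generate ?G (a ` {..<l} \<union> b ` {..<l})" (is "_ = ?H")
  proof
    have "a ` {..<l} \<union> b ` {..<l} \<subseteq> carrier ?G" using ab by auto
    then show "?H \<subseteq> carrier ?G" by (rule G.generate_incl)
    interpret H: subgroup ?H ?G using \<open>a ` {..<l} \<union> b ` {..<l} \<subseteq> carrier ?G\<close> by (rule G.generate_is_subgroup)
    have glued_H: "?c u v \<in> ?H" if g: "glued l m u v" for m u v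
    proof -
      define j where "j = m div 4"
      have "is_side l m" using g by (simp add: glued_def)
      then have j: "j < l" and "m = 4 * j \<or> m = 4 * j + 1" by (auto simp: is_side_def j_def) presburger
      then show ?thesis
      proof (elim disjE)
        assume "m = 4 * j"
        then have "?c u v = a j" using a_side(1) g by simp
        then show ?thesis using j by (auto intro: generate.incl)
      next
        assume "m = 4 * j + 1"
        then have "?c u v = inv\<^bsub>?G\<^esub> (b j)" using b_side(1) g by simp
        then show ?thesis using j by (auto intro: generate.inv)
      qed
    qed
    have "?c z w \<in> ?H" if zw: "z \<in> cball 0 1" "w \<in> cball 0 1" "q z = q w" for z w
    proof -
      have "w \<in> cball 0 1 \<and> q z = q w \<and> ?c z w \<in> ?H"
      proof (rule fibre_induct[OF zw, of "\<lambda>w. w \<in> cball 0 1 \<and> q z = q w \<and> ?c z w \<in> ?H"])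
        show "z \<in> cball 0 1 \<and> q z = q z \<and> ?c z z \<in> ?H" using zw self by simp
        fix m u v assume g: "glued l m u v"
        have uv: "u \<in> cball 0 1" "v \<in> cball 0 1" "q u = q v" using in_D[OF g] qg[OF g] by auto
        have H1: "?c u v \<in> ?H" by (rule glued_H[OF g])
        have H2: "?c v u \<in> ?H" using H.m_inv_closed[OF H1] unfolding inv[OF uv] .
        have e1: "?c z u \<otimes>\<^bsub>?G\<^esub> ?c u v = ?c z v" if "q z = q u"
          by (rule mult) (use zw uv that in simp_all)
        have e2: "?c z v \<otimes>\<^bsub>?G\<^esub> ?c v u = ?c z u" if "q z = q v"
          by (rule mult) (use zw uv that in simp_all)
        show "(u \<in> cball 0 1 \<and> q z = q u \<and> ?c z u \<in> ?H) \<longleftrightarrow> (v \<in> cball 0 1 \<and> q z = q v \<and> ?c z v \<in> ?H)"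
        proof
          assume as: "u \<in> cball 0 1 \<and> q z = q u \<and> ?c z u \<in> ?H"
          then have "?c z u \<otimes>\<^bsub>?G\<^esub> ?c u v \<in> ?H" using H1 by (intro H.m_closed) simp_all
          then have "?c z v \<in> ?H" using e1 as by (simp only:)
          then show "v \<in> cball 0 1 \<and> q z = q v \<and> ?c z v \<in> ?H" using uv as by (simp only:)
        next
          assume as: "v \<in> cball 0 1 \<and> q z = q v \<and> ?c z v \<in> ?H"
          then have "?c z v \<otimes>\<^bsub>?G\<^esub> ?c v u \<in> ?H" using H2 by (intro H.m_closed) simp_all
          then have "?c z u \<in> ?H" using e2 as by (simp only:)
          then show "u \<in> cball 0 1 \<and> q z = q u \<and> ?c z u \<in> ?H" using uv as by (simp only:)
        qed
      qed
      then show ?thesis by simp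
    qed
    then have "{?c z w | z w. z \<in> cball 0 1 \<and> w \<in> cball 0 1 \<and> q z = q w} \<subseteq> ?H" by auto
    then have "generate ?G {?c z w | z w. z \<in> cball 0 1 \<and> w \<in> cball 0 1 \<and> q z = q w} \<subseteq> ?H"
      by (rule G.generate_subgroup_incl) (rule H.subgroup_axioms)
    then show "carrier ?G \<subseteq> ?H" using crossings_generate[OF z0(1)] z0(2) by simp
  qed
  have homs: "\<exists>\<rho>\<in>hom ?G \<Gamma>. \<forall>i<l. \<rho> (a i) = A i \<and> \<rho> (b i) = B i"
    if \<Gamma>: "group \<Gamma>" and AB: "\<And>j. A j \<in> carrier \<Gamma>" "\<And>j. B j \<in> carrier \<Gamma>" and rel: "comm_prod \<Gamma> A B l = \<one>\<^bsub>\<Gamma>\<^esub>"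
    for \<Gamma> :: "'g monoid" and A B
  proof -
    interpret \<Gamma>: group \<Gamma> by fact
    note labels = \<Gamma>.point_label[OF l AB rel]
    obtain \<rho> where \<rho>: "\<rho> \<in> hom ?G \<Gamma>" and val: "\<And>z w. z \<in> cball 0 1 \<Longrightarrow> w \<in> cball 0 1 \<Longrightarrow> q z = q w \<Longrightarrow>
       \<rho> (?c z w) = inv\<^bsub>\<Gamma>\<^esub> point_label \<Gamma> l A B z \<otimes>\<^bsub>\<Gamma>\<^esub> point_label \<Gamma> l A B w"
      using hom_of_labels[where \<pi> = "point_label \<Gamma> l A B" and h = "side_label \<Gamma> A B",
          OF z0(1) \<Gamma> labels(1) labels(2) labels(4)] z0(2) by blast
    have cp: "comm_prod \<Gamma> A B j \<in> carrier \<Gamma>" for j using AB by (intro \<Gamma>.comm_prod_closed)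
    have "\<rho> (a i) = A i \<and> \<rho> (b i) = B i" if i: "i < l" for i
    proof
      have d: "(4 * i + 3) div 4 = i" "(4 * i + 3) mod 4 = 3" "(4 * i + 1) div 4 = i" "(4 * i + 1) mod 4 = 1" 
        "(4 * i + 4) div 4 = Suc i" "(4 * i + 4) mod 4 = 0" by presburger+
      show "\<rho> (a i) = A i"
        unfolding a_def val[OF vD vD vq] using labels(3)[of "4 * i"] labels(3)[of "4 * i + 3"] i d AB cp
        by (simp add: vertex_label_def Let_def del: of_nat_add of_nat_mult)
      have "\<rho> (b i) = inv\<^bsub>\<Gamma>\<^esub> vertex_label \<Gamma> A B (4 * i + 4) \<otimes>\<^bsub>\<Gamma>\<^esub> vertex_label \<Gamma> A B (4 * i + 1)"
        unfolding b_def val[OF vD vD vq] using labels(3)[of "4 * i + 4"] labels(3)[of "4 * i + 1"] i by simp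
      also have "\<dots> = B i"
        using d AB cp[of i] by (simp add: vertex_label_def Let_def comm_def \<Gamma>.inv_mult_group \<Gamma>.m_assoc)
      finally show "\<rho> (b i) = B i" .
    qed
    then show ?thesis using \<rho> by blast
  qed
  show ?thesis
  proof (rule exI[of _ a], rule exI[of _ b], intro conjI allI impI)
    show "\<exists>\<rho>\<in>hom ?G \<Gamma>. \<forall>i<l. \<rho> (a i) = A i \<and> \<rho> (b i) = B i"
      if "group \<Gamma>" "\<forall>j. A j \<in> carrier \<Gamma> \<and> B j \<in> carrier \<Gamma>" "comm_prod \<Gamma> A B l = \<one>\<^bsub>\<Gamma>\<^esub>"
      for \<Gamma> :: "'g monoid" and A B
      by (rule homs) (use that in simp_all)
  qed (rule ab relation gens)+
qed

section \<open>Lifts of projective transformations\<close>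

text \<open>The universal cover of the real projective line, as an ordered set: \<open>(n, Some x)\<close> is the point \<open>x\<close> of
  the \<open>n\<close>-th copy of the reals, and \<open>(n, None)\<close> is the lift of \<open>\<infinity>\<close> that precedes this copy.\<close>

type_synonym line = "int \<times> real option"

fun line_le :: "line \<Rightarrow> line \<Rightarrow> bool" where
  "line_le (m, x) (n, y) \<longleftrightarrow> m < n \<or> m = n \<and>
     (case x of None \<Rightarrow> True | Some a \<Rightarrow> (case y of None \<Rightarrow> False | Some b \<Rightarrow> a \<le> b))"

definition shift :: "int \<Rightarrow> line \<Rightarrow> line" where
  "shift k p = (fst p + k, snd p)"

definition lifts :: "(line \<Rightarrow> line) set" where
  "lifts = {f. bij f \<and> (\<forall>p q. line_le (f p) (f q) \<longleftrightarrow> line_le p q) \<and> (\<forall>k p. f (shift k p) = shift k (f p))}"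

lemma liftsI:
  "bij f \<Longrightarrow> (\<And>p q. line_le (f p) (f q) \<longleftrightarrow> line_le p q) \<Longrightarrow> (\<And>k p. f (shift k p) = shift k (f p)) \<Longrightarrow> f \<in> lifts"
  by (simp add: lifts_def del: split_paired_All)

lemma lifts_id: "id \<in> lifts"
  by (simp add: lifts_def)

lemma lifts_compose: "f \<in> lifts \<Longrightarrow> g \<in> lifts \<Longrightarrow> f \<circ> g \<in> lifts"
  by (simp add: lifts_def bij_comp del: split_paired_All)

lemma lifts_inverse:
  assumes "f \<in> lifts" shows "inv_into UNIV f \<in> lifts"
proof -
  have f: "bij f" "\<And>p q. line_le (f p) (f q) \<longleftrightarrow> line_le p q" "\<And>k p. f (shift k p) = shift k (f p)"
    using assms by (simp_all add: lifts_def del: split_paired_All)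
  have ff: "f (inv_into UNIV f p) = p" "inv_into UNIV f (f p) = p" for p
    using f(1) by (auto simp: bij_is_surj surj_f_inv_f bij_is_inj inv_f_f)
  have "line_le (inv_into UNIV f p) (inv_into UNIV f q) \<longleftrightarrow> line_le p q" for p q
    using f(2)[of "inv_into UNIV f p" "inv_into UNIV f q"] by (simp add: ff)
  moreover have "inv_into UNIV f (shift k p) = shift k (inv_into UNIV f p)" for k p
    using ff(2)[of "shift k (inv_into UNIV f p)"] by (simp add: f(3) ff(1))
  ultimately show ?thesis using f(1) by (intro liftsI) (simp_all add: bij_imp_bij_inv)
qed

lemma shift_shift: "shift j (shift k p) = shift (j + k) p"
  by (simp add: shift_def)

lemma lifts_shift: "shift k \<in> lifts"
proof -
  have "bij (shift k)" by (rule o_bij[of "shift (- k)"]) (auto simp: fun_eq_iff shift_def)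
  moreover have "line_le (shift k p) (shift k q) \<longleftrightarrow> line_le p q" for p q
    by (cases p; cases q) (simp add: shift_def)
  ultimately show ?thesis by (intro liftsI) (simp_all add: shift_shift add.commute)
qed

text \<open>The point \<open>(n, x)\<close> lies between \<open>(n, None)\<close> and \<open>(n + 1, None)\<close>, and a lift is monotone and commutes with
  translations.\<close>

lemma lift_block:
  assumes "f \<in> lifts"
  shows "fst (f (0, None)) + n \<le> fst (f (n, x))" "fst (f (n, x)) \<le> fst (f (0, None)) + n + 1"
proof -
  have le: "fst p \<le> fst q" if "line_le p q" for p q using that by (cases p; cases q) auto
  have f: "line_le (f p) (f q) \<longleftrightarrow> line_le p q" "f (shift k p) = shift k (f p)" for p q k
    using assms by (simp_all add: lifts_def del: split_paired_All)
  have block: "f (k, None) = shift k (f (0, None))" for k using f(2)[of k "(0, None)"] by (simp add: shift_def)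
  have "fst (f (n, None)) \<le> fst (f (n, x))" by (rule le) (simp add: f(1))
  then show "fst (f (0, None)) + n \<le> fst (f (n, x))" using block[of n] by (simp add: shift_def)
  have "fst (f (n, x)) \<le> fst (f (n + 1, None))" by (rule le) (simp add: f(1))
  then show "fst (f (n, x)) \<le> fst (f (0, None)) + n + 1" using block[of "n + 1"] by (simp add: shift_def)
qed

definition scale :: "real \<Rightarrow> line \<Rightarrow> line" where
  "scale \<mu> p = (fst p, map_option (\<lambda>x. \<mu> * x) (snd p))"

definition translate :: "real \<Rightarrow> line \<Rightarrow> line" where
  "translate c p = (fst p, map_option (\<lambda>x. x + c) (snd p))"

text \<open>A lift of \<open>x \<mapsto> - 1 / x\<close>, normalized to send \<open>(n, None)\<close> to \<open>(n, Some 0)\<close>.\<close>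

definition turn :: "line \<Rightarrow> line" where
  "turn p = (case snd p of None \<Rightarrow> (fst p, Some 0)
     | Some x \<Rightarrow> if x < 0 then (fst p, Some (- 1 / x)) else if x = 0 then (fst p + 1, None) else (fst p + 1, Some (- 1 / x)))"

definition unturn :: "line \<Rightarrow> line" where
  "unturn p = (case snd p of None \<Rightarrow> (fst p - 1, Some 0)
     | Some x \<Rightarrow> if 0 < x then (fst p, Some (- 1 / x)) else if x = 0 then (fst p, None) else (fst p - 1, Some (- 1 / x)))"

lemma scale_lift: assumes "\<mu> > 0" shows "scale \<mu> \<in> lifts"
proof -
  have "bij (scale \<mu>)" by (rule o_bij[of "scale (1 / \<mu>)"])
    (use assms in \<open>auto simp: fun_eq_iff scale_def option.map_comp o_def option.map_ident\<close>)
  moreover have "line_le (scale \<mu> p) (scale \<mu> q) \<longleftrightarrow> line_le p q" for p q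
    using assms by (cases p; cases q) (auto simp: scale_def split: option.splits)
  ultimately show ?thesis by (intro liftsI) (simp_all add: shift_def scale_def)
qed

lemma translate_lift: "translate c \<in> lifts"
proof -
  have "bij (translate c)" by (rule o_bij[of "translate (- c)"])
    (auto simp: fun_eq_iff translate_def option.map_comp o_def option.map_ident)
  moreover have "line_le (translate c p) (translate c q) \<longleftrightarrow> line_le p q" for p q
    by (cases p; cases q) (auto simp: translate_def split: option.splits)
  ultimately show ?thesis by (intro liftsI) (simp_all add: shift_def translate_def)
qed

lemma unturn_turn: "unturn (turn p) = p" "turn (unturn p) = p"
  by (cases p; cases "snd p"; auto simp: turn_def unturn_def field_simps)+

lemma turn_lift: "turn \<in> lifts"
proof -
  have "bij turn" by (rule o_bij[of unturn]) (auto simp: fun_eq_iff unturn_turn)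
  moreover have "line_le (turn p) (turn q) \<longleftrightarrow> line_le p q" for p q
  proof -
    have *: "- 1 / x \<le> - 1 / y \<longleftrightarrow> x \<le> y" if "x * y > 0" for x y :: real
      using that by (cases "x > 0"; cases "y > 0") (auto simp: divide_simps zero_less_mult_iff)
    obtain m x n y where pq: "p = (m, x)" "q = (n, y)" by (cases p; cases q) auto
    show ?thesis
      unfolding pq by (cases x; cases y) (auto simp: turn_def * zero_less_mult_iff mult_pos_pos mult_neg_neg not_less
          divide_simps split: if_splits)
  qed
  ultimately show ?thesis by (intro liftsI) (auto simp: shift_def turn_def split: option.splits)
qed

definition torus_a :: "line \<Rightarrow> line" where "torus_a = scale 2"
definition torus_b :: "line \<Rightarrow> line" where "torus_b = translate 1 \<circ> turn \<circ> translate 5"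
definition half_turn :: "line \<Rightarrow> line" where
  "half_turn p = (case snd p of None \<Rightarrow> (fst p, Some (6 / 5))
     | Some x \<Rightarrow> if x < 6 / 5 then (fst p, Some ((6 * x - 8) / (5 * x - 6)))
        else if x = 6 / 5 then (fst p + 1, None) else (fst p + 1, Some ((6 * x - 8) / (5 * x - 6))))"

lemma torus_lifts: "torus_a \<in> lifts" "torus_b \<in> lifts"
  unfolding torus_a_def torus_b_def
  by (intro scale_lift lifts_compose translate_lift turn_lift; simp)+

text \<open>The commutator of \<open>x \<mapsto> 2 x\<close> and \<open>x \<mapsto> (x + 4) / (x + 5)\<close> is the involution
  \<open>x \<mapsto> (6 x - 8) / (5 x - 6)\<close> of the projective line.\<close>

lemma torus_commutator: "torus_a \<circ> torus_b = half_turn \<circ> (torus_b \<circ> torus_a)"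
proof
  fix p :: line
  obtain n x where p: "p = (n, x)" by (cases p)
  show "(torus_a \<circ> torus_b) p = (half_turn \<circ> (torus_b \<circ> torus_a)) p"
  proof (cases x)
    case None
    then show ?thesis by (simp add: p torus_a_def torus_b_def half_turn_def scale_def translate_def turn_def)
  next
    case (Some r)
    consider "r + 5 < 0" | "r + 5 = 0" | "- 5 < r" "2 * r + 5 < 0" | "2 * r + 5 = 0" | "2 * r + 5 > 0" by linarith
    then show ?thesis
      unfolding p Some torus_a_def torus_b_def half_turn_def scale_def translate_def turn_def
      by cases (auto simp: divide_simps; algebra?)+
  qed
qed

text \<open>The involution exchanges \<open>\<infinity>\<close> and \<open>6 / 5\<close>, and its lift sends the copy of \<open>\<infinity>\<close> in a block to \<open>6 / 5\<close> in the
  same block and this to \<open>\<infinity>\<close> in the next one. So its square is a translation and not the identity. Two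
  handles that are both sent to \<open>torus_a\<close> and \<open>torus_b\<close> therefore have Euler number one.\<close>

lemma half_turn_square: "half_turn \<circ> half_turn = shift 1"
proof
  fix p :: line
  obtain n x where p: "p = (n, x)" by (cases p)
  show "(half_turn \<circ> half_turn) p = shift 1 p"
  proof (cases x)
    case None
    then show ?thesis by (simp add: p half_turn_def shift_def)
  next
    case (Some r)
    consider "5 * r - 6 < 0" | "r = 6 / 5" | "5 * r - 6 > 0" by linarith
    then show ?thesis
      unfolding p Some half_turn_def shift_def
      by cases (auto simp: divide_simps)
  qed
qed

section \<open>A bounded representative of the intersection form\<close>

type_synonym extension = "(line \<Rightarrow> line) \<times> (nat \<Rightarrow> int) \<times> (nat \<Rightarrow> int) \<times> int"

text \<open>The product of the lifts with the Heisenberg group of rank \<open>l\<close>.\<close>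

definition extension_group :: "nat \<Rightarrow> extension monoid" where
  "extension_group l = \<lparr>carrier = {(f, u, v, s). f \<in> lifts},
     mult = (\<lambda>(f, u, v, s) (f', u', v', s'). (f \<circ> f', \<lambda>i. u i + u' i, \<lambda>i. v i + v' i, s + s' + (\<Sum>i<l. u i * v' i))),
     one = (id, \<lambda>_. 0, \<lambda>_. 0, 0)\<rparr>"

definition diagonal :: "nat \<Rightarrow> extension set" where
  "diagonal l = range (\<lambda>k. (shift k, \<lambda>_. 0, \<lambda>_. 0, int l * k))"

lemma extension_simps:
  "carrier (extension_group l) = {(f, u, v, s). f \<in> lifts}"
  "(f, u, v, s) \<otimes>\<^bsub>extension_group l\<^esub> (f', u', v', s') =
     (f \<circ> f', \<lambda>i. u i + u' i, \<lambda>i. v i + v' i, s + s' + (\<Sum>i<l. u i * v' i))"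
  "\<one>\<^bsub>extension_group l\<^esub> = (id, \<lambda>_. 0, \<lambda>_. 0, 0)"
  by (simp_all add: extension_group_def)

lemma group_extension_group: "group (extension_group l)"
proof (rule groupI)
  fix p q r assume "p \<in> carrier (extension_group l)" "q \<in> carrier (extension_group l)" "r \<in> carrier (extension_group l)"
  then show "p \<otimes>\<^bsub>extension_group l\<^esub> q \<otimes>\<^bsub>extension_group l\<^esub> r = p \<otimes>\<^bsub>extension_group l\<^esub> (q \<otimes>\<^bsub>extension_group l\<^esub> r)"
    by (cases p; cases q; cases r) (auto simp: extension_simps o_assoc algebra_simps sum.distrib)
next
  fix p assume "p \<in> carrier (extension_group l)"
  then obtain f u v s where p: "p = (f, u, v, s)" "f \<in> lifts" by (auto simp: extension_simps)
  have "inv_into UNIV f \<circ> f = id" using p(2) by (auto simp: lifts_def bij_is_inj)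
  then show "\<exists>q\<in>carrier (extension_group l). q \<otimes>\<^bsub>extension_group l\<^esub> p = \<one>\<^bsub>extension_group l\<^esub>"
    using p lifts_inverse[OF p(2)]
    by (intro bexI[of _ "(inv_into UNIV f, \<lambda>i. - u i, \<lambda>i. - v i, - s + (\<Sum>i<l. u i * v i))"])
      (auto simp: extension_simps sum_negf)
qed (auto simp: extension_simps lifts_compose lifts_id)

lemma diagonal_central:
  assumes "k \<in> diagonal l" "p \<in> carrier (extension_group l)"
  shows "k \<in> carrier (extension_group l)" "k \<otimes>\<^bsub>extension_group l\<^esub> p = p \<otimes>\<^bsub>extension_group l\<^esub> k"
proof -
  obtain f u v s where p: "p = (f, u, v, s)" "f \<in> lifts" using assms(2) by (auto simp: extension_simps)
  obtain n where k: "k = (shift n, \<lambda>_. 0, \<lambda>_. 0, int l * n)" using assms(1) by (auto simp: diagonal_def)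
  show "k \<in> carrier (extension_group l)" by (simp add: k extension_simps lifts_shift)
  have "f (shift n x) = shift n (f x)" for x using p(2) by (simp add: lifts_def del: split_paired_All)
  then have "shift n \<circ> f = f \<circ> shift n" by (auto simp: fun_eq_iff simp del: split_paired_All)
  then show "k \<otimes>\<^bsub>extension_group l\<^esub> p = p \<otimes>\<^bsub>extension_group l\<^esub> k" by (simp add: k p extension_simps)
qed

lemma diagonal_normal: "diagonal l \<lhd> extension_group l"
proof -
  interpret group "extension_group l" by (rule group_extension_group)
  have mult: "(shift j, \<lambda>_. 0, \<lambda>_. 0, int l * j) \<otimes>\<^bsub>extension_group l\<^esub> (shift k, \<lambda>_. 0, \<lambda>_. 0, int l * k) =
      (shift (j + k), \<lambda>_. 0, \<lambda>_. 0, int l * (j + k))" for j k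
    by (simp add: extension_simps fun_eq_iff shift_shift algebra_simps del: split_paired_All)
  have one: "(shift 0, \<lambda>_. 0, \<lambda>_. 0, int l * 0) = \<one>\<^bsub>extension_group l\<^esub>"
    by (simp add: extension_simps fun_eq_iff shift_def)
  have car: "(shift k, \<lambda>_. 0, \<lambda>_. 0, int l * k) \<in> carrier (extension_group l)" for k
    by (simp add: extension_simps lifts_shift)
  have "subgroup (diagonal l) (extension_group l)"
  proof (rule subgroupI)
    show "diagonal l \<subseteq> carrier (extension_group l)" using car by (auto simp: diagonal_def)
    show "diagonal l \<noteq> {}" by (auto simp: diagonal_def)
    show "inv\<^bsub>extension_group l\<^esub> x \<in> diagonal l" if x: "x \<in> diagonal l" for x
    proof -
      obtain k where k: "x = (shift k, \<lambda>_. 0, \<lambda>_. 0, int l * k)" using x by (auto simp: diagonal_def)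
      have "inv\<^bsub>extension_group l\<^esub> x = (shift (- k), \<lambda>_. 0, \<lambda>_. 0, int l * (- k))"
        unfolding k using mult[of "- k" k] one car[of k] car[of "- k"] by (intro inv_equality) simp_all
      then show ?thesis unfolding diagonal_def by (rule range_eqI)
    qed
    show "x \<otimes>\<^bsub>extension_group l\<^esub> y \<in> diagonal l" if xy: "x \<in> diagonal l" "y \<in> diagonal l" for x y
    proof -
      obtain j k where jk: "x = (shift j, \<lambda>_. 0, \<lambda>_. 0, int l * j)" "y = (shift k, \<lambda>_. 0, \<lambda>_. 0, int l * k)"
        using xy by (auto simp: diagonal_def)
      have "x \<otimes>\<^bsub>extension_group l\<^esub> y = (shift (j + k), \<lambda>_. 0, \<lambda>_. 0, int l * (j + k))" unfolding jk by (rule mult)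
      then show ?thesis unfolding diagonal_def by (rule range_eqI)
    qed
  qed
  moreover have "p \<otimes>\<^bsub>extension_group l\<^esub> k \<otimes>\<^bsub>extension_group l\<^esub> inv\<^bsub>extension_group l\<^esub> p \<in> diagonal l"
    if "p \<in> carrier (extension_group l)" "k \<in> diagonal l" for p k
    using diagonal_central[OF that(2,1)] that by (metis m_assoc inv_closed r_inv r_one)
  ultimately show ?thesis by (intro normal_invI)
qed

lemma hom_comm_prod:
  assumes "group G" "group H" "h \<in> hom G H" and ab: "\<And>i. i < n \<Longrightarrow> a i \<in> carrier G" "\<And>i. i < n \<Longrightarrow> b i \<in> carrier G"
  shows "h (comm_prod G a b n) = comm_prod H (\<lambda>i. h (a i)) (\<lambda>i. h (b i)) n"
proof -
  interpret group_hom G H h using assms(1-3) by (simp add: group_hom_def group_hom_axioms_def)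
  show ?thesis using ab
  proof (induction n)
    case (Suc n)
    have "comm_prod G a b n \<in> carrier G" using Suc.prems by (intro G.comm_prod_closed) auto
    then show ?case using Suc by (simp add: comm_def)
  qed simp
qed

text \<open>Two of the handles carry the whole Euler number; the Heisenberg coordinates see all \<open>l\<close> handles. So
  the surface relation takes the value \<open>(shift 1, 0, 0, l)\<close>, the generator of \<open>diagonal l\<close>
  (\<open>ext_comm_prod\<close>), and is satisfied in the quotient.\<close>

definition ext_a :: "nat \<Rightarrow> extension" where
  "ext_a i = (if i < 2 then torus_a else id, \<lambda>j. if j = i then 1 else 0, \<lambda>_. 0, 0)"

definition ext_b :: "nat \<Rightarrow> extension" where
  "ext_b i = (if i < 2 then torus_b else id, \<lambda>_. 0, \<lambda>j. if j = i then 1 else 0, 0)"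

lemma ext_carrier: "ext_a i \<in> carrier (extension_group l)" "ext_b i \<in> carrier (extension_group l)"
  by (simp_all add: ext_a_def ext_b_def extension_simps torus_lifts lifts_id)

lemma half_turn_lift: "half_turn \<in> lifts"
proof -
  have "half_turn = torus_a \<circ> torus_b \<circ> (inv_into UNIV torus_a \<circ> inv_into UNIV torus_b)"
  proof
    fix p
    have a: "torus_a (inv_into UNIV torus_a p) = p" "torus_b (inv_into UNIV torus_b p) = p" for p
      using torus_lifts by (auto simp: lifts_def bij_is_surj surj_f_inv_f)
    have "(torus_a \<circ> torus_b) q = half_turn (torus_b (torus_a q))" for q
      using torus_commutator by (simp add: fun_eq_iff del: split_paired_All)
    then show "half_turn p = (torus_a \<circ> torus_b \<circ> (inv_into UNIV torus_a \<circ> inv_into UNIV torus_b)) p"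
      using a by (simp del: split_paired_All)
  qed
  then show ?thesis using lifts_compose lifts_inverse torus_lifts by metis
qed

lemma ext_comm:
  assumes "i < l" shows "comm (extension_group l) (ext_a i) (ext_b i) = (if i < 2 then half_turn else id, \<lambda>_. 0, \<lambda>_. 0, 1)"
proof -
  interpret group "extension_group l" by (rule group_extension_group)
  let ?c = "(if i < 2 then half_turn else id, \<lambda>_. 0, \<lambda>_. 0, 1) :: extension"
  have c: "?c \<in> carrier (extension_group l)" by (simp add: extension_simps half_turn_lift lifts_id)
  have "(\<Sum>j<l. (if j = i then 1 else 0) * (if j = i then 1 else 0)) = (1::int)"
    using assms by (simp add: if_distrib[of "\<lambda>x. x * _"] cong: if_cong)
  then have "?c \<otimes>\<^bsub>extension_group l\<^esub> (ext_b i \<otimes>\<^bsub>extension_group l\<^esub> ext_a i) = ext_a i \<otimes>\<^bsub>extension_group l\<^esub> ext_b i"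
    using torus_commutator by (simp add: ext_a_def ext_b_def extension_simps)
  also have "\<dots> = comm (extension_group l) (ext_a i) (ext_b i) \<otimes>\<^bsub>extension_group l\<^esub> (ext_b i \<otimes>\<^bsub>extension_group l\<^esub> ext_a i)"
    using comm_mult ext_carrier by simp
  finally show ?thesis using c ext_carrier by simp
qed

lemma ext_comm_prod:
  "n \<le> l \<Longrightarrow> comm_prod (extension_group l) ext_a ext_b n =
     (if n = 0 then id else if n = 1 then half_turn else shift 1, \<lambda>_. 0, \<lambda>_. 0, int n)"
proof (induction n)
  case 0
  then show ?case by (simp add: extension_simps fun_eq_iff)
next
  case (Suc n)
  then show ?case by (auto simp: ext_comm extension_simps half_turn_square)
qed

text \<open>The coefficients are chosen so that \<open>height\<close> is constant on the cosets of \<open>diagonal l\<close>.\<close>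

definition height :: "nat \<Rightarrow> extension \<Rightarrow> int" where
  "height l = (\<lambda>(f, u, v, s). int l * fst (f (0, None)) - s)"

lemma height_quasi:
  assumes "f \<in> lifts" "f' \<in> lifts"
  shows "\<bar>height l ((f, u, v, s) \<otimes>\<^bsub>extension_group l\<^esub> (f', u', v', s')) - height l (f, u, v, s) - height l (f', u', v', s')
     + (\<Sum>i<l. u i * v' i)\<bar> \<le> int l"
proof -
  obtain n x where nx: "f' (0, None) = (n, x)" by (cases "f' (0, None)")
  define d where "d = fst (f (n, x)) - fst (f (0, None)) - n"
  have d: "0 \<le> d" "d \<le> 1" using lift_block[OF assms(1), of n x] by (auto simp: d_def)
  have "height l ((f, u, v, s) \<otimes>\<^bsub>extension_group l\<^esub> (f', u', v', s')) - height l (f, u, v, s) - height l (f', u', v', s')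
     + (\<Sum>i<l. u i * v' i) = int l * d"
    by (simp add: height_def extension_simps nx d_def algebra_simps)
  moreover have "\<bar>int l * d\<bar> \<le> int l" using d mult_left_mono[of d 1 "int l"] by (simp add: abs_mult)
  ultimately show ?thesis by simp
qed

text \<open>Map the generators to \<open>ext_a\<close> and \<open>ext_b\<close> modulo the diagonal. The coordinates \<open>x\<close>, \<open>y\<close> and the function
  \<open>\<beta>\<close>, the height, depend only on the coset, and \<open>height_quasi\<close> applies to representatives.\<close>

lemma euler_data:
  assumes G: "group G" and l: "l \<ge> 2"
    and ab: "\<And>i. i < l \<Longrightarrow> a i \<in> carrier G" "\<And>i. i < l \<Longrightarrow> b i \<in> carrier G"
    and homs: "\<And>(\<Gamma> :: extension set monoid) A B. group \<Gamma> \<Longrightarrow> (\<And>j. A j \<in> carrier \<Gamma>) \<Longrightarrow> (\<And>j. B j \<in> carrier \<Gamma>) \<Longrightarrow>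
       comm_prod \<Gamma> A B l = \<one>\<^bsub>\<Gamma>\<^esub> \<Longrightarrow> \<exists>\<rho>\<in>hom G \<Gamma>. \<forall>i<l. \<rho> (a i) = A i \<and> \<rho> (b i) = B i"
  obtains x y :: "'a \<Rightarrow> nat \<Rightarrow> int" and \<beta> :: "'a \<Rightarrow> int" where
    "\<And>g h i. g \<in> carrier G \<Longrightarrow> h \<in> carrier G \<Longrightarrow> x (g \<otimes>\<^bsub>G\<^esub> h) i = x g i + x h i"
    "\<And>g h i. g \<in> carrier G \<Longrightarrow> h \<in> carrier G \<Longrightarrow> y (g \<otimes>\<^bsub>G\<^esub> h) i = y g i + y h i"
    "\<And>i j. i < l \<Longrightarrow> x (a i) j = (if j = i then 1 else 0)" "\<And>i j. i < l \<Longrightarrow> x (b i) j = 0"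
    "\<And>i j. i < l \<Longrightarrow> y (a i) j = 0" "\<And>i j. i < l \<Longrightarrow> y (b i) j = (if j = i then 1 else 0)"
    "\<And>g h. g \<in> carrier G \<Longrightarrow> h \<in> carrier G \<Longrightarrow> \<bar>\<beta> (g \<otimes>\<^bsub>G\<^esub> h) - \<beta> g - \<beta> h + (\<Sum>i<l. x g i * y h i)\<bar> \<le> int l"
proof -
  let ?P = "extension_group l" and ?K = "diagonal l"
  interpret P: group ?P by (rule group_extension_group)
  interpret K: normal ?K ?P by (rule diagonal_normal)
  let ?Q = "?P Mod ?K"
  have Q: "group ?Q" by (rule K.factorgroup_is_group)
  have coset: "(\<lambda>p. ?K #>\<^bsub>?P\<^esub> p) \<in> hom ?P ?Q" by (rule K.r_coset_hom_Mod)
  have "comm_prod ?Q (\<lambda>i. ?K #>\<^bsub>?P\<^esub> ext_a i) (\<lambda>i. ?K #>\<^bsub>?P\<^esub> ext_b i) l = ?K #>\<^bsub>?P\<^esub> comm_prod ?P ext_a ext_b l"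
    by (rule hom_comm_prod[symmetric, OF P.is_group Q coset]) (rule ext_carrier)+
  also have "?K #>\<^bsub>?P\<^esub> comm_prod ?P ext_a ext_b l = \<one>\<^bsub>?Q\<^esub>"
  proof -
    have mem: "comm_prod ?P ext_a ext_b l \<in> ?K" using l by (simp add: ext_comm_prod diagonal_def)
    have "?K #>\<^bsub>?P\<^esub> comm_prod ?P ext_a ext_b l = ?K"
      by (rule P.coset_join2[OF subsetD[OF K.subset mem] K.subgroup_axioms mem])
    then show ?thesis by (simp only: FactGroup_def monoid.simps)
  qed
  finally have rel: "comm_prod ?Q (\<lambda>i. ?K #>\<^bsub>?P\<^esub> ext_a i) (\<lambda>i. ?K #>\<^bsub>?P\<^esub> ext_b i) l = \<one>\<^bsub>?Q\<^esub>" .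
  have "?K #>\<^bsub>?P\<^esub> p \<in> carrier ?Q" if "p \<in> carrier ?P" for p using coset that by (auto simp: hom_def)
  then have "\<exists>\<rho>\<in>hom G ?Q. \<forall>i<l. \<rho> (a i) = ?K #>\<^bsub>?P\<^esub> ext_a i \<and> \<rho> (b i) = ?K #>\<^bsub>?P\<^esub> ext_b i"
    by (intro homs[OF Q _ _ rel]) (simp_all only: ext_carrier)
  then obtain \<rho> where \<rho>: "\<rho> \<in> hom G ?Q"
    and \<rho>_ab: "\<forall>i<l. \<rho> (a i) = ?K #>\<^bsub>?P\<^esub> ext_a i \<and> \<rho> (b i) = ?K #>\<^bsub>?P\<^esub> ext_b i"
    by (rule bexE)
  have "\<exists>p. p \<in> carrier ?P \<and> \<rho> g = ?K #>\<^bsub>?P\<^esub> p" if "g \<in> carrier G" for g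
  proof -
    have "\<rho> g \<in> carrier ?Q" using \<rho> that by (auto simp: hom_def)
    then show ?thesis by (auto simp: FactGroup_def RCOSETS_def)
  qed
  then obtain rep where rep: "\<And>g. g \<in> carrier G \<Longrightarrow> rep g \<in> carrier ?P" "\<And>g. g \<in> carrier G \<Longrightarrow> \<rho> g = ?K #>\<^bsub>?P\<^esub> rep g"
    by metis
  have mult: "?K #>\<^bsub>?P\<^esub> rep (g \<otimes>\<^bsub>G\<^esub> h) = ?K #>\<^bsub>?P\<^esub> (rep g \<otimes>\<^bsub>?P\<^esub> rep h)" if "g \<in> carrier G" "h \<in> carrier G" for g h
  proof -
    have "g \<otimes>\<^bsub>G\<^esub> h \<in> carrier G" using that G by (simp add: group.is_monoid monoid.m_closed)
    then have "?K #>\<^bsub>?P\<^esub> rep (g \<otimes>\<^bsub>G\<^esub> h) = \<rho> (g \<otimes>\<^bsub>G\<^esub> h)" using rep by simp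
    also have "\<dots> = \<rho> g \<otimes>\<^bsub>?Q\<^esub> \<rho> h" using \<rho> that by (simp add: hom_def)
    also have "\<dots> = ?K #>\<^bsub>?P\<^esub> (rep g \<otimes>\<^bsub>?P\<^esub> rep h)" using rep that coset by (simp add: hom_def)
    finally show ?thesis .
  qed
  define x where "x g = fst (snd (rep g))" for g
  define y where "y g = fst (snd (snd (rep g)))" for g
  define \<beta> where "\<beta> g = height l (rep g)" for g
  have same: "x g = u \<and> y g = v \<and> \<beta> g = height l (f, u, v, s)"
    if g: "g \<in> carrier G" "?K #>\<^bsub>?P\<^esub> rep g = ?K #>\<^bsub>?P\<^esub> (f, u, v, s)" "f \<in> lifts" for g f u v s
  proof -
    have "rep g \<in> ?K #>\<^bsub>?P\<^esub> (f, u, v, s)" using P.rcos_self[OF rep(1)[OF g(1)] K.subgroup_axioms] g(2) by simp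
    then obtain k where "rep g = (shift k, \<lambda>_. 0, \<lambda>_. 0, int l * k) \<otimes>\<^bsub>?P\<^esub> (f, u, v, s)"
      by (auto simp: r_coset_def diagonal_def)
    then show ?thesis by (simp add: extension_simps x_def y_def \<beta>_def height_def shift_def algebra_simps)
  qed
  have prod: "x (g \<otimes>\<^bsub>G\<^esub> h) = (\<lambda>i. x g i + x h i) \<and> y (g \<otimes>\<^bsub>G\<^esub> h) = (\<lambda>i. y g i + y h i) \<and>
      \<beta> (g \<otimes>\<^bsub>G\<^esub> h) = height l (rep g \<otimes>\<^bsub>?P\<^esub> rep h)" if gh: "g \<in> carrier G" "h \<in> carrier G" for g h
  proof -
    obtain f u v s where 1: "rep g = (f, u, v, s)" "f \<in> lifts" using rep(1)[OF gh(1)] by (auto simp: extension_simps)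
    obtain f' u' v' s' where 2: "rep h = (f', u', v', s')" "f' \<in> lifts" using rep(1)[OF gh(2)] by (auto simp: extension_simps)
    have c: "g \<otimes>\<^bsub>G\<^esub> h \<in> carrier G" using gh G by (simp add: group.is_monoid monoid.m_closed)
    have "?K #>\<^bsub>?P\<^esub> rep (g \<otimes>\<^bsub>G\<^esub> h) =
      ?K #>\<^bsub>?P\<^esub> (f \<circ> f', \<lambda>i. u i + u' i, \<lambda>i. v i + v' i, s + s' + (\<Sum>i<l. u i * v' i))"
      unfolding mult[OF gh] 1 2 extension_simps ..
    from same[OF c this lifts_compose[OF 1(2) 2(2)]] show ?thesis
      by (simp add: 1 2 x_def y_def extension_simps)
  qed
  show thesis
  proof (rule that[of x y \<beta>])
    show "\<bar>\<beta> (g \<otimes>\<^bsub>G\<^esub> h) - \<beta> g - \<beta> h + (\<Sum>i<l. x g i * y h i)\<bar> \<le> int l" if gh: "g \<in> carrier G" "h \<in> carrier G" for g h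
    proof -
      obtain f u v s where 1: "rep g = (f, u, v, s)" "f \<in> lifts" using rep(1)[OF gh(1)] by (auto simp: extension_simps)
      obtain f' u' v' s' where 2: "rep h = (f', u', v', s')" "f' \<in> lifts" using rep(1)[OF gh(2)] by (auto simp: extension_simps)
      show ?thesis using prod[OF gh] height_quasi[OF 1(2) 2(2), of l u v s u' v' s']
        by (simp add: 1 2 x_def y_def \<beta>_def)
    qed
    have a: "x (a i) = (\<lambda>j. if j = i then 1 else 0) \<and> y (a i) = (\<lambda>_. 0)" if "i < l" for i
    proof -
      have e: "?K #>\<^bsub>?P\<^esub> rep (a i) = ?K #>\<^bsub>?P\<^esub> ext_a i" using rep(2)[OF ab(1)[OF that]] \<rho>_ab that by metis
      have "(if i < 2 then torus_a else id) \<in> lifts" by (simp add: torus_lifts lifts_id)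
      from same[OF ab(1)[OF that] e[unfolded ext_a_def] this] show ?thesis by simp
    qed
    have b: "x (b i) = (\<lambda>_. 0) \<and> y (b i) = (\<lambda>j. if j = i then 1 else 0)" if "i < l" for i
    proof -
      have e: "?K #>\<^bsub>?P\<^esub> rep (b i) = ?K #>\<^bsub>?P\<^esub> ext_b i" using rep(2)[OF ab(2)[OF that]] \<rho>_ab that by metis
      have "(if i < 2 then torus_b else id) \<in> lifts" by (simp add: torus_lifts lifts_id)
      from same[OF ab(2)[OF that] e[unfolded ext_b_def] this] show ?thesis by simp
    qed
    show "x (a i) j = (if j = i then 1 else 0)" "x (b i) j = 0" "y (a i) j = 0" "y (b i) j = (if j = i then 1 else 0)"
      if "i < l" for i j using a[OF that] b[OF that] by simp_all
  qed (use prod in simp_all)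
qed

section \<open>Functions that are additive up to a biadditive form and a bounded error\<close>

definition additive :: "('a, 'b) monoid_scheme \<Rightarrow> ('a \<Rightarrow> int) \<Rightarrow> bool" where
  "additive G f \<longleftrightarrow> (\<forall>g\<in>carrier G. \<forall>h\<in>carrier G. f (g \<otimes>\<^bsub>G\<^esub> h) = f g + f h)"

definition biadditive :: "('a, 'b) monoid_scheme \<Rightarrow> ('a \<Rightarrow> 'a \<Rightarrow> int) \<Rightarrow> bool" where
  "biadditive G E \<longleftrightarrow> (\<forall>g\<in>carrier G. additive G (E g) \<and> additive G (\<lambda>h. E h g))"

text \<open>A bounded-error version of the statement that the class of the bilinear cocycle \<open>E\<close> is trivial.
  For \<open>D = 0\<close> it says that \<open>- E\<close> is the coboundary of \<open>\<beta>\<close>.\<close>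

definition quasi_form :: "('a, 'b) monoid_scheme \<Rightarrow> int \<Rightarrow> ('a \<Rightarrow> 'a \<Rightarrow> int) \<Rightarrow> ('a \<Rightarrow> int) \<Rightarrow> bool" where
  "quasi_form G D E \<beta> \<longleftrightarrow> biadditive G E \<and>
     (\<forall>g\<in>carrier G. \<forall>h\<in>carrier G. \<bar>\<beta> (g \<otimes>\<^bsub>G\<^esub> h) - \<beta> g - \<beta> h - E g h\<bar> \<le> D)"

context group
begin

lemma additiveD: "additive G f \<Longrightarrow> g \<in> carrier G \<Longrightarrow> h \<in> carrier G \<Longrightarrow> f (g \<otimes> h) = f g + f h"
  by (simp add: additive_def)

lemma additive_one: "additive G f \<Longrightarrow> f \<one> = 0"
  using additiveD[of f \<one> \<one>] by simp

lemma additive_inv: "additive G f \<Longrightarrow> g \<in> carrier G \<Longrightarrow> f (inv g) = - f g"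
  using additiveD[of f "inv g" g] additive_one[of f] by simp

lemma additive_pow: "additive G f \<Longrightarrow> g \<in> carrier G \<Longrightarrow> f (g [^] (n::nat)) = int n * f g"
  by (induction n) (simp_all add: additive_one additiveD algebra_simps)

lemma additive_comm: "additive G f \<Longrightarrow> g \<in> carrier G \<Longrightarrow> h \<in> carrier G \<Longrightarrow> f (comm G g h) = 0"
  by (simp add: comm_def additiveD additive_inv)

lemma comm_derived: "g \<in> carrier G \<Longrightarrow> h \<in> carrier G \<Longrightarrow> comm G g h \<in> derived G (carrier G)"
  unfolding derived_def comm_def by (intro generate.incl) blast

lemma derived_induct [consumes 1, case_names one comm inv mult]:
  assumes "w \<in> derived G (carrier G)" and "P \<one>"
    and "\<And>g h. g \<in> carrier G \<Longrightarrow> h \<in> carrier G \<Longrightarrow> P (comm G g h)"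
    and "\<And>w. w \<in> carrier G \<Longrightarrow> P w \<Longrightarrow> P (inv w)"
    and "\<And>v w. v \<in> derived G (carrier G) \<Longrightarrow> w \<in> derived G (carrier G) \<Longrightarrow> P v \<Longrightarrow> P w \<Longrightarrow> P (v \<otimes> w)"
  shows "P w"
  using assms(1) unfolding derived_def
proof (induction rule: generate.induct)
  case (inv h)
  then obtain x y where "x \<in> carrier G" "y \<in> carrier G" "h = comm G x y" by (auto simp: comm_def)
  then show ?case using assms(3,4) by simp
next
  case (incl h)
  then obtain x y where "x \<in> carrier G" "y \<in> carrier G" "h = comm G x y" by (auto simp: comm_def)
  then show ?case using assms(3) by simp
qed (use assms(2,5) in \<open>auto simp: derived_def\<close>)

lemma derived_sub: "derived G (carrier G) \<subseteq> carrier G"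
  by (rule derived_in_carrier) simp

lemma additive_derived: "additive G f \<Longrightarrow> w \<in> derived G (carrier G) \<Longrightarrow> f w = 0"
  by (rotate_tac, induction w rule: derived_induct)
    (use derived_sub in \<open>auto simp: additive_one additive_comm additive_inv additiveD subset_iff\<close>)

lemma quasi_formD:
  assumes "quasi_form G D E \<beta>" "g \<in> carrier G" "h \<in> carrier G"
  shows "\<bar>\<beta> (g \<otimes> h) - \<beta> g - \<beta> h - E g h\<bar> \<le> D" "additive G (E g)" "additive G (\<lambda>h. E h g)"
  using assms by (auto simp: quasi_form_def biadditive_def)

lemma quasi_form_derived:
  assumes q: "quasi_form G D E \<beta>" and gh: "g \<in> carrier G" "h \<in> carrier G"
    and or: "g \<in> derived G (carrier G) \<or> h \<in> derived G (carrier G)"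
  shows "\<bar>\<beta> (g \<otimes> h) - \<beta> g - \<beta> h\<bar> \<le> D"
proof -
  have "E g h = 0" using or additive_derived quasi_formD(2,3)[OF q] gh by blast
  then show ?thesis using quasi_formD(1)[OF q gh] by simp
qed

lemma derived_one: "\<one> \<in> derived G (carrier G)"
  by (simp add: derived_is_subgroup subgroup.one_closed)

lemma quasi_form_one: "quasi_form G D E \<beta> \<Longrightarrow> \<bar>\<beta> \<one>\<bar> \<le> D"
  using quasi_form_derived[of D E \<beta> \<one> \<one>] derived_one by simp

lemma quasi_form_comm:
  assumes q: "quasi_form G D E \<beta>" and gh: "g \<in> carrier G" "h \<in> carrier G"
  shows "\<bar>\<beta> (comm G g h) - (E g h - E h g)\<bar> \<le> 3 * D"
proof -
  have "\<bar>\<beta> (comm G g h \<otimes> (h \<otimes> g)) - \<beta> (comm G g h) - \<beta> (h \<otimes> g)\<bar> \<le> D"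
    using gh by (intro quasi_form_derived[OF q] disjI1 comm_derived) auto
  then show ?thesis using quasi_formD(1)[OF q gh] quasi_formD(1)[OF q gh(2,1)] gh by (simp add: comm_mult)
qed

lemma comm_prod_derived:
  "(\<And>i. i < n \<Longrightarrow> a i \<in> carrier G) \<Longrightarrow> (\<And>i. i < n \<Longrightarrow> b i \<in> carrier G) \<Longrightarrow> comm_prod G a b n \<in> derived G (carrier G)"
  by (induction n) (auto simp: derived_one comm_derived derived_is_subgroup subgroup.m_closed)

text \<open>Since the form vanishes on commutators, the value on a product of commutators is
  determined up to a bounded error by the form; for \<open>D = 0\<close> this is an equation.\<close>

lemma quasi_form_comm_prod:
  assumes q: "quasi_form G D E \<beta>" and ab: "\<And>i. i < n \<Longrightarrow> a i \<in> carrier G" "\<And>i. i < n \<Longrightarrow> b i \<in> carrier G"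
  shows "\<bar>\<beta> (comm_prod G a b n) - (\<Sum>i<n. E (a i) (b i) - E (b i) (a i))\<bar> \<le> (4 * int n + 1) * D"
  using ab
proof (induction n)
  case 0
  then show ?case using quasi_form_one[OF q] by simp
next
  case (Suc n)
  have "comm_prod G a b n \<in> carrier G" "comm G (a n) (b n) \<in> derived G (carrier G)" "comm G (a n) (b n) \<in> carrier G"
    using Suc.prems by (auto intro: comm_prod_closed comm_derived)
  then have "\<bar>\<beta> (comm_prod G a b n \<otimes> comm G (a n) (b n)) - \<beta> (comm_prod G a b n) - \<beta> (comm G (a n) (b n))\<bar> \<le> D"
    by (intro quasi_form_derived[OF q]) auto
  moreover have "\<bar>\<beta> (comm G (a n) (b n)) - (E (a n) (b n) - E (b n) (a n))\<bar> \<le> 3 * D"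
    using Suc.prems by (intro quasi_form_comm[OF q]) auto
  ultimately show ?case using Suc by (simp add: distrib_right) 
qed

lemma quasi_form_pow:
  assumes q: "quasi_form G D E \<beta>" and w: "w \<in> derived G (carrier G)"
  shows "\<bar>\<beta> (w [^] (n::nat)) - int n * \<beta> w\<bar> \<le> (int n + 1) * D"
proof (induction n)
  case 0
  then show ?case using quasi_form_one[OF q] by simp
next
  case (Suc n)
  have "w \<in> carrier G" using w derived_sub by auto
  then have "\<bar>\<beta> (w [^] n \<otimes> w) - \<beta> (w [^] n) - \<beta> w\<bar> \<le> D" using w by (intro quasi_form_derived[OF q]) auto
  then show ?case using Suc by (simp add: distrib_right)
qed

lemma quasi_form_conj:
  assumes q: "quasi_form G D E \<beta>" and w: "w \<in> derived G (carrier G)" and g: "g \<in> carrier G"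
  shows "\<bar>\<beta> (g \<otimes> w \<otimes> inv g) - \<beta> w\<bar> \<le> 2 * D"
proof -
  have wG: "w \<in> carrier G" using w derived_sub by auto
  interpret N: normal "derived G (carrier G)" G by (rule derived_self_is_normal)
  have c: "g \<otimes> w \<otimes> inv g \<in> derived G (carrier G)" using g w by (rule N.inv_op_closed2)
  have "\<bar>\<beta> (g \<otimes> w \<otimes> inv g \<otimes> g) - \<beta> (g \<otimes> w \<otimes> inv g) - \<beta> g\<bar> \<le> D"
    using c g wG by (intro quasi_form_derived[OF q]) auto
  moreover have "g \<otimes> w \<otimes> inv g \<otimes> g = g \<otimes> w" using g wG by (simp add: m_assoc)
  moreover have "\<bar>\<beta> (g \<otimes> w) - \<beta> g - \<beta> w\<bar> \<le> D" using g w wG by (intro quasi_form_derived[OF q]) auto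
  ultimately show ?thesis by simp
qed

lemma quasi_form_inv:
  assumes q: "quasi_form G D E \<beta>" and w: "w \<in> derived G (carrier G)"
  shows "\<bar>\<beta> (inv w) + \<beta> w\<bar> \<le> 2 * D"
proof -
  have wG: "w \<in> carrier G" using w derived_sub by auto
  then have "\<bar>\<beta> (w \<otimes> inv w) - \<beta> w - \<beta> (inv w)\<bar> \<le> D" using w by (intro quasi_form_derived[OF q]) auto
  then show ?thesis using quasi_form_one[OF q] wG by simp
qed

subsection \<open>Invariance of the intersection form\<close>

context
  fixes l :: nat and a b :: "nat \<Rightarrow> 'a" and x y :: "'a \<Rightarrow> nat \<Rightarrow> int"
  assumes ab: "\<And>i. i < l \<Longrightarrow> a i \<in> carrier G" "\<And>i. i < l \<Longrightarrow> b i \<in> carrier G"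
    and rel: "comm_prod G a b l = \<one>"
    and gens: "carrier G = generate G (a ` {..<l} \<union> b ` {..<l})"
    and x_add: "\<And>i. additive G (\<lambda>g. x g i)" and y_add: "\<And>i. additive G (\<lambda>g. y g i)"
    and x_a: "\<And>i j. i < l \<Longrightarrow> x (a i) j = (if j = i then 1 else 0)" and x_b: "\<And>i j. i < l \<Longrightarrow> x (b i) j = 0"
    and y_a: "\<And>i j. i < l \<Longrightarrow> y (a i) j = 0" and y_b: "\<And>i j. i < l \<Longrightarrow> y (b i) j = (if j = i then 1 else 0)"
begin

definition intersection where "intersection g h = (\<Sum>i<l. x g i * y h i - y g i * x h i)"

text \<open>The cup product of two elements of \<open>H\<^sup>1\<close>, evaluated on the fundamental class.\<close>

definition cup where "cup f k = (\<Sum>i<l. f (a i) * k (b i) - f (b i) * k (a i))" for f k :: "'a \<Rightarrow> int"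

lemma coordinates_mult:
  "g \<in> carrier G \<Longrightarrow> h \<in> carrier G \<Longrightarrow> x (g \<otimes> h) i = x g i + x h i"
  "g \<in> carrier G \<Longrightarrow> h \<in> carrier G \<Longrightarrow> y (g \<otimes> h) i = y g i + y h i"
  using x_add[of i] y_add[of i] by (simp_all add: additive_def)

lemma intersection_biadditive: "biadditive G intersection"
  unfolding biadditive_def additive_def intersection_def
  by (auto simp: coordinates_mult sum.distrib[symmetric] algebra_simps intro!: sum.cong)

lemma additive_eq:
  assumes "additive G f" "additive G k" "\<And>i. i < l \<Longrightarrow> f (a i) = k (a i)" "\<And>i. i < l \<Longrightarrow> f (b i) = k (b i)"
    and "g \<in> carrier G"
  shows "f g = k g"
proof -
  have sub: "a ` {..<l} \<union> b ` {..<l} \<subseteq> carrier G" using ab by auto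
  have "g \<in> generate G (a ` {..<l} \<union> b ` {..<l})" using assms(5) gens by simp
  then show ?thesis
  proof (induction rule: generate.induct)
    case one
    then show ?case using assms by (simp add: additive_one)
  next
    case (incl h)
    then show ?case using assms by auto
  next
    case (inv h)
    then have "h \<in> carrier G" "f h = k h" using sub assms by auto
    then show ?case using assms by (simp add: additive_inv)
  next
    case (eng h1 h2)
    then have "h1 \<in> carrier G" "h2 \<in> carrier G" using gens by auto
    then show ?case using eng assms by (simp add: additiveD)
  qed
qed

text \<open>The functional \<open>intersection g\<close> is Poincare dual to \<open>g\<close>.\<close>

lemma cup_intersection:
  assumes f: "additive G f" and g: "g \<in> carrier G"
  shows "cup f (intersection g) = f g"
proof (rule additive_eq[OF _ f _ _ g])
  show "additive G (\<lambda>g. cup f (intersection g))"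
    using intersection_biadditive ab
    by (auto simp: additive_def biadditive_def cup_def sum.distrib[symmetric] algebra_simps intro!: sum.cong)
  have val: "intersection h (a j) = - y h j" "intersection h (b j) = x h j" if "j < l" for h j
    using that by (simp_all add: intersection_def x_a y_a x_b y_b if_distrib[of "\<lambda>r. _ * r"] sum_negf cong: if_cong)
  show "cup f (intersection (a i)) = f (a i)" if "i < l" for i
    using that by (simp add: cup_def val x_a y_a if_distrib[of "\<lambda>r. _ * r"] cong: if_cong)
  show "cup f (intersection (b i)) = f (b i)" if "i < l" for i
    using that by (simp add: cup_def val x_b y_b if_distrib[of "\<lambda>r. _ * r"] cong: if_cong)
qed

text \<open>An automorphism that acts trivially on \<open>H\<^sup>2\<close> preserves cup products: evaluate the
  coboundary on the surface relation.\<close>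

lemma cup_invariant:
  assumes \<psi>: "\<psi> \<in> Aut_plus G" and f: "additive G f" and k: "additive G k"
  shows "cup (\<lambda>g. f (\<psi> g)) (\<lambda>g. k (\<psi> g)) = cup f k"
proof -
  have hom: "\<psi> \<in> hom G G" using \<psi> by (auto simp: Aut_plus_def auto_def)
  have \<psi>c: "\<psi> g \<in> carrier G" if "g \<in> carrier G" for g using hom that by (auto simp: hom_def)
  have \<psi>m: "\<psi> (g \<otimes> h) = \<psi> g \<otimes> \<psi> h" if "g \<in> carrier G" "h \<in> carrier G" for g h using hom that by (auto simp: hom_def)
  let ?c = "\<lambda>g h. f g * k h"
  have "int_cocycle2 G ?c" using f k by (simp add: int_cocycle2_def additiveD algebra_simps)
  moreover have "\<forall>c. int_cocycle2 G c \<longrightarrow> int_coboundary2 G (\<lambda>g h. c (\<psi> g) (\<psi> h) - c g h)"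
    using \<psi> by (simp add: Aut_plus_def)
  ultimately have "int_coboundary2 G (\<lambda>g h. ?c (\<psi> g) (\<psi> h) - ?c g h)"
    by (elim allE[of _ ?c] impE)
  then obtain c where c: "\<forall>g\<in>carrier G. \<forall>h\<in>carrier G.
      f (\<psi> g) * k (\<psi> h) - f g * k h = c h - c (g \<otimes> h) + c g"
    unfolding int_coboundary2_def by (rule exE)
  let ?E = "\<lambda>g h. f g * k h - f (\<psi> g) * k (\<psi> h)"
  have "quasi_form G 0 ?E c"
    unfolding quasi_form_def
  proof (intro conjI ballI)
    show "biadditive G ?E" using f k \<psi>c
      by (simp add: biadditive_def additive_def \<psi>m algebra_simps)
    show "\<bar>c (g \<otimes> h) - c g - c h - ?E g h\<bar> \<le> 0" if "g \<in> carrier G" "h \<in> carrier G" for g h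
      using bspec[OF bspec[OF c that(1)] that(2)] by simp
  qed
  from quasi_form_comm_prod[OF this, of l a b] quasi_form_one[OF this] ab
  have "(\<Sum>i<l. ?E (a i) (b i) - ?E (b i) (a i)) = 0" by (simp add: rel)
  then show ?thesis by (simp add: cup_def sum_subtractf sum.distrib algebra_simps)
qed

text \<open>Since \<open>intersection g\<close> is dual to \<open>g\<close> and the cup product is invariant, the functionals
  \<open>intersection (\<psi> g) \<circ> \<psi>\<close> and \<open>intersection g\<close> have the same cup product with each \<open>f \<circ> \<psi>\<close>. All
  functionals are of this form, because \<open>\<psi>\<close> is invertible, and the cup product is nondegenerate.\<close>

lemma intersection_invariant:
  assumes \<psi>: "\<psi> \<in> Aut_plus G" and gh: "g \<in> carrier G" "h \<in> carrier G"
  shows "intersection (\<psi> g) (\<psi> h) = intersection g h"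
proof -
  have hom: "\<psi> \<in> hom G G" and Bij: "\<psi> \<in> Bij (carrier G)" using \<psi> by (auto simp: Aut_plus_def auto_def)
  have \<psi>c: "\<psi> g \<in> carrier G" if "g \<in> carrier G" for g using hom that by (auto simp: hom_def)
  have \<psi>m: "\<psi> (g \<otimes> h) = \<psi> g \<otimes> \<psi> h" if "g \<in> carrier G" "h \<in> carrier G" for g h using hom that by (auto simp: hom_def)
  define \<phi> where "\<phi> = restrict (inv_into (carrier G) \<psi>) (carrier G)"
  have \<phi>: "\<phi> \<in> hom G G" unfolding \<phi>_def by (rule restrict_inv_into_hom[OF hom Bij])
  have \<phi>\<psi>: "\<phi> (\<psi> g) = g" if "g \<in> carrier G" for g
    using Bij that \<psi>c by (simp add: \<phi>_def Bij_def bij_betw_def inv_into_f_f)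
  have E: "additive G (intersection g)" if "g \<in> carrier G" for g
    using intersection_biadditive that by (simp add: biadditive_def)
  have E\<psi>: "additive G (\<lambda>h. intersection (\<psi> g) (\<psi> h))"
    using E[OF \<psi>c[OF gh(1)]] \<psi>c by (simp add: additive_def \<psi>m)
  have dual: "cup f (\<lambda>h. intersection (\<psi> g) (\<psi> h)) = cup f (intersection g)" if f: "additive G f" for f
  proof -
    have f\<phi>: "additive G (\<lambda>g. f (\<phi> g))" using f \<phi> by (auto simp: additive_def hom_def)
    have "cup f (\<lambda>h. intersection (\<psi> g) (\<psi> h)) = cup (\<lambda>g. f (\<phi> (\<psi> g))) (\<lambda>h. intersection (\<psi> g) (\<psi> h))"
      using ab by (simp add: cup_def \<phi>\<psi>)
    also have "\<dots> = cup (\<lambda>g. f (\<phi> g)) (intersection (\<psi> g))" by (rule cup_invariant[OF \<psi> f\<phi> E[OF \<psi>c[OF gh(1)]]])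
    also have "\<dots> = f (\<phi> (\<psi> g))" by (rule cup_intersection[OF f\<phi> \<psi>c[OF gh(1)]])
    also have "\<dots> = cup f (intersection g)" using cup_intersection[OF f gh(1)] \<phi>\<psi>[OF gh(1)] by simp
    finally show ?thesis .
  qed
  have cx: "cup (\<lambda>g. x g i) k = k (b i)" and cy: "cup (\<lambda>g. y g i) k = - k (a i)" if "i < l" for i k
  proof -
    have "cup (\<lambda>g. x g i) k = (\<Sum>j<l. if j = i then k (b j) else 0)"
      unfolding cup_def by (rule sum.cong) (auto simp: x_a x_b)
    then show "cup (\<lambda>g. x g i) k = k (b i)" using that by simp
    have "cup (\<lambda>g. y g i) k = (\<Sum>j<l. if j = i then - k (a j) else 0)"
      unfolding cup_def by (rule sum.cong) (auto simp: y_a y_b)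
    then show "cup (\<lambda>g. y g i) k = - k (a i)" using that by simp
  qed
  show ?thesis
  proof (rule additive_eq[OF E\<psi> E[OF gh(1)] _ _ gh(2)])
    show "intersection (\<psi> g) (\<psi> (a i)) = intersection g (a i)" if "i < l" for i
      using dual[OF y_add[of i]] cy[OF that] by simp
    show "intersection (\<psi> g) (\<psi> (b i)) = intersection g (b i)" if "i < l" for i
      using dual[OF x_add[of i]] cx[OF that] by simp
  qed
qed

text \<open>Completing the square turns the one-sided form of a bounded cocycle into the
  antisymmetric, and therefore invariant, intersection form.\<close>

lemma intersection_quasi_form:
  assumes "\<And>g h. g \<in> carrier G \<Longrightarrow> h \<in> carrier G \<Longrightarrow> \<bar>\<beta> (g \<otimes> h) - \<beta> g - \<beta> h + (\<Sum>i<l. x g i * y h i)\<bar> \<le> D"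
  shows "quasi_form G (2 * D) intersection (\<lambda>g. - (2 * \<beta> g + (\<Sum>i<l. x g i * y g i)))"
  unfolding quasi_form_def
proof (intro conjI ballI intersection_biadditive)
  fix g h assume gh: "g \<in> carrier G" "h \<in> carrier G"
  have "(\<Sum>i<l. x (g \<otimes> h) i * y (g \<otimes> h) i) = (\<Sum>i<l. x g i * y g i) + (\<Sum>i<l. x h i * y h i) + (\<Sum>i<l. x g i * y h i) + (\<Sum>i<l. y g i * x h i)"
    using gh by (simp add: coordinates_mult sum.distrib[symmetric] algebra_simps)
  moreover have "intersection g h = (\<Sum>i<l. x g i * y h i) - (\<Sum>i<l. y g i * x h i)"
    by (simp add: intersection_def sum_subtractf)
  ultimately show "\<bar>- (2 * \<beta> (g \<otimes> h) + (\<Sum>i<l. x (g \<otimes> h) i * y (g \<otimes> h) i)) - - (2 * \<beta> g + (\<Sum>i<l. x g i * y g i))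
      - - (2 * \<beta> h + (\<Sum>i<l. x h i * y h i)) - intersection g h\<bar> \<le> 2 * D"
    using assms[OF gh] by linarith
qed

lemma invariant_quasi_form:
  assumes \<psi>: "\<psi> \<in> Aut_plus G"
    and \<beta>: "\<And>g h. g \<in> carrier G \<Longrightarrow> h \<in> carrier G \<Longrightarrow> \<bar>\<beta> (g \<otimes> h) - \<beta> g - \<beta> h + (\<Sum>i<l. x g i * y h i)\<bar> \<le> D"
  obtains E \<beta>' where "quasi_form G (2 * D) E \<beta>'"
    "\<And>g h. g \<in> carrier G \<Longrightarrow> h \<in> carrier G \<Longrightarrow> E (\<psi> g) (\<psi> h) = E g h"
    "\<And>i. i < l \<Longrightarrow> E (a i) (b i) - E (b i) (a i) = 2"
proof (rule that[OF intersection_quasi_form[OF \<beta>] intersection_invariant[OF \<psi>]])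
  have sum: "(\<Sum>j<l. (if j = i then 1 else 0) * (if j = i then 1 else 0)) = (1::int)" if "i < l" for i
    using that by (simp add: if_distrib[of "\<lambda>r. r * _"] cong: if_cong)
  show "intersection (a i) (b i) - intersection (b i) (a i) = 2" if "i < l" for i
    using that sum[OF that] by (simp add: intersection_def x_a x_b y_a y_b sum_negf)
qed

end

end

section \<open>Mixed commutators in the mapping torus group\<close>

lemma comm_prod_cong:
  "(\<And>i. i < n \<Longrightarrow> a i = a' i) \<Longrightarrow> comm_prod G a b n = comm_prod G a' b n"
  by (induction n) auto

text \<open>The two sums differ only in their first and last \<open>\<bar>m\<bar>\<close> terms.\<close>

lemma bounded_telescope:
  fixes b :: "int \<Rightarrow> int"
  assumes b: "\<And>k. \<bar>b k\<bar> \<le> B"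
  shows "\<exists>C. \<forall>n::nat. (\<Sum>k<n. b (int k + m) - b (int k)) \<le> C"
proof -
  have tele: "(\<Sum>k<n. b (int k + j + 1) - b (int k + j)) = b (int n + j) - b j" for n :: nat and j
    by (induction n) (simp_all add: algebra_simps)
  have "\<exists>C. \<forall>n::nat. \<bar>\<Sum>k<n. b (int k + m) - b (int k)\<bar> \<le> C"
  proof (induction m rule: int_induct[where k = 0])
    case base
    then show ?case by (intro exI[of _ 0]) simp
  next
    case (step1 j)
    then obtain C where C: "\<And>n::nat. \<bar>\<Sum>k<n. b (int k + j) - b (int k)\<bar> \<le> C" by blast
    have "\<bar>\<Sum>k<n. b (int k + (j + 1)) - b (int k)\<bar> \<le> C + 2 * B" for n :: nat
    proof -
      have "(\<Sum>k<n. b (int k + (j + 1)) - b (int k)) = (\<Sum>k<n. b (int k + j) - b (int k)) + (b (int n + j) - b j)"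
        unfolding tele[symmetric] sum.distrib[symmetric] by (simp add: add.assoc)
      then show ?thesis using C[of n] b[of "int n + j"] b[of j] by linarith
    qed
    then show ?case by blast
  next
    case (step2 j)
    then obtain C where C: "\<And>n::nat. \<bar>\<Sum>k<n. b (int k + j) - b (int k)\<bar> \<le> C" by blast
    have "\<bar>\<Sum>k<n. b (int k + (j - 1)) - b (int k)\<bar> \<le> C + 2 * B" for n :: nat
    proof -
      have "(\<Sum>k<n. b (int k + (j - 1)) - b (int k)) = (\<Sum>k<n. b (int k + j) - b (int k)) - (b (int n + (j - 1)) - b (j - 1))"
        unfolding tele[symmetric] sum_subtractf[symmetric] by (simp add: algebra_simps)
      then show ?thesis using C[of n] b[of "int n + (j - 1)"] b[of "j - 1"] by linarith
    qed
    then show ?case by blast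
  qed
  then show ?thesis by (meson abs_le_D1)
qed

context group
begin

lemma central_comm_pow:
  assumes ab: "a \<in> carrier G" "b \<in> carrier G"
    and c: "\<And>g. g \<in> carrier G \<Longrightarrow> comm G a b \<otimes> g = g \<otimes> comm G a b"
  shows "comm G (a [^] (n::nat)) b = comm G a b [^] n"
proof (induction n)
  case 0
  then show ?case using ab by (simp add: comm_def)
next
  case (Suc n)
  have "comm G (a [^] Suc n) b = a [^] n \<otimes> comm G a b \<otimes> (b \<otimes> inv (a [^] n) \<otimes> inv b)"
    using ab by (simp add: comm_def m_assoc inv_mult_group)
  also have "a [^] n \<otimes> comm G a b = comm G a b \<otimes> a [^] n" using c[of "a [^] n"] ab by simp
  also have "comm G a b \<otimes> a [^] n \<otimes> (b \<otimes> inv (a [^] n) \<otimes> inv b) = comm G a b \<otimes> comm G (a [^] n) b"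
    using ab by (simp add: comm_def m_assoc)
  also have "\<dots> = comm G a b [^] Suc n" using Suc ab nat_pow_Suc2[of "comm G a b" n] by simp
  finally show ?case .
qed

lemma central_comm_prod_pow:
  assumes "\<And>i. i < l \<Longrightarrow> a i \<in> carrier G" "\<And>i. i < l \<Longrightarrow> b i \<in> carrier G"
    and "\<And>i g. i < l \<Longrightarrow> g \<in> carrier G \<Longrightarrow> comm G (a i) (b i) \<otimes> g = g \<otimes> comm G (a i) (b i)"
  shows "comm_prod G (\<lambda>i. a i [^] (n::nat)) b l = comm_prod G a b l [^] n"
  using assms
proof (induction l)
  case (Suc l)
  have c: "comm G (a l) (b l) \<in> carrier G" "comm_prod G a b l \<in> carrier G"
    using Suc.prems by (auto intro: comm_prod_closed)
  have "comm_prod G (\<lambda>i. a i [^] n) b (Suc l) = comm_prod G a b l [^] n \<otimes> comm G (a l) (b l) [^] n"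
    using Suc central_comm_pow[of "a l" "b l" n] by simp
  also have "\<dots> = (comm_prod G a b l \<otimes> comm G (a l) (b l)) [^] n"
    using c Suc.prems(3)[of l "comm_prod G a b l"] by (intro pow_mult_distrib[symmetric]) auto
  finally show ?case by simp
qed simp

lemma mixed_commutator_subgroup_normal:
  assumes N: "N \<lhd> G" shows "mixed_commutator_subgroup G N \<lhd> G"
proof -
  interpret N: normal N G by (rule N)
  show ?thesis
    unfolding mixed_commutator_subgroup_def
  proof (rule normal_generateI)
    show "mixed_commutators G N \<subseteq> carrier G" by (rule mixed_commutators_carrier[OF N.subset])
    fix h g assume "h \<in> mixed_commutators G N" and g: "g \<in> carrier G"
    then obtain k w where h: "h = comm G k w" "k \<in> carrier G" "w \<in> N" by (auto simp: mixed_commutators_eq)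
    have w: "w \<in> carrier G" using h(3) N.subset by auto
    have "g \<otimes> h \<otimes> inv g = comm G (g \<otimes> k \<otimes> inv g) (g \<otimes> w \<otimes> inv g)"
      using g w h by (simp add: comm_def m_assoc inv_mult_group)
    moreover have "g \<otimes> w \<otimes> inv g \<in> N" using N.inv_op_closed2 g h(3) by auto
    ultimately show "g \<otimes> h \<otimes> inv g \<in> mixed_commutators G N"
      using g h by (auto simp: mixed_commutators_eq)
  qed
qed

text \<open>Modulo \<open>[G,N]\<close> the group \<open>N\<close> is central, so commutators in \<open>N\<close> are multiplicative in each
  argument and the relation may be raised to a power inside its commutators.\<close>

lemma powered_relation:
  assumes N: "N \<lhd> G" and ab: "\<And>i. i < l \<Longrightarrow> a i \<in> carrier G" "\<And>i. i < l \<Longrightarrow> b i \<in> carrier G"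
    and inN: "\<And>i. i < l \<Longrightarrow> comm G (a i) (b i) \<in> N" and rel: "comm_prod G a b l = \<one>"
  shows "comm_prod G (\<lambda>i. a i [^] (n::nat)) b l \<in> mixed_commutator_subgroup G N"
proof -
  let ?M = "mixed_commutator_subgroup G N"
  interpret M: normal ?M G by (rule mixed_commutator_subgroup_normal[OF N])
  interpret N: normal N G by (rule N)
  let ?Q = "G Mod ?M" and ?c = "\<lambda>g. ?M #> g"
  interpret Q: group ?Q by (rule M.factorgroup_is_group)
  have hom: "?c \<in> hom G ?Q" by (rule M.r_coset_hom_Mod)
  interpret c: group_hom G ?Q ?c using hom by (simp add: group_hom_def group_hom_axioms_def is_group Q.is_group)
  have one: "\<one>\<^bsub>?Q\<^esub> = ?M" by (simp add: FactGroup_def)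
  have kernel: "?c g = \<one>\<^bsub>?Q\<^esub> \<longleftrightarrow> g \<in> ?M" if "g \<in> carrier G" for g
    using that M.subgroup_axioms coset_join1[of ?M g] coset_join2[of g ?M] M.subset one by auto
  have central: "?c w \<otimes>\<^bsub>?Q\<^esub> q = q \<otimes>\<^bsub>?Q\<^esub> ?c w" if w: "w \<in> N" and q: "q \<in> carrier ?Q" for w q
  proof -
    obtain g where g: "g \<in> carrier G" "q = ?c g" using q by (auto simp: FactGroup_def RCOSETS_def)
    have wG: "w \<in> carrier G" using w N.subset by auto
    have "comm G g w \<in> ?M" unfolding mixed_commutator_subgroup_def
      using g w by (intro generate.incl) (auto simp: mixed_commutators_eq)
    then have "?c (comm G g w) = \<one>\<^bsub>?Q\<^esub>" using kernel g wG by simp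
    moreover have "?c (comm G g w) \<otimes>\<^bsub>?Q\<^esub> (?c w \<otimes>\<^bsub>?Q\<^esub> ?c g) = ?c g \<otimes>\<^bsub>?Q\<^esub> ?c w"
      using g wG comm_mult[OF g(1) wG] by (metis c.hom_mult comm_closed m_closed)
    ultimately have "\<one>\<^bsub>?Q\<^esub> \<otimes>\<^bsub>?Q\<^esub> (?c w \<otimes>\<^bsub>?Q\<^esub> ?c g) = ?c g \<otimes>\<^bsub>?Q\<^esub> ?c w" by (simp only:)
    moreover have "?c w \<otimes>\<^bsub>?Q\<^esub> ?c g \<in> carrier ?Q" by (intro Q.m_closed c.hom_closed wG g(1))
    ultimately show ?thesis unfolding g(2) by (simp only: Q.l_one)
  qed
  have ccomm: "comm ?Q (?c (a i)) (?c (b i)) = ?c (comm G (a i) (b i))" if "i < l" for i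
    using ab that by (simp add: comm_def)
  have "?c (comm_prod G (\<lambda>i. a i [^] n) b l) = comm_prod ?Q (\<lambda>i. ?c (a i [^] n)) (\<lambda>i. ?c (b i)) l"
    by (rule hom_comm_prod[OF is_group Q.is_group hom]) (use ab in auto)
  also have "\<dots> = comm_prod ?Q (\<lambda>i. ?c (a i) [^]\<^bsub>?Q\<^esub> n) (\<lambda>i. ?c (b i)) l"
    by (rule comm_prod_cong) (rule c.hom_nat_pow, rule ab)
  also have "\<dots> = comm_prod ?Q (\<lambda>i. ?c (a i)) (\<lambda>i. ?c (b i)) l [^]\<^bsub>?Q\<^esub> n"
  proof (rule Q.central_comm_prod_pow)
    fix i q assume i: "i < l" and q: "q \<in> carrier ?Q"
    show "comm ?Q (?c (a i)) (?c (b i)) \<otimes>\<^bsub>?Q\<^esub> q = q \<otimes>\<^bsub>?Q\<^esub> comm ?Q (?c (a i)) (?c (b i))"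
      unfolding ccomm[OF i] by (rule central[OF inN[OF i] q])
  qed (intro c.hom_closed ab; assumption)+
  also have "comm_prod ?Q (\<lambda>i. ?c (a i)) (\<lambda>i. ?c (b i)) l = ?c (comm_prod G a b l)"
    by (rule hom_comm_prod[OF is_group Q.is_group hom, symmetric]) (use ab in auto)
  also have "\<dots> = \<one>\<^bsub>?Q\<^esub>" by (simp only: rel c.hom_one)
  finally have "?c (comm_prod G (\<lambda>i. a i [^] n) b l) = \<one>\<^bsub>?Q\<^esub>" by (simp only: Q.nat_pow_one)
  then show ?thesis using kernel comm_prod_closed ab by simp
qed

end

locale mapping_torus = group G for G (structure) +
  fixes \<psi> assumes \<psi>: "\<psi> \<in> auto G"
begin

abbreviation T where "T \<equiv> semidirect_int G \<psi>"

definition iter :: "int \<Rightarrow> 'a \<Rightarrow> 'a" where "iter k = \<psi> [^]\<^bsub>AutoGroup G\<^esub> k"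

lemma AutoGroup_simps: "carrier (AutoGroup G) = auto G"
  "f \<in> auto G \<Longrightarrow> g \<in> auto G \<Longrightarrow> x \<in> carrier G \<Longrightarrow> (f \<otimes>\<^bsub>AutoGroup G\<^esub> g) x = f (g x)"
  "x \<in> carrier G \<Longrightarrow> \<one>\<^bsub>AutoGroup G\<^esub> x = x"
  by (auto simp: AutoGroup_def BijGroup_def auto_def compose_def)

lemma iter_auto: "iter k \<in> auto G"
proof -
  interpret A: group "AutoGroup G" by (rule AutoGroup)
  have "\<psi> [^]\<^bsub>AutoGroup G\<^esub> k \<in> carrier (AutoGroup G)"
    by (rule A.int_pow_closed) (use \<psi> AutoGroup_simps(1) in simp)
  then show ?thesis unfolding iter_def AutoGroup_simps(1) .
qed

lemma iter_add: assumes "g \<in> carrier G" shows "iter (j + k) g = iter j (iter k g)"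
proof -
  interpret A: group "AutoGroup G" by (rule AutoGroup)
  have "iter (j + k) = iter j \<otimes>\<^bsub>AutoGroup G\<^esub> iter k"
    unfolding iter_def using \<psi> AutoGroup_simps(1) by (intro A.int_pow_mult) simp
  then show ?thesis using AutoGroup_simps(2)[OF iter_auto iter_auto assms] by simp
qed

lemma iter_0: "g \<in> carrier G \<Longrightarrow> iter 0 g = g"
  by (simp add: iter_def AutoGroup_simps)

lemma iter_1: "g \<in> carrier G \<Longrightarrow> iter 1 g = \<psi> g"
proof -
  interpret A: group "AutoGroup G" by (rule AutoGroup)
  show ?thesis unfolding iter_def using \<psi> AutoGroup_simps(1) by (simp add: A.int_pow_1)
qed

lemma iter_hom: "iter k \<in> hom G G"
  using iter_auto by (auto simp: auto_def)

sublocale iter: group_hom G G "iter k" for k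
  using iter_hom by (simp add: group_hom_def group_hom_axioms_def is_group)

lemma iter_comm: "g \<in> carrier G \<Longrightarrow> h \<in> carrier G \<Longrightarrow> iter k (comm G g h) = comm G (iter k g) (iter k h)"
  by (simp add: comm_def)

lemma iter_derived: "w \<in> derived G (carrier G) \<Longrightarrow> iter k w \<in> derived G (carrier G)"
  by (induction w rule: derived_induct)
    (use derived_sub in \<open>auto simp: derived_one iter_comm comm_derived derived_is_subgroup subgroup.m_inv_closed
      subgroup.m_closed subset_iff\<close>)

lemma T_simps: "carrier T = carrier G \<times> UNIV" "(g, m) \<otimes>\<^bsub>T\<^esub> (h, n) = (g \<otimes> iter m h, m + n)" "\<one>\<^bsub>T\<^esub> = (\<one>, 0)"
  by (simp_all add: semidirect_int_def iter_def)

lemma group_T: "group T"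
proof (rule groupI)
  fix p assume "p \<in> carrier T"
  then obtain g m where p: "p = (g, m)" "g \<in> carrier G" by (auto simp: T_simps)
  then show "\<exists>q\<in>carrier T. q \<otimes>\<^bsub>T\<^esub> p = \<one>\<^bsub>T\<^esub>"
    by (intro bexI[of _ "(iter (- m) (inv g), - m)"]) (auto simp: T_simps)
qed (auto simp: T_simps m_assoc iter_add iter_0)

sublocale T: group T by (rule group_T)

lemma inv_T: "g \<in> carrier G \<Longrightarrow> inv\<^bsub>T\<^esub> (g, m) = (iter (- m) (inv g), - m)"
  by (rule T.inv_equality) (auto simp: T_simps)

lemma fibre_hom: "(\<lambda>g. (g, 0)) \<in> hom G T"
  by (auto simp: hom_def T_simps iter_0)

lemma iter_cancel: "g \<in> carrier G \<Longrightarrow> iter m (iter (- m) g) = g"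
  using iter_add[of g m "- m"] by (simp add: iter_0)

lemma conj_T:
  assumes "g \<in> carrier G" "w \<in> carrier G"
  shows "(g, m) \<otimes>\<^bsub>T\<^esub> (w, 0) \<otimes>\<^bsub>T\<^esub> inv\<^bsub>T\<^esub> (g, m) = (g \<otimes> iter m w \<otimes> inv g, 0)"
  using assms by (simp add: inv_T T_simps iter_cancel)

lemma N_sub_eq: "N_sub G \<psi> = derived G (carrier G) \<times> {0}"
proof -
  have sub: "subgroup (derived G (carrier G)) G" by (rule derived_is_subgroup) simp
  have one: "\<one>\<^bsub>abelianized_semidirect G \<psi>\<^esub> = (derived G (carrier G), 0)"
    by (simp add: abelianized_semidirect_def semidirect_int_def FactGroup_def)
  have "derived G (carrier G) #> g = derived G (carrier G) \<longleftrightarrow> g \<in> derived G (carrier G)" if "g \<in> carrier G" for g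
    using that sub coset_join1[of "derived G (carrier G)" g] coset_join2[of g "derived G (carrier G)"] derived_sub by auto
  then show ?thesis using derived_sub by (auto simp: N_sub_def kernel_def proj_def one T_simps)
qed

lemma N_normal: "N_sub G \<psi> \<lhd> T"
proof -
  have sub: "subgroup (derived G (carrier G)) G" by (rule derived_is_subgroup) simp
  interpret N: normal "derived G (carrier G)" G by (rule derived_self_is_normal)
  have d: "w \<in> carrier G" if "w \<in> derived G (carrier G)" for w using that derived_sub by auto
  show ?thesis
    unfolding N_sub_eq
  proof (rule T.normal_invI)
    show "subgroup (derived G (carrier G) \<times> {0}) T"
    proof (rule T.subgroupI)
      show "derived G (carrier G) \<times> {0} \<noteq> {}" using derived_one by blast
    qed (use d in \<open>auto simp: T_simps inv_T iter_0 subgroup.m_closed[OF sub] subgroup.m_inv_closed[OF sub]\<close>)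
    fix p h :: "'a \<times> int" assume "p \<in> carrier T" "h \<in> derived G (carrier G) \<times> {0}"
    then obtain g m w where p: "p = (g, m)" "g \<in> carrier G" "h = (w, 0)" "w \<in> derived G (carrier G)" by (auto simp: T_simps)
    then show "p \<otimes>\<^bsub>T\<^esub> h \<otimes>\<^bsub>T\<^esub> inv\<^bsub>T\<^esub> p \<in> derived G (carrier G) \<times> {0}"
      using conj_T[of g w m] N.inv_op_closed2[OF p(2) iter_derived[OF p(4)]] d by simp
  qed
qed

subsection \<open>Averaging along the monodromy\<close>

context
  fixes D :: int and E \<beta>
  assumes q: "quasi_form G D E \<beta>"
    and inv: "\<And>g h. g \<in> carrier G \<Longrightarrow> h \<in> carrier G \<Longrightarrow> E (\<psi> g) (\<psi> h) = E g h"
begin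

lemma iter_invariant:
  assumes "g \<in> carrier G" "h \<in> carrier G" shows "E (iter k g) (iter k h) = E g h"
proof (induction k rule: int_induct[where k = 0])
  case base
  then show ?case using assms by (simp add: iter_0)
next
  case (step1 k)
  then show ?case using assms inv[of "iter k g" "iter k h"] iter_add[of _ 1 k] by (simp add: iter_1 add.commute)
next
  case (step2 k)
  then show ?case using assms inv[of "iter (k - 1) g" "iter (k - 1) h"] iter_add[of _ 1 "k - 1"] by (simp add: iter_1)
qed

lemma displacement_quasi:
  assumes "g \<in> carrier G" "h \<in> carrier G"
  shows "\<bar>(\<beta> (iter k (g \<otimes> h)) - \<beta> (g \<otimes> h)) - (\<beta> (iter k g) - \<beta> g) - (\<beta> (iter k h) - \<beta> h)\<bar> \<le> 2 * D"
  using quasi_formD(1)[OF q assms] quasi_formD(1)[OF q, of "iter k g" "iter k h"] iter_invariant[OF assms] assms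
  by simp

text \<open>The coboundary of \<open>\<beta> \<circ> \<psi>\<^sup>k - \<beta>\<close> is bounded independently of \<open>k\<close>, because the form is
  invariant. Hence the orbits of the commutator subgroup have bounded \<open>\<beta>\<close>.\<close>

lemma displacement_bounded:
  assumes "w \<in> derived G (carrier G)" shows "\<exists>C. \<forall>k. \<bar>\<beta> (iter k w) - \<beta> w\<bar> \<le> C"
  using assms
proof (induction w rule: derived_induct)
  case one
  then show ?case by (intro exI[of _ 0]) simp
next
  case (comm g h)
  show ?case
  proof (intro exI allI)
    fix k
    show "\<bar>\<beta> (iter k (comm G g h)) - \<beta> (comm G g h)\<bar> \<le> 6 * D"
      using displacement_quasi[of "comm G g h" "h \<otimes> g" k] displacement_quasi[OF comm, of k]
        displacement_quasi[OF comm(2,1), of k] comm by (simp add: comm_mult) 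
  qed
next
  case (inv w)
  then obtain C where C: "\<And>k. \<bar>\<beta> (iter k w) - \<beta> w\<bar> \<le> C" by blast
  show ?case
  proof (intro exI allI)
    fix k
    show "\<bar>\<beta> (iter k (inv w)) - \<beta> (inv w)\<bar> \<le> C + 2 * D"
      using displacement_quasi[of w "inv w" k] C[of k] inv by simp
  qed
next
  case (mult v w)
  then obtain C C' where C: "\<And>k. \<bar>\<beta> (iter k v) - \<beta> v\<bar> \<le> C" "\<And>k. \<bar>\<beta> (iter k w) - \<beta> w\<bar> \<le> C'" by blast
  have vw: "v \<in> carrier G" "w \<in> carrier G" using mult derived_sub by auto
  show ?case
  proof (intro exI allI)
    fix k
    show "\<bar>\<beta> (iter k (v \<otimes> w)) - \<beta> (v \<otimes> w)\<bar> \<le> C + C' + 2 * D"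
      using displacement_quasi[OF vw, of k] C(1)[of k] C(2)[of k] by linarith
  qed
qed

text \<open>The left-hand argument without \<open>X\<close> is the mixed commutator of \<open>(g, m)\<close> and \<open>(w, 0)\<close>. Six errors of size
  \<open>D\<close> arise: two for the conjugation, two for the inverse and two for the products.\<close>

lemma mixed_commutator_value:
  assumes g: "g \<in> carrier G" and w: "w \<in> derived G (carrier G)" and X: "X \<in> carrier G"
  shows "\<beta> (iter k (g \<otimes> iter m w \<otimes> inv g \<otimes> inv w \<otimes> X)) \<le> (\<beta> (iter (k + m) w) - \<beta> (iter k w)) + \<beta> (iter k X) + 6 * D"
proof -
  have wG: "w \<in> carrier G" using w derived_sub by auto
  interpret N: normal "derived G (carrier G)" G by (rule derived_self_is_normal)
  let ?g = "iter k g" and ?v = "iter (k + m) w" and ?w = "iter k w"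
  have v: "?v \<in> derived G (carrier G)" "?w \<in> derived G (carrier G)" using w by (simp_all add: iter_derived)
  have c: "?g \<otimes> ?v \<otimes> inv ?g \<in> derived G (carrier G)" using g v by (intro N.inv_op_closed2) auto
  have c': "?g \<otimes> ?v \<otimes> inv ?g \<otimes> inv ?w \<in> derived G (carrier G)" by (rule N.m_closed[OF c N.m_inv_closed[OF v(2)]])
  have "iter k (g \<otimes> iter m w \<otimes> inv g \<otimes> inv w \<otimes> X) = (?g \<otimes> ?v \<otimes> inv ?g) \<otimes> inv ?w \<otimes> iter k X"
    using g wG X by (simp add: iter_add)
  moreover have "\<bar>\<beta> ((?g \<otimes> ?v \<otimes> inv ?g) \<otimes> inv ?w \<otimes> iter k X) - \<beta> ((?g \<otimes> ?v \<otimes> inv ?g) \<otimes> inv ?w) - \<beta> (iter k X)\<bar> \<le> D"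
    using c' g X wG by (intro quasi_form_derived[OF q] disjI1) auto
  moreover have "\<bar>\<beta> ((?g \<otimes> ?v \<otimes> inv ?g) \<otimes> inv ?w) - \<beta> (?g \<otimes> ?v \<otimes> inv ?g) - \<beta> (inv ?w)\<bar> \<le> D"
    using c g wG by (intro quasi_form_derived[OF q] disjI1) auto
  moreover have "\<bar>\<beta> (?g \<otimes> ?v \<otimes> inv ?g) - \<beta> ?v\<bar> \<le> 2 * D" using quasi_form_conj[OF q v(1)] g by simp
  moreover have "\<bar>\<beta> (inv ?w) + \<beta> ?w\<bar> \<le> 2 * D" by (rule quasi_form_inv[OF q v(2)])
  ultimately show ?thesis by simp
qed

text \<open>Each mixed commutator contributes a telescoping sum, which stays bounded in \<open>n\<close>, and \<open>n\<close> errors of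
  size \<open>6 * D\<close>.\<close>

lemma list_prod_average:
  assumes "set cs \<subseteq> mixed_commutators T (N_sub G \<psi>)"
  shows "\<exists>X. list_prod T cs = (X, 0) \<and> X \<in> carrier G \<and>
     (\<exists>C. \<forall>n::nat. (\<Sum>k<n. \<beta> (iter (int k) X)) \<le> int n * ((6 * int (length cs) + 1) * D) + C)"
  using assms
proof (induction cs)
  case Nil
  have "(\<Sum>k<n. \<beta> (iter (int k) \<one>)) \<le> int n * D" for n :: nat
    using quasi_form_one[OF q] by (simp add: mult_left_mono)
  then show ?case by (intro exI[of _ \<one>]) (auto simp: T_simps intro!: exI[of _ 0])
next
  case (Cons c cs)
  then obtain X C where X: "list_prod T cs = (X, 0)" "X \<in> carrier G"
    and C: "\<And>n::nat. (\<Sum>k<n. \<beta> (iter (int k) X)) \<le> int n * ((6 * int (length cs) + 1) * D) + C" by auto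
  obtain g m w where gw: "g \<in> carrier G" "w \<in> derived G (carrier G)" "c = comm T (g, m) (w, 0)"
    using Cons.prems by (auto simp: T.mixed_commutators_eq N_sub_eq T_simps)
  have wG: "w \<in> carrier G" using gw derived_sub by auto
  let ?Y = "g \<otimes> iter m w \<otimes> inv g \<otimes> inv w \<otimes> X"
  have "list_prod T (c # cs) = (?Y, 0)"
    using gw(1) wG X by (simp add: gw(3) comm_def conj_T inv_T iter_0 iter_cancel T_simps(2))
  moreover have "?Y \<in> carrier G" using gw(1) wG X by simp
  moreover have "\<exists>C. \<forall>n::nat. (\<Sum>k<n. \<beta> (iter (int k) ?Y)) \<le> int n * ((6 * int (length (c # cs)) + 1) * D) + C"
  proof -
    obtain B where B: "\<And>k. \<bar>\<beta> (iter k w) - \<beta> w\<bar> \<le> B" using displacement_bounded[OF gw(2)] by blast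
    have "\<bar>\<beta> (iter k w)\<bar> \<le> B + \<bar>\<beta> w\<bar>" for k using B[of k] by linarith
    then obtain C' where C': "\<And>n::nat. (\<Sum>k<n. \<beta> (iter (int k + m) w) - \<beta> (iter (int k) w)) \<le> C'"
      using bounded_telescope[of "\<lambda>k. \<beta> (iter k w)" "B + \<bar>\<beta> w\<bar>" m] by blast
    have "(\<Sum>k<n. \<beta> (iter (int k) ?Y)) \<le> int n * ((6 * int (length (c # cs)) + 1) * D) + (C + C')" for n :: nat
    proof -
      have "(\<Sum>k<n. \<beta> (iter (int k) ?Y)) \<le>
          (\<Sum>k<n. (\<beta> (iter (int k + m) w) - \<beta> (iter (int k) w)) + \<beta> (iter (int k) X) + 6 * D)"
        by (rule sum_mono) (rule mixed_commutator_value[OF gw(1,2) X(2)])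
      also have "\<dots> = (\<Sum>k<n. \<beta> (iter (int k + m) w) - \<beta> (iter (int k) w)) + (\<Sum>k<n. \<beta> (iter (int k) X)) + int n * (6 * D)"
        by (simp add: sum.distrib)
      finally show ?thesis using C[of n] C'[of n] by (simp add: algebra_simps)
    qed
    then show ?thesis by blast
  qed
  ultimately show ?case by blast
qed

lemma length_lower_bound:
  assumes "set cs \<subseteq> mixed_commutators T (N_sub G \<psi>)" "list_prod T cs = (X, 0)" and low: "\<And>k. L \<le> \<beta> (iter k X)"
  shows "L \<le> (6 * int (length cs) + 1) * D"
proof (rule ccontr)
  let ?R = "(6 * int (length cs) + 1) * D"
  assume "\<not> L \<le> ?R"
  obtain C where C: "\<And>n::nat. (\<Sum>k<n. \<beta> (iter (int k) X)) \<le> int n * ?R + C"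
    using list_prod_average[OF assms(1)] assms(2) by auto
  define n where "n = nat (\<bar>C\<bar> + 1)"
  have "int n * L = (\<Sum>k<n. L)" by simp
  also have "\<dots> \<le> (\<Sum>k<n. \<beta> (iter (int k) X))" by (rule sum_mono) (rule low)
  also have "\<dots> \<le> int n * ?R + C" by (rule C)
  finally have "int n * (L - ?R) \<le> C" by (simp add: algebra_simps)
  moreover have "int n * 1 \<le> int n * (L - ?R)" using \<open>\<not> L \<le> ?R\<close> by (intro mult_left_mono) auto
  ultimately have "int n \<le> C" by linarith
  then show False by (simp add: n_def)
qed

lemma mixed_scl_lower_bound:
  assumes D: "D \<ge> 1" and w: "(w, 0) \<in> mixed_commutator_subgroup T (N_sub G \<psi>)" "w \<in> derived G (carrier G)"
    and low: "\<And>k. L \<le> \<beta> (iter k w)"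
  shows "real_of_int (L - D) / real_of_int (6 * D) \<le> mixed_scl T (N_sub G \<psi>) (w, 0)"
proof (rule T.mixed_scl_ge[OF N_normal w(1)])
  fix m :: nat and cs
  assume cs: "set cs \<subseteq> mixed_commutators T (N_sub G \<psi>)" "list_prod T cs = (w, 0) [^]\<^bsub>T\<^esub> m"
  have wG: "w \<in> carrier G" using w(2) derived_sub by auto
  have pow: "(w, 0) [^]\<^bsub>T\<^esub> m = (w [^] m, 0)" for m :: nat
    by (induction m) (use wG in \<open>auto simp: T_simps iter_0\<close>)
  have "int m * L - (int m + 1) * D \<le> \<beta> (iter k (w [^] m))" for k
  proof -
    have "int m * L \<le> int m * \<beta> (iter k w)" by (rule mult_left_mono[OF low]) simp
    then show ?thesis using quasi_form_pow[OF q iter_derived[OF w(2)], of k m] wG by (simp add: iter.hom_nat_pow)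
  qed
  from length_lower_bound[OF cs(1) cs(2)[unfolded pow] this]
  have "(L - D) * int m - 2 * D \<le> 6 * D * int (length cs)" by (simp add: algebra_simps)
  then have "real_of_int ((L - D) * int m - 2 * D) \<le> real_of_int (6 * D * int (length cs))" by (simp only: of_int_le_iff)
  then show "real_of_int (L - D) / real_of_int (6 * D) * real m - 1 / 3 \<le> real (length cs)"
    using D by (simp add: field_simps)
qed

text \<open>The witnesses are the products of \<open>[a\<^sub>i\<^sup>n, b\<^sub>i]\<close>: the form makes \<open>\<beta>\<close> grow like \<open>2 l n\<close> on their whole
  \<open>\<psi>\<close>-orbit, while the number of commutators stays equal to \<open>l\<close>.\<close>

lemma not_scl_equivalent:
  assumes D: "D \<ge> 1" and l: "l \<ge> 1"
    and ab: "\<And>i. i < l \<Longrightarrow> a i \<in> carrier G" "\<And>i. i < l \<Longrightarrow> b i \<in> carrier G"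
    and rel: "comm_prod G a b l = \<one>"
    and E: "\<And>i. i < l \<Longrightarrow> E (a i) (b i) - E (b i) (a i) = 2"
  shows "\<not> scl_equivalent T (N_sub G \<psi>)"
proof
  assume "scl_equivalent T (N_sub G \<psi>)"
  then obtain C where C: "\<And>x. x \<in> mixed_commutator_subgroup T (N_sub G \<psi>) \<Longrightarrow> mixed_scl T (N_sub G \<psi>) x \<le> C * scl T x" "C > 0"
    by (auto simp: scl_equivalent_def)
  let ?K = "(4 * int l + 1) * D"
  have bound: "real_of_int (2 * int n * int l - ?K - D) \<le> 6 * real_of_int D * (C * real l)" for n :: nat
  proof -
    define w where "w = comm_prod G (\<lambda>i. a i [^] n) b l"
    have w: "w \<in> derived G (carrier G)" unfolding w_def using ab by (intro comm_prod_derived) auto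
    have lift: "(comm_prod G f h l, 0) = comm_prod T (\<lambda>i. (f i, 0)) (\<lambda>i. (h i, 0)) l"
      if "\<And>i. i < l \<Longrightarrow> f i \<in> carrier G" "\<And>i. i < l \<Longrightarrow> h i \<in> carrier G" for f h
      by (rule hom_comm_prod[OF is_group group_T fibre_hom]) (use that in auto)
    have pow: "(g, 0) [^]\<^bsub>T\<^esub> n = (g [^] n, 0)" if "g \<in> carrier G" for g and n :: nat
      by (induction n) (use that in \<open>auto simp: T_simps iter_0\<close>)
    have "comm_prod T (\<lambda>i. (a i, 0) [^]\<^bsub>T\<^esub> n) (\<lambda>i. (b i, 0)) l \<in> mixed_commutator_subgroup T (N_sub G \<psi>)"
    proof (rule T.powered_relation[OF N_normal])
      show "comm T (a i, 0) (b i, 0) \<in> N_sub G \<psi>" if "i < l" for i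
      proof -
        have "comm T (a i, 0) (b i, 0) = (comm G (a i) (b i), 0)"
          using ab that by (simp add: comm_def T_simps inv_T iter_0)
        then show ?thesis using ab that by (simp add: N_sub_eq comm_derived)
      qed
      show "comm_prod T (\<lambda>i. (a i, 0)) (\<lambda>i. (b i, 0)) l = \<one>\<^bsub>T\<^esub>"
        unfolding T_simps rel[symmetric] by (rule lift[symmetric]) (use ab in auto)
    qed (use ab in \<open>auto simp: T_simps\<close>)
    also have "comm_prod T (\<lambda>i. (a i, 0) [^]\<^bsub>T\<^esub> n) (\<lambda>i. (b i, 0)) l = comm_prod T (\<lambda>i. (a i [^] n, 0)) (\<lambda>i. (b i, 0)) l"
      by (rule comm_prod_cong) (simp add: pow ab)
    also have "\<dots> = (w, 0)" unfolding w_def by (rule lift[symmetric]) (use ab in auto)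
    finally have mem: "(w, 0) \<in> mixed_commutator_subgroup T (N_sub G \<psi>)" .
    have "\<exists>cs. length cs = l \<and> set cs \<subseteq> mixed_commutators T (carrier T) \<and> list_prod T cs = comm_prod T (\<lambda>i. (a i [^] n, 0)) (\<lambda>i. (b i, 0)) l"
      by (rule T.comm_prod_list) (use ab in \<open>auto simp: T_simps\<close>)
    then have "scl T (w, 0) \<le> real l"
      using T.scl_le_length \<open>comm_prod T (\<lambda>i. (a i [^] n, 0)) (\<lambda>i. (b i, 0)) l = (w, 0)\<close> by metis
    then have "mixed_scl T (N_sub G \<psi>) (w, 0) \<le> C * real l"
      using C(1)[OF mem] mult_left_mono[of "scl T (w, 0)" "real l" C] C(2) by linarith
    moreover have "2 * int n * int l - ?K \<le> \<beta> (iter k w)" for k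
    proof -
      have "iter k w = comm_prod G (\<lambda>i. iter k (a i [^] n)) (\<lambda>i. iter k (b i)) l"
        unfolding w_def by (rule hom_comm_prod[OF is_group is_group iter_hom]) (use ab in auto)
      moreover have "\<bar>\<beta> (comm_prod G (\<lambda>i. iter k (a i [^] n)) (\<lambda>i. iter k (b i)) l) -
          (\<Sum>i<l. E (iter k (a i [^] n)) (iter k (b i)) - E (iter k (b i)) (iter k (a i [^] n)))\<bar> \<le> ?K"
        by (rule quasi_form_comm_prod[OF q]) (use ab in auto)
      moreover have "(\<Sum>i<l. E (iter k (a i [^] n)) (iter k (b i)) - E (iter k (b i)) (iter k (a i [^] n))) = (\<Sum>i<l. 2 * int n)"
      proof (rule sum.cong)
        fix i assume "i \<in> {..<l}"
        then have i: "i < l" by simp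
        have "E (a i [^] n) (b i) = int n * E (a i) (b i)" "E (b i) (a i [^] n) = int n * E (b i) (a i)"
          using additive_pow[of "\<lambda>g. E g (b i)" "a i" n] additive_pow[of "E (b i)" "a i" n] quasi_formD(2,3)[OF q] ab i by auto
        then show "E (iter k (a i [^] n)) (iter k (b i)) - E (iter k (b i)) (iter k (a i [^] n)) = 2 * int n"
          using E[OF i] ab i by (simp add: iter_invariant flip: right_diff_distrib)
      qed simp
      ultimately show ?thesis by (simp add: mult_ac)
    qed
    ultimately have "real_of_int (2 * int n * int l - ?K - D) / real_of_int (6 * D) \<le> C * real l"
      using mixed_scl_lower_bound[OF D mem w] by (meson order_trans)
    then show ?thesis using D by (simp add: field_simps)
  qed
  obtain n :: nat where n: "6 * real_of_int D * (C * real l) + real_of_int (?K + D) < real n"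
    using reals_Archimedean2 by blast
  have "real n * 1 \<le> real n * (2 * real l)" using l by (intro mult_left_mono) auto
  then show False using bound[of n] n by (simp add: algebra_simps)
qed

end

end

theorem theorem1p5:
  fixes l :: nat
    and S :: "'s::topological_space set" and s0 :: 's
    and X :: "'x::topological_space set" and p :: "'x \<Rightarrow> complex"
    and b0 :: complex and \<iota> :: "'s \<Rightarrow> 'x" and \<iota>' :: "'x \<Rightarrow> 's"
    and \<psi> :: "(real \<Rightarrow> 's) set \<Rightarrow> (real \<Rightarrow> 's) set"
    and \<Phi> :: "(real \<Rightarrow> 's) set \<times> int \<Rightarrow> (real \<Rightarrow> 'x) set"
  defines "G\<^sub>l \<equiv> fundamental_group S s0"
  defines "G\<^sub>\<psi> \<equiv> semidirect_int G\<^sub>l \<psi>"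
  defines "N\<^sub>\<psi> \<equiv> N_sub G\<^sub>l \<psi>"
  assumes "l \<ge> 2"
    and "closed_surface_of_genus l S" and "s0 \<in> S"
    and "closed_hyperbolic_3_manifold X"
    and "fibre_bundle X p (sphere 0 1) S"
    and "b0 \<in> sphere 0 1" and "homeomorphism S (X \<inter> p -` {b0}) \<iota> \<iota>'"
    and "\<psi> \<in> Aut_plus G\<^sub>l"
    and "\<Phi> \<in> iso G\<^sub>\<psi> (fundamental_group X (\<iota> s0))"
    and "\<And>\<gamma>. \<gamma> \<in> carrier G\<^sub>l \<Longrightarrow> \<Phi> (\<gamma>, 0) = fundamental_group_map X \<iota> \<gamma>"
  shows "\<not> scl_equivalent G\<^sub>\<psi> N\<^sub>\<psi>"
  proof -
  note surface = \<open>closed_surface_of_genus l S\<close> and orientation = \<open>\<psi> \<in> Aut_plus G\<^sub>l\<close>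
  have l: "l \<ge> 1" using \<open>l \<ge> 2\<close> by simp
  interpret group G\<^sub>l unfolding G\<^sub>l_def by (rule group_fundamental_group[OF \<open>s0 \<in> S\<close>])
  interpret mapping_torus G\<^sub>l \<psi>
    using orientation by unfold_locales (simp add: Aut_plus_def)
  from surface_group_presentation[OF surface \<open>s0 \<in> S\<close> l, folded G\<^sub>l_def]
  obtain a b where ab: "\<forall>i<l. a i \<in> carrier G\<^sub>l \<and> b i \<in> carrier G\<^sub>l"
    and rel: "comm_prod G\<^sub>l a b l = \<one>\<^bsub>G\<^sub>l\<^esub>"
    and gens: "carrier G\<^sub>l = generate G\<^sub>l (a ` {..<l} \<union> b ` {..<l})"
    and homs: "\<forall>(\<Gamma> :: extension set monoid) A B. group \<Gamma> \<longrightarrow> (\<forall>j. A j \<in> carrier \<Gamma> \<and> B j \<in> carrier \<Gamma>) \<longrightarrow>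
       comm_prod \<Gamma> A B l = \<one>\<^bsub>\<Gamma>\<^esub> \<longrightarrow> (\<exists>\<rho>\<in>hom G\<^sub>l \<Gamma>. \<forall>i<l. \<rho> (a i) = A i \<and> \<rho> (b i) = B i)"
    by (elim exE conjE)
  have ab': "a i \<in> carrier G\<^sub>l" "b i \<in> carrier G\<^sub>l" if "i < l" for i using ab that by auto
  have hom: "\<exists>\<rho>\<in>hom G\<^sub>l \<Gamma>. \<forall>i<l. \<rho> (a i) = A i \<and> \<rho> (b i) = B i"
    if "group \<Gamma>" "\<And>j. A j \<in> carrier \<Gamma>" "\<And>j. B j \<in> carrier \<Gamma>" "comm_prod \<Gamma> A B l = \<one>\<^bsub>\<Gamma>\<^esub>"
    for \<Gamma> :: "extension set monoid" and A B
    using that by (intro homs[rule_format]) simp_all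
  obtain x y :: "(real \<Rightarrow> 's) set \<Rightarrow> nat \<Rightarrow> int" and \<beta> :: "(real \<Rightarrow> 's) set \<Rightarrow> int" where
    x: "\<And>g h i. g \<in> carrier G\<^sub>l \<Longrightarrow> h \<in> carrier G\<^sub>l \<Longrightarrow> x (g \<otimes>\<^bsub>G\<^sub>l\<^esub> h) i = x g i + x h i"
    and y: "\<And>g h i. g \<in> carrier G\<^sub>l \<Longrightarrow> h \<in> carrier G\<^sub>l \<Longrightarrow> y (g \<otimes>\<^bsub>G\<^sub>l\<^esub> h) i = y g i + y h i"
    and coordinates: "\<And>i j. i < l \<Longrightarrow> x (a i) j = (if j = i then 1 else 0)" "\<And>i j. i < l \<Longrightarrow> x (b i) j = 0"
      "\<And>i j. i < l \<Longrightarrow> y (a i) j = 0" "\<And>i j. i < l \<Longrightarrow> y (b i) j = (if j = i then 1 else 0)"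
    and \<beta>: "\<And>g h. g \<in> carrier G\<^sub>l \<Longrightarrow> h \<in> carrier G\<^sub>l \<Longrightarrow>
      \<bar>\<beta> (g \<otimes>\<^bsub>G\<^sub>l\<^esub> h) - \<beta> g - \<beta> h + (\<Sum>i<l. x g i * y h i)\<bar> \<le> int l"
    by (rule euler_data[OF is_group \<open>l \<ge> 2\<close>, of a b]) (assumption | rule ab' hom | rule that)+
  have add: "additive G\<^sub>l (\<lambda>g. x g i)" "additive G\<^sub>l (\<lambda>g. y g i)" for i
    by (simp_all add: additive_def x y)
  obtain E \<beta>' where E: "quasi_form G\<^sub>l (2 * int l) E \<beta>'"
    "\<And>g h. g \<in> carrier G\<^sub>l \<Longrightarrow> h \<in> carrier G\<^sub>l \<Longrightarrow> E (\<psi> g) (\<psi> h) = E g h"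
    "\<And>i. i < l \<Longrightarrow> E (a i) (b i) - E (b i) (a i) = 2"
    by (rule invariant_quasi_form[where l = l and a = a and b = b and x = x and y = y and \<beta> = \<beta> and D = "int l" and \<psi> = \<psi>])
      (assumption | rule ab' rel gens add coordinates orientation \<beta> | rule that)+
  show ?thesis unfolding G\<^sub>\<psi>_def N\<^sub>\<psi>_def
  proof (rule not_scl_equivalent[OF E(1)])
    show "1 \<le> 2 * int l" using l by simp
  qed (assumption | rule E ab' rel l)+
qed

end
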